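(* Let $W$ be a complex reflection group with braid group $B$ and pure braid group $P$, and let $d$ be a regular number for $W$. If $B/(P,P)$ has an element of order $d$ whose image in $W$ is regular, then $d$ is freely regular.
   Context: A complex reflection group is a finite subgroup $W<\mathrm{GL}_n(\mathbf{C})$ generated by (pseudo-)reflections, i.e. elements $\neq 1$ fixing pointwise a hyperplane. $\mathcal{A}$ is the set of reflecting hyperplanes of $W$, and $X=\mathbf{C}^n\setminus\bigcup\mathcal{A}$. The group $W$ acts freely on $X$; $P=\pi_1(X)$ (pure braid group) and $B=\pi_1(X/W)$ (braid group), so there is an exact sequence $1\to P\to B\to W\to 1$. $(P,P)$ is the commutator subgroup of $P$. If $w\in W$ has an eigenvector $x\in X$, with eigenvalue of (multiplicative) order $d$, then $w$ is called a regular element and $d$ a regular number for $W$; such a $w$ necessarily has order $d$. One says that $w$ and $d$ are freely regular if in addition the cyclic group $\langle w\rangle$ acts freely on the set $\mathcal{A}$. *)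

theory Defs
  imports "HOL-Analysis.Analysis" "HOL-Algebra.Generated_Groups" "HOL-Algebra.Multiplicative_Group"
begin

section \<open>Fundamental groups of abstract topological spaces\<close>

text \<open>
  Orbit spaces are abstract topologies, not type class instances, so the constants
  \<open>pathstart\<close>, \<open>+++\<close> and \<open>homotopic_paths\<close> do not apply to them;
  the following are their counterparts for \<open>'a topology\<close>.
\<close>

definition quotient_topology :: "'a topology \<Rightarrow> ('a \<Rightarrow> 'b) \<Rightarrow> 'b topology" where
  "quotient_topology T f =
     topology (\<lambda>U. U \<subseteq> f ` topspace T \<and> openin T {x \<in> topspace T. f x \<in> U})"

lemma openin_quotient_topology:
  "openin (quotient_topology T f) U \<longleftrightarrow>
     U \<subseteq> f ` topspace T \<and> openin T {x \<in> topspace T. f x \<in> U}"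
proof -
  have "istopology (\<lambda>U. U \<subseteq> f ` topspace T \<and> openin T {x \<in> topspace T. f x \<in> U})"
    unfolding istopology_def
  proof (intro conjI allI impI)
    fix S U
    assume S: "S \<subseteq> f ` topspace T \<and> openin T {x \<in> topspace T. f x \<in> S}"
      and U: "U \<subseteq> f ` topspace T \<and> openin T {x \<in> topspace T. f x \<in> U}"
    show "S \<inter> U \<subseteq> f ` topspace T" using S by blast
    have "{x \<in> topspace T. f x \<in> S \<inter> U} = {x \<in> topspace T. f x \<in> S} \<inter> {x \<in> topspace T. f x \<in> U}"
      by blast
    then show "openin T {x \<in> topspace T. f x \<in> S \<inter> U}" using S U by (simp add: openin_Int)
  next
    fix K
    assume K: "\<forall>S\<in>K. S \<subseteq> f ` topspace T \<and> openin T {x \<in> topspace T. f x \<in> S}"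
    show "\<Union>K \<subseteq> f ` topspace T" using K by blast
    have eq: "{x \<in> topspace T. f x \<in> \<Union>K} = (\<Union>S\<in>K. {x \<in> topspace T. f x \<in> S})"
      by blast
    show "openin T {x \<in> topspace T. f x \<in> \<Union>K}"
      unfolding eq using K by (intro openin_Union) blast
  qed
  then show ?thesis by (simp add: quotient_topology_def)
qed

lemma topspace_quotient_topology: "topspace (quotient_topology T f) = f ` topspace T"
proof
  show "topspace (quotient_topology T f) \<subseteq> f ` topspace T"
    using openin_topspace[of "quotient_topology T f"] unfolding openin_quotient_topology by blast
  have "{x \<in> topspace T. f x \<in> f ` topspace T} = topspace T" by blast
  then have "openin (quotient_topology T f) (f ` topspace T)"
    by (simp add: openin_quotient_topology)
  then show "f ` topspace T \<subseteq> topspace (quotient_topology T f)"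
    by (rule openin_subset)
qed

lemma quotient_map_quotient_topology: "quotient_map T (quotient_topology T f) f"
  unfolding quotient_map_def topspace_quotient_topology openin_quotient_topology by blast

definition loop_at :: "'a topology \<Rightarrow> 'a \<Rightarrow> (real \<Rightarrow> 'a) \<Rightarrow> bool" where
  "loop_at T a p \<longleftrightarrow> pathin T p \<and> p 0 = a \<and> p 1 = a"

definition join_loops :: "(real \<Rightarrow> 'a) \<Rightarrow> (real \<Rightarrow> 'a) \<Rightarrow> real \<Rightarrow> 'a" where
  "join_loops p q = (\<lambda>t. if t \<le> 1/2 then p (2 * t) else q (2 * t - 1))"

definition homotopic_loops_at :: "'a topology \<Rightarrow> 'a \<Rightarrow> (real \<Rightarrow> 'a) \<Rightarrow> (real \<Rightarrow> 'a) \<Rightarrow> bool" where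
  "homotopic_loops_at T a = homotopic_with (\<lambda>r. r 0 = a \<and> r 1 = a) (top_of_set {0..1}) T"

definition fundamental_group :: "'a topology \<Rightarrow> 'a \<Rightarrow> (real \<Rightarrow> 'a) set monoid" where
  "fundamental_group T a =
     \<lparr>carrier = Collect (loop_at T a) // {(p, q). homotopic_loops_at T a p q},
      mult = (\<lambda>C D. {r. \<exists>p\<in>C. \<exists>q\<in>D. homotopic_loops_at T a (join_loops p q) r}),
      one = {r. homotopic_loops_at T a (\<lambda>_. a) r}\<rparr>"

definition fundamental_group_map ::
    "'b topology \<Rightarrow> 'b \<Rightarrow> ('a \<Rightarrow> 'b) \<Rightarrow> (real \<Rightarrow> 'a) set \<Rightarrow> (real \<Rightarrow> 'b) set" where
  "fundamental_group_map T b f C = {r. \<exists>p\<in>C. homotopic_loops_at T b (f \<circ> p) r}"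


section \<open>Complex reflection groups\<close>

definition GL :: "(complex^'n^'n) monoid" where
  "GL = \<lparr>carrier = {A. invertible A}, mult = (**), one = mat 1\<rparr>"

definition hyperplane :: "(complex^'n) set \<Rightarrow> bool" where
  "hyperplane H \<longleftrightarrow> vec.subspace H \<and> vec.dim H + 1 = CARD('n)"

definition fixes_pointwise :: "complex^'n^'n \<Rightarrow> (complex^'n) set \<Rightarrow> bool" where
  "fixes_pointwise g H \<longleftrightarrow> (\<forall>x\<in>H. g *v x = x)"

definition is_reflection :: "complex^'n^'n \<Rightarrow> bool" where
  "is_reflection r \<longleftrightarrow> invertible r \<and> r \<noteq> mat 1 \<and> (\<exists>H. hyperplane H \<and> fixes_pointwise r H)"

definition complex_reflection_group :: "(complex^'n^'n) set \<Rightarrow> bool" where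
  "complex_reflection_group W \<longleftrightarrow>
     subgroup W GL \<and> finite W \<and> W = generate GL {r \<in> W. is_reflection r}"

definition reflecting_hyperplanes :: "(complex^'n^'n) set \<Rightarrow> (complex^'n) set set" where
  "reflecting_hyperplanes W =
     {H. hyperplane H \<and> (\<exists>r\<in>W. is_reflection r \<and> fixes_pointwise r H)}"

definition hyperplane_complement :: "(complex^'n^'n) set \<Rightarrow> (complex^'n) set" where
  "hyperplane_complement W = UNIV - \<Union>(reflecting_hyperplanes W)"


section \<open>Braid groups\<close>

definition orbit_of :: "(complex^'n^'n) set \<Rightarrow> complex^'n \<Rightarrow> (complex^'n) set" where
  "orbit_of W x = (\<lambda>w. w *v x) ` W"

definition orbit_space :: "(complex^'n^'n) set \<Rightarrow> (complex^'n) set topology" where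
  "orbit_space W = quotient_topology (top_of_set (hyperplane_complement W)) (orbit_of W)"

definition pure_braid_group ::
    "(complex^'n^'n) set \<Rightarrow> complex^'n \<Rightarrow> (real \<Rightarrow> complex^'n) set monoid" where
  "pure_braid_group W x0 = fundamental_group (top_of_set (hyperplane_complement W)) x0"

definition braid_group ::
    "(complex^'n^'n) set \<Rightarrow> complex^'n \<Rightarrow> (real \<Rightarrow> (complex^'n) set) set monoid" where
  "braid_group W x0 = fundamental_group (orbit_space W) (orbit_of W x0)"

text \<open>The injection \<open>P \<rightarrow> B\<close>.\<close>

definition pure_to_braid ::
    "(complex^'n^'n) set \<Rightarrow> complex^'n \<Rightarrow> (real \<Rightarrow> complex^'n) set \<Rightarrow> (real \<Rightarrow> (complex^'n) set) set" where
  "pure_to_braid W x0 = fundamental_group_map (orbit_space W) (orbit_of W x0) (orbit_of W)"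

text \<open>
  The surjection \<open>B \<rightarrow> W\<close> with kernel \<open>P\<close>: lift a loop representing the braid to a path in
  the complement starting at \<open>x0\<close>; it ends at \<open>w *v x0\<close>, and \<open>w\<close> is unique because
  \<open>W\<close> acts freely on the complement. As \<open>join_loops p q\<close> runs through \<open>p\<close> first, this is a
  homomorphism.
\<close>

definition braid_to_group ::
    "(complex^'n^'n) set \<Rightarrow> complex^'n \<Rightarrow> (real \<Rightarrow> (complex^'n) set) set \<Rightarrow> complex^'n^'n" where
  "braid_to_group W x0 b =
     (THE w. w \<in> W \<and>
        (\<exists>g. pathin (top_of_set (hyperplane_complement W)) g \<and>
             g 0 = x0 \<and> g 1 = w *v x0 \<and> orbit_of W \<circ> g \<in> b))"

text \<open>The commutator subgroup \<open>(P,P)\<close>, viewed as a subgroup of \<open>B\<close>.\<close>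

definition pure_commutators ::
    "(complex^'n^'n) set \<Rightarrow> complex^'n \<Rightarrow> (real \<Rightarrow> (complex^'n) set) set set" where
  "pure_commutators W x0 =
     (let P = pure_braid_group W x0 in pure_to_braid W x0 ` derived P (carrier P))"

definition braid_quotient ::
    "(complex^'n^'n) set \<Rightarrow> complex^'n \<Rightarrow> (real \<Rightarrow> (complex^'n) set) set set monoid" where
  "braid_quotient W x0 = braid_group W x0 Mod pure_commutators W x0"

text \<open>The map \<open>B/(P,P) \<rightarrow> W\<close> induced by \<open>braid_to_group\<close>, which is constant on cosets of \<open>(P,P)\<close>.\<close>

definition braid_quotient_to_group ::
    "(complex^'n^'n) set \<Rightarrow> complex^'n \<Rightarrow> (real \<Rightarrow> (complex^'n) set) set set \<Rightarrow> complex^'n^'n" where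
  "braid_quotient_to_group W x0 c = the_elem (braid_to_group W x0 ` c)"


section \<open>Regular elements\<close>

definition has_mult_order :: "complex \<Rightarrow> nat \<Rightarrow> bool" where
  "has_mult_order z d \<longleftrightarrow> d > 0 \<and> z ^ d = 1 \<and> (\<forall>k. 0 < k \<and> k < d \<longrightarrow> z ^ k \<noteq> 1)"

definition regular_with_order :: "(complex^'n^'n) set \<Rightarrow> nat \<Rightarrow> complex^'n^'n \<Rightarrow> bool" where
  "regular_with_order W d w \<longleftrightarrow>
     w \<in> W \<and> (\<exists>x \<in> hyperplane_complement W. x \<noteq> 0 \<and>
                (\<exists>z. w *v x = z *s x \<and> has_mult_order z d))"

definition regular_element :: "(complex^'n^'n) set \<Rightarrow> complex^'n^'n \<Rightarrow> bool" where
  "regular_element W w \<longleftrightarrow> (\<exists>d. regular_with_order W d w)"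

definition regular_number :: "(complex^'n^'n) set \<Rightarrow> nat \<Rightarrow> bool" where
  "regular_number W d \<longleftrightarrow> (\<exists>w. regular_with_order W d w)"

definition acts_freely_on :: "(complex^'n^'n) set \<Rightarrow> (complex^'n) set set \<Rightarrow> bool" where
  "acts_freely_on G \<A> \<longleftrightarrow> (\<forall>g\<in>G. \<forall>H\<in>\<A>. (*v) g ` H = H \<longrightarrow> g = mat 1)"

definition freely_regular_number :: "(complex^'n^'n) set \<Rightarrow> nat \<Rightarrow> bool" where
  "freely_regular_number W d \<longleftrightarrow>
     (\<exists>w. regular_with_order W d w \<and>
          acts_freely_on (generate GL {w}) (reflecting_hyperplanes W))"

end

theory Submission
  imports Defs "HOL-Complex_Analysis.Complex_Analysis"
begin

text \<open>
  Let \<open>c\<close> have order \<open>d\<close> in \<open>B/(P,P)\<close>, represented by a braid \<open>b\<close> with image \<open>w \<in> W\<close>, and let \<open>x\<close>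
  be an eigenvector of \<open>w\<close> off the hyperplanes, with eigenvalue \<open>z\<close>. Write a reflecting hyperplane
  as the kernel of a linear form \<open>l\<close>. The argument rests on two facts.

  First, \<open>W\<close> acts freely on the complement \<open>X\<close> (Steinberg). Hence a power of \<open>w\<close> is trivial as
  soon as the same power of \<open>z\<close> is, and \<open>X \<rightarrow> X/W\<close> is a covering, so that a braid over \<open>w\<close> is a
  path in \<open>X\<close> from the base point \<open>x0\<close> to \<open>w x0\<close>.

  Second, a loop in \<open>X\<close> lies in \<open>(P,P)\<close> if and only if every form \<open>l\<close> has winding number \<open>0\<close> along
  it. In particular \<open>P/(P,P)\<close> has no torsion.

  If \<open>z\<close> has order \<open>d'\<close>, then \<open>b^d'\<close> is pure by the first fact, and it is a torsion element modulo
  \<open>(P,P)\<close>, because \<open>d'\<close> divides \<open>d\<close>. So it lies in \<open>(P,P)\<close>, whence \<open>d' = d\<close> and \<open>w\<close> is regular of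
  order \<open>d\<close>. Now let \<open>u = w^j\<close> stabilise the kernel of \<open>l\<close>, so that \<open>l \<circ> u\<close> is a multiple \<open>\<zeta> l\<close>.
  The braid \<open>b^j\<close> lifts to a path \<open>\<gamma>\<close> from \<open>x0\<close> to \<open>u x0\<close>, and its \<open>d\<close>-th power lifts to the
  concatenation of \<open>\<gamma>\<close>, \<open>u \<gamma>\<close>, ..., \<open>u^(d-1) \<gamma>\<close>. All these pieces have the same winding number for
  \<open>l\<close>, and the sum is \<open>0\<close> because \<open>b^(jd)\<close> lies in \<open>(P,P)\<close>. So \<open>l\<close> does not wind along \<open>\<gamma>\<close>, which
  forces \<open>l (u x0) = l x0\<close>, that is \<open>\<zeta> = 1\<close>. Evaluating \<open>l \<circ> u = l\<close> at \<open>x\<close> gives \<open>z^j = 1\<close>, hence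
  \<open>u = 1\<close>. This is \<open>torsion_imp_freely_regular\<close>.

  The theorem of Steinberg (\<open>steinberg\<close>) is proved by bounding a dual basis. By an argument of
  Chevalley the polynomials form a free module over the \<open>W\<close>-invariant ones
  (\<open>free_over_invariants\<close>). The basis dual to a homogeneous basis for the trace form consists of
  rational functions that are regular at every point with trivial stabiliser (\<open>trace_dual_basis\<close>).
  If some \<open>u \<noteq> 1\<close> fixed a point of \<open>X\<close>, then near that point the points with nontrivial stabiliser
  would have codimension at least two, so the dual basis would stay bounded by the maximum
  principle; but the duality relations at \<open>p\<close> and \<open>u p\<close> contradict each other in the limit.

  The statement on winding numbers (\<open>zero_winding_imp_derived\<close>) is proved by adding one hyperplane
  at a time. A homomorphism on the fundamental group of the smaller complement that is trivial on
  small loops around the new hyperplane is trivial on all loops that become contractible in the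
  larger complement (\<open>null_homotopic_killed\<close>), and the meridians of one hyperplane all agree in
  the abelianised group (\<open>meridian_exists\<close>).
\<close>

section \<open>Linear forms\<close>

definition lf :: "complex^'n \<Rightarrow> complex^'n \<Rightarrow> complex" where
  "lf l x = (\<Sum>i\<in>UNIV. l $ i * x $ i)"

lemma lf_add: "lf l (x + y) = lf l x + lf l y"
  by (simp add: lf_def sum.distrib algebra_simps)

lemma lf_diff: "lf l (x - y) = lf l x - lf l y"
  by (simp add: lf_def sum_subtractf algebra_simps)

lemma lf_scale: "lf l (c *s x) = c * lf l x"
  by (simp add: lf_def sum_distrib_left algebra_simps)

lemma lf_zero: "lf l 0 = 0"
  by (simp add: lf_def)

lemma lf_commute: "lf l x = lf x l"
  by (simp add: lf_def mult.commute)

lemma lf_axis: "lf l (axis i 1) = l $ i"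
proof -
  have "(\<Sum>j\<in>UNIV. l $ j * axis i 1 $ j) = (\<Sum>j\<in>UNIV. if j = i then l $ i else 0)"
    by (intro sum.cong) (auto simp: axis_def)
  then show ?thesis by (simp add: lf_def)
qed

lemma lf_eq_0_iff: "(\<forall>x. lf l x = 0) \<longleftrightarrow> l = 0"
  by (metis lf_axis lf_commute lf_zero vec_eq_iff zero_index)

lemma lf_nonzero_dual:
  assumes "l \<noteq> 0"
  obtains e where "lf l e = 1"
proof -
  obtain x where "lf l x \<noteq> 0" using assms lf_eq_0_iff by blast
  then have "lf l ((1 / lf l x) *s x) = 1" by (simp add: lf_scale)
  then show ?thesis using that by blast
qed

lemma continuous_on_vector_scalar_mult [continuous_intros]:
  fixes c :: "'a::topological_space \<Rightarrow> complex" and f :: "'a \<Rightarrow> complex^'n"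
  assumes "continuous_on S c" "continuous_on S f"
  shows "continuous_on S (\<lambda>x. c x *s f x)"
  unfolding vector_scalar_mult_def
  by (intro continuous_on_vec_lambda continuous_on_mult assms continuous_on_component)

lemma continuous_on_lf [continuous_intros]:
  fixes f :: "'a::topological_space \<Rightarrow> complex^'n"
  assumes "continuous_on S f"
  shows "continuous_on S (\<lambda>x. lf l (f x))"
  unfolding lf_def by (intro continuous_intros assms continuous_on_component)

lemma continuous_on_matrix_vector_mult [continuous_intros]:
  fixes f :: "'a::topological_space \<Rightarrow> complex^'n" and w :: "complex^'n^'n"
  assumes "continuous_on S f"
  shows "continuous_on S (\<lambda>x. w *v f x)"
  unfolding matrix_vector_mult_def
  by (intro continuous_on_vec_lambda continuous_intros assms continuous_on_component)

text \<open>A line that leaves the kernel of \<open>l\<close> meets it in one point only.\<close>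

lemma lf_nonzero_dense:
  fixes l x :: "complex^'n"
  assumes "l \<noteq> 0" "\<delta> > 0"
  obtains y where "dist x y < \<delta>" "lf l y \<noteq> 0"
proof (cases "lf l x = 0")
  case False
  then show ?thesis using that[of x] assms by simp
next
  case True
  obtain e where e: "lf l e = 1" using lf_nonzero_dual assms(1) by blast
  have "continuous_on UNIV (\<lambda>t::complex. x + t *s e)"
    by (intro continuous_intros)
  then have "((\<lambda>t::complex. x + t *s e) \<longlongrightarrow> x + 0 *s e) (at 0)"
    unfolding continuous_on_def by blast
  then have "\<forall>\<^sub>F t in at 0. dist (x + t *s e) x < \<delta>"
    using assms(2) tendstoD[of _ "x + 0 *s e"] by simp
  then have "\<forall>\<^sub>F t in at (0::complex). dist (x + t *s e) x < \<delta> \<and> t \<noteq> 0"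
    by (simp add: eventually_conj eventually_neq_at_within)
  then obtain t :: complex where "dist (x + t *s e) x < \<delta>" "t \<noteq> 0"
    using eventually_happens at_neq_bot by blast
  then show ?thesis using that[of "x + t *s e"] True e
    by (simp add: dist_commute lf_add lf_scale)
qed

section \<open>Homogeneous polynomial functions\<close>

text \<open>
  Degrees are integers, so that the coefficient of a form of degree \<open>n\<close> in a combination of degree
  \<open>k\<close> has degree \<open>k - n\<close> without a case distinction: in negative degree only \<open>0\<close> is homogeneous.
\<close>

inductive homog :: "int \<Rightarrow> (complex^'n \<Rightarrow> complex) \<Rightarrow> bool" where
  zero: "homog k (\<lambda>x. 0)"
| const: "homog 0 (\<lambda>x. c)"
| add: "homog k f \<Longrightarrow> homog k g \<Longrightarrow> homog k (\<lambda>x. f x + g x)"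
| coord: "homog k f \<Longrightarrow> homog (k + 1) (\<lambda>x. x $ i * f x)"

lemma homog_cong: "homog k f \<Longrightarrow> k = k' \<Longrightarrow> (\<And>x. f x = g x) \<Longrightarrow> homog k' g"
  by (metis ext)

lemma homog_neg: "homog k f \<Longrightarrow> k < 0 \<Longrightarrow> f x = 0"
  by (induction rule: homog.induct) auto

lemma homog_degree_0: "homog k f \<Longrightarrow> k = 0 \<Longrightarrow> f x = f y"
  by (induction rule: homog.induct) (auto simp: homog_neg)

lemma homog_scale: "homog k f \<Longrightarrow> homog k (\<lambda>x. c * f x)"
proof (induction rule: homog.induct)
  case (coord k f i)
  show ?case by (rule homog_cong[OF homog.coord[OF coord.IH, of i]]) auto
next
  case (add k f g)
  show ?case by (rule homog_cong[OF homog.add[OF add.IH]]) (auto simp: algebra_simps)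
qed (auto intro: homog.intros)

lemma homog_mult: "homog k f \<Longrightarrow> homog m g \<Longrightarrow> homog (k + m) (\<lambda>x. f x * g x)"
proof (induction rule: homog.induct)
  case (coord k f i)
  show ?case by (rule homog_cong[OF homog.coord[OF coord.IH[OF coord.prems], of i]]) auto
next
  case (add k f g)
  show ?case using homog.add[OF add.IH(1)[OF add.prems] add.IH(2)[OF add.prems]]
    by (simp add: algebra_simps)
qed (auto intro: homog.intros homog_scale)

lemma homog_uminus: "homog k f \<Longrightarrow> homog k (\<lambda>x. - f x)"
  using homog_scale[of k f "-1"] by simp

lemma homog_diff: "homog k f \<Longrightarrow> homog k g \<Longrightarrow> homog k (\<lambda>x. f x - g x)"
  using homog.add[OF _ homog_uminus, of k f g] by simp

lemma homog_sum: "(\<And>a. a \<in> A \<Longrightarrow> homog k (f a)) \<Longrightarrow> homog k (\<lambda>x. \<Sum>a\<in>A. f a x)"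
  by (induction A rule: infinite_finite_induct) (auto intro: homog.intros)

lemma homog_prod:
  "finite A \<Longrightarrow> (\<And>a. a \<in> A \<Longrightarrow> homog (m a) (f a)) \<Longrightarrow> homog (\<Sum>a\<in>A. m a) (\<lambda>x. \<Prod>a\<in>A. f a x)"
  by (induction A rule: finite_induct) (auto intro: homog.intros homog_mult)

lemma homog_power: "homog k f \<Longrightarrow> homog (int j * k) (\<lambda>x. f x ^ j)"
proof (induction j)
  case (Suc j)
  show ?case by (rule homog_cong[OF homog_mult[OF Suc.prems Suc.IH[OF Suc.prems]]])
      (auto simp: algebra_simps)
qed (simp add: homog.const)

lemma homog_coord: "homog 1 (\<lambda>x. x $ i)"
  using homog.coord[OF homog.const[of 1], of i] by simp

lemma homog_lf: "homog 1 (lf l)"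
proof -
  have "homog 1 (\<lambda>x. \<Sum>i\<in>UNIV. l $ i * x $ i)"
    by (intro homog_sum homog_scale homog_coord)
  then show ?thesis by (simp add: lf_def[abs_def])
qed

lemma homog_matrix_coord: "homog 1 (\<lambda>x. (w *v x) $ i)"
  unfolding matrix_vector_mult_def by (auto intro!: homog_sum homog_scale homog_coord)

lemma homog_compose: "homog k f \<Longrightarrow> homog k (\<lambda>x. f (w *v x))"
proof (induction rule: homog.induct)
  case (coord k f i)
  show ?case by (rule homog_cong[OF homog_mult[OF homog_matrix_coord[of w i] coord.IH]]) auto
qed (auto intro: homog.intros)

lemma continuous_on_homog [continuous_intros]:
  fixes g :: "'a::topological_space \<Rightarrow> complex^'n"
  shows "homog k f \<Longrightarrow> continuous_on S g \<Longrightarrow> continuous_on S (\<lambda>x. f (g x))"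
  by (induction rule: homog.induct) (auto intro!: continuous_intros continuous_on_component)

lemma holomorphic_on_homog:
  "homog k f \<Longrightarrow> (\<lambda>t. f (p + t *s v)) holomorphic_on S"
  by (induction rule: homog.induct) (auto intro!: holomorphic_intros)

text \<open>
  The difference quotient lowers the degree by one, which is what drives the induction in
  \<open>chevalley_relation\<close>.
\<close>

lemma homog_reflection_quotient:
  assumes r: "\<And>x. r *v x = x + lf l x *s a"
  shows "homog k f \<Longrightarrow> \<exists>g. homog (k - 1) g \<and> (\<forall>x. f (r *v x) - f x = lf l x * g x)"
proof (induction rule: homog.induct)
  case (zero k)
  show ?case by (rule exI[of _ "\<lambda>x. 0"]) (auto intro: homog.zero)
next
  case (const c)
  show ?case by (rule exI[of _ "\<lambda>x. 0"]) (auto intro: homog.zero)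
next
  case (add k f g)
  then obtain f' g' where "homog (k - 1) f'" "\<forall>x. f (r *v x) - f x = lf l x * f' x"
    "homog (k - 1) g'" "\<forall>x. g (r *v x) - g x = lf l x * g' x" by blast
  then have "homog (k - 1) (\<lambda>x. f' x + g' x)"
    "\<forall>x. f (r *v x) + g (r *v x) - (f x + g x) = lf l x * (f' x + g' x)"
    by (auto intro: homog.add simp: algebra_simps)
  then show ?case by blast
next
  case (coord k f i)
  then obtain g where g: "homog (k - 1) g" "\<And>x. f (r *v x) = f x + lf l x * g x"
    by (metis add_diff_cancel_left' diff_add_cancel add.commute)
  have "homog (k + 1 - 1) (\<lambda>x. (r *v x) $ i * g x + a $ i * f x)"
    by (intro homog.add homog_cong[OF homog_mult[OF homog_matrix_coord[of r i] g(1)]]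
        homog_cong[OF homog_scale[OF coord.hyps, of "a $ i"]]) auto
  moreover have "(r *v x) $ i * f (r *v x) - x $ i * f x = lf l x * ((r *v x) $ i * g x + a $ i * f x)" for x
    by (simp add: r[of x] g(2)[of x, unfolded r[of x]] algebra_simps)
  ultimately show ?case by blast
qed

lemma lf_cancel:
  assumes l: "l \<noteq> 0" and g: "homog k g" and z: "\<And>x. lf l x * g x = 0"
  shows "g x = 0"
proof (rule ccontr)
  assume nz: "g x \<noteq> 0"
  have c: "isCont g x" using continuous_on_homog[OF g continuous_on_id, of UNIV]
    by (simp add: continuous_on_eq_continuous_at)
  then obtain \<delta> where d: "\<delta> > 0" "\<And>y. dist y x < \<delta> \<Longrightarrow> dist (g y) (g x) < norm (g x)"
    using nz unfolding continuous_at_eps_delta by (metis zero_less_norm_iff)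
  obtain y where y: "dist x y < \<delta>" "lf l y \<noteq> 0" using lf_nonzero_dense[OF l d(1)] by blast
  then have "g y = 0" using z[of y] by simp
  then show False using d(2)[of y] y(1) by (simp add: dist_commute)
qed

text \<open>The coefficients are elementary symmetric functions of the linear forms.\<close>

lemma homog_coeff_prod_linear:
  assumes "finite S" "\<And>w. w \<in> S \<Longrightarrow> homog 1 (y w)"
  shows "homog (int (card S) - int j) (\<lambda>x. Polynomial.coeff (\<Prod>w\<in>S. [:- y w x, 1:]) j)"
  using assms
proof (induction S arbitrary: j rule: finite_induct)
  case empty
  show ?case by (cases j) (auto intro: homog.intros)
next
  case (insert w S)
  let ?q = "\<lambda>x. \<Prod>w\<in>S. [:- y w x, 1:]"
  have y: "homog 1 (\<lambda>x. - y w x)" using insert.prems by (auto intro: homog_uminus)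
  have IH: "homog (int (card S) - int j) (\<lambda>x. Polynomial.coeff (?q x) j)" for j
    using insert by auto
  have m: "homog (int (card (insert w S)) - int j) (\<lambda>x. - y w x * Polynomial.coeff (?q x) j)" for j
    by (rule homog_cong[OF homog_mult[OF y IH[of j]]]) (use insert.hyps in auto)
  show ?case
  proof (cases j)
    case 0
    then show ?thesis using m[of 0] insert.hyps by simp
  next
    case (Suc i)
    have "homog (int (card (insert w S)) - int j) (\<lambda>x. Polynomial.coeff (?q x) i)"
      by (rule homog_cong[OF IH[of i]]) (use insert.hyps Suc in auto)
    then have "homog (int (card (insert w S)) - int j)
        (\<lambda>x. - y w x * Polynomial.coeff (?q x) j + Polynomial.coeff (?q x) i)"
      by (intro homog.add m)
    then show ?thesis using insert.hyps Suc by simp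
  qed
qed

section \<open>Invariants of a finite matrix group\<close>

locale finite_matrix_group =
  fixes W :: "(complex^'n^'n) set"
  assumes finite_W: "finite W"
    and one_W: "mat 1 \<in> W"
    and mult_W: "A \<in> W \<Longrightarrow> B \<in> W \<Longrightarrow> A ** B \<in> W"
    and inv_W: "A \<in> W \<Longrightarrow> \<exists>B\<in>W. B ** A = mat 1 \<and> A ** B = mat 1"
begin

lemma bij_betw_mult_right: "u \<in> W \<Longrightarrow> bij_betw (\<lambda>w. w ** u) W W"
proof -
  assume u: "u \<in> W"
  obtain v where v: "v \<in> W" "v ** u = mat 1" "u ** v = mat 1" using inv_W u by blast
  show ?thesis
    by (rule bij_betw_byWitness[where f' = "\<lambda>w. w ** v"])
      (use u v mult_W in \<open>auto simp: matrix_mul_assoc[symmetric]\<close>)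
qed

lemma card_W_pos: "card W > 0"
  using finite_W one_W card_gt_0_iff by blast

definition invariant :: "(complex^'n \<Rightarrow> complex) \<Rightarrow> bool" where
  "invariant f \<longleftrightarrow> (\<forall>w\<in>W. \<forall>x. f (w *v x) = f x)"

definition inv_homog :: "int \<Rightarrow> (complex^'n \<Rightarrow> complex) \<Rightarrow> bool" where
  "inv_homog k f \<longleftrightarrow> homog k f \<and> invariant f"

lemma inv_homogD: "inv_homog k f \<Longrightarrow> homog k f" "inv_homog k f \<Longrightarrow> w \<in> W \<Longrightarrow> f (w *v x) = f x"
  by (auto simp: inv_homog_def invariant_def)

lemma inv_homog_cong: "inv_homog k f \<Longrightarrow> k = k' \<Longrightarrow> (\<And>x. f x = g x) \<Longrightarrow> inv_homog k' g"
  by (metis ext)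

lemma inv_homog_zero: "inv_homog k (\<lambda>x. 0)"
  by (simp add: inv_homog_def invariant_def homog.zero)

lemma inv_homog_const: "inv_homog 0 (\<lambda>x. c)"
  by (simp add: inv_homog_def invariant_def homog.const)

lemma inv_homog_add: "inv_homog k f \<Longrightarrow> inv_homog k g \<Longrightarrow> inv_homog k (\<lambda>x. f x + g x)"
  by (simp add: inv_homog_def invariant_def homog.add)

lemma inv_homog_diff: "inv_homog k f \<Longrightarrow> inv_homog k g \<Longrightarrow> inv_homog k (\<lambda>x. f x - g x)"
  by (simp add: inv_homog_def invariant_def homog_diff)

lemma inv_homog_scale: "inv_homog k f \<Longrightarrow> inv_homog k (\<lambda>x. c * f x)"
  by (simp add: inv_homog_def invariant_def homog_scale)

lemma inv_homog_mult:
  "inv_homog k f \<Longrightarrow> inv_homog m g \<Longrightarrow> inv_homog (k + m) (\<lambda>x. f x * g x)"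
  by (simp add: inv_homog_def invariant_def homog_mult)

definition average :: "(complex^'n \<Rightarrow> complex) \<Rightarrow> complex^'n \<Rightarrow> complex" where
  "average g x = (\<Sum>w\<in>W. g (w *v x)) / of_nat (card W)"

lemma invariant_orbit_sum:
  assumes "u \<in> W"
  shows "(\<Sum>w\<in>W. g (w *v (u *v x))) = (\<Sum>w\<in>W. g (w *v x))"
  using sum.reindex_bij_betw[OF bij_betw_mult_right[OF assms], of "\<lambda>w. g (w *v x)"]
  by (simp add: matrix_vector_mul_assoc)

lemma inv_homog_orbit_sum: "homog k g \<Longrightarrow> inv_homog k (\<lambda>x. \<Sum>w\<in>W. g (w *v x))"
  by (auto simp: inv_homog_def invariant_def invariant_orbit_sum intro!: homog_sum homog_compose)

lemma inv_homog_average: "homog k g \<Longrightarrow> inv_homog k (average g)"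
  using inv_homog_scale[OF inv_homog_orbit_sum, of k g "1 / of_nat (card W)"]
  by (simp add: average_def[abs_def])

lemma average_invariant_mult:
  "invariant f \<Longrightarrow> average (\<lambda>x. f x * g x) x = f x * average g x"
  by (simp add: average_def invariant_def sum_distrib_left[symmetric])

lemma average_sum: "average (\<lambda>x. \<Sum>i\<in>B. g i x) x = (\<Sum>i\<in>B. average (g i) x)"
  unfolding average_def by (subst sum.swap) (simp add: sum_divide_distrib)

text \<open>The ideal generated by the invariants of positive degree (the Hilbert ideal).\<close>

inductive hilbert :: "int \<Rightarrow> (complex^'n \<Rightarrow> complex) \<Rightarrow> bool" where
  zero: "hilbert k (\<lambda>x. 0)"
| add: "hilbert k f \<Longrightarrow> hilbert k g \<Longrightarrow> hilbert k (\<lambda>x. f x + g x)"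
| gen: "inv_homog a f \<Longrightarrow> a > 0 \<Longrightarrow> homog b h \<Longrightarrow> hilbert (a + b) (\<lambda>x. f x * h x)"

lemma hilbert_cong: "hilbert k f \<Longrightarrow> k = k' \<Longrightarrow> (\<And>x. f x = g x) \<Longrightarrow> hilbert k' g"
  by (metis ext)

lemma hilbert_mult: "hilbert k g \<Longrightarrow> homog m h \<Longrightarrow> hilbert (k + m) (\<lambda>x. g x * h x)"
proof (induction rule: hilbert.induct)
  case (gen a f b h')
  show ?case by (rule hilbert_cong[OF hilbert.gen[OF gen(1,2) homog_mult[OF gen(3,4)]]]) auto
next
  case (add k f g)
  show ?case
    by (rule hilbert_cong[OF hilbert.add[OF add.IH(1)[OF add.prems] add.IH(2)[OF add.prems]]])
      (auto simp: algebra_simps)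
qed (auto intro: hilbert.intros)

lemma hilbert_compose: "hilbert k g \<Longrightarrow> w \<in> W \<Longrightarrow> hilbert k (\<lambda>x. g (w *v x))"
proof (induction rule: hilbert.induct)
  case (gen a f b h)
  show ?case
    by (rule hilbert_cong[OF hilbert.gen[OF gen(1,2) homog_compose[OF gen(3), of w]]])
      (use inv_homogD(2)[OF gen(1) gen(4)] in auto)
qed (auto intro: hilbert.intros)

lemma hilbert_sum:
  "(\<And>a. a \<in> A \<Longrightarrow> hilbert k (f a)) \<Longrightarrow> hilbert k (\<lambda>x. \<Sum>a\<in>A. f a x)"
  by (induction A rule: infinite_finite_induct) (auto intro: hilbert.intros)

end

text \<open>
  That reflections generate the group is only ever used as an induction principle. Inverses do not
  appear, since the inverse of a reflection is a reflection.
\<close>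

locale reflection_group = finite_matrix_group W for W :: "(complex^'n^'n) set" +
  assumes reflection_induct: "\<And>Q w. w \<in> W \<Longrightarrow> Q (mat 1) \<Longrightarrow>
      (\<And>r w. r \<in> W \<Longrightarrow> is_reflection r \<Longrightarrow> w \<in> W \<Longrightarrow> Q w \<Longrightarrow> Q (r ** w)) \<Longrightarrow> Q w"

lemma vec_dim_proper_subspace:
  fixes S :: "(complex^'n) set"
  assumes "vec.subspace S" "S \<noteq> UNIV"
  shows "vec.dim S < CARD('n)"
  using vec.dim_eq_full[of S] assms vec.dim_subset_UNIV[of S]
  by (metis dual_order.order_iff_strict vec.span_eq_iff vec.dimension_def card_cart_basis vec.dim_UNIV vec_dim_card)

lemma hyperplane_subset_lf_kernel:
  fixes H :: "(complex^'n) set"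
  assumes H: "hyperplane H" and l: "l \<noteq> 0" and sub: "\<And>x. x \<in> H \<Longrightarrow> lf l x = 0"
  shows "H = {x. lf l x = 0}"
proof -
  let ?K = "{x. lf l x = 0}"
  have K: "vec.subspace ?K"
    by (auto simp: vec.subspace_def lf_add lf_scale lf_zero)
  have "?K \<noteq> UNIV" using l lf_eq_0_iff by blast
  then have "vec.dim ?K < CARD('n)"
    by (rule vec_dim_proper_subspace[OF K])
  then have "vec.dim ?K \<le> vec.dim H" using H by (simp add: hyperplane_def)
  moreover have "H \<subseteq> ?K" using sub by blast
  ultimately show ?thesis
    using vec.subspace_dim_equal[of H ?K] H K by (auto simp: hyperplane_def)
qed

text \<open>
  Every row of \<open>r - 1\<close> vanishes on the fixed hyperplane, so a nonzero row is an equation \<open>l\<close> for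
  it; the vector \<open>a\<close> is the displacement \<open>r e - e\<close> of any \<open>e\<close> with \<open>l e = 1\<close>.
\<close>

lemma reflection_form:
  fixes r :: "complex^'n^'n"
  assumes r: "is_reflection r" and H: "hyperplane H" "fixes_pointwise r H"
  shows "\<exists>l a. l \<noteq> 0 \<and> H = {x. lf l x = 0} \<and> (\<forall>x. r *v x = x + lf l x *s a)"
proof -
  have "r \<noteq> mat 1" using r by (simp add: is_reflection_def)
  then obtain i j where ij: "r $ i $ j \<noteq> mat 1 $ i $ j" by (metis vec_eq_iff)
  define l where "l = (\<chi> k. r $ i $ k - mat 1 $ i $ k)"
  have lnz: "l \<noteq> 0" using ij by (auto simp: l_def vec_eq_iff)
  have l: "lf l x = (r *v x) $ i - x $ i" for x
  proof -
    have "lf l x = (r *v x) $ i - (mat 1 *v x) $ i"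
      by (simp only: lf_def l_def matrix_vector_mult_def vec_lambda_beta sum_subtractf[symmetric]
          left_diff_distrib)
    then show ?thesis by simp
  qed
  have Hl: "H = {x. lf l x = 0}"
    by (rule hyperplane_subset_lf_kernel[OF H(1) lnz])
      (use H(2) in \<open>auto simp: l fixes_pointwise_def\<close>)
  obtain e where e: "lf l e = 1" using lf_nonzero_dual lnz by blast
  have "r *v x = x + lf l x *s (r *v e - e)" for x
  proof -
    have "x - lf l x *s e \<in> H" by (simp add: Hl lf_diff lf_scale e)
    then have "r *v (x - lf l x *s e) = x - lf l x *s e" using H(2) by (simp add: fixes_pointwise_def)
    then have "r *v x - lf l x *s (r *v e) = x - lf l x *s e"
      by (simp add: matrix_vector_mult_diff_distrib matrix_vector_mult_scaleR vector_scalar_commute)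
    then show ?thesis by (simp add: algebra_simps vec.scale_right_diff_distrib)
  qed
  then have "\<forall>x. r *v x = x + lf l x *s (r *v e - e)" by blast
  with lnz Hl show ?thesis by blast
qed

context reflection_group
begin

text \<open>
  If all difference quotients of \<open>g\<close> lie in the ideal, then \<open>g\<close> is congruent to each of its
  translates, hence to its average over the group, and the average is an invariant of positive
  degree.
\<close>

lemma hilbert_if_quotients:
  assumes g: "homog k g" and k: "k > 0"
    and q: "\<And>l a r h. r \<in> W \<Longrightarrow> l \<noteq> 0 \<Longrightarrow> (\<And>x. r *v x = x + lf l x *s a) \<Longrightarrow> homog (k - 1) h \<Longrightarrow>
        (\<And>x. g (r *v x) - g x = lf l x * h x) \<Longrightarrow> hilbert (k - 1) h"
  shows "hilbert k g"
proof -
  have d: "hilbert k (\<lambda>x. g (w *v x) - g x)" if "w \<in> W" for w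
    using that
  proof (induction rule: reflection_induct[consumes 1])
    case 1
    show ?case by (simp add: hilbert.zero)
  next
    case (2 r w)
    obtain H where H: "hyperplane H" "fixes_pointwise r H"
      using 2(2) unfolding is_reflection_def by blast
    obtain l a where l': "l \<noteq> 0" "\<forall>x. r *v x = x + lf l x *s a"
      using reflection_form[OF 2(2) H] by (elim exE conjE)
    note l = l'(1) l'(2)[rule_format]
    obtain h where h: "homog (k - 1) h" "\<And>x. g (r *v x) - g x = lf l x * h x"
      using homog_reflection_quotient[OF l(2) g] by blast
    have "hilbert (k - 1) h" using q[OF 2(1) l h] .
    then have "hilbert (k - 1 + 1) (\<lambda>x. h (w *v x) * lf l (w *v x))"
      by (rule hilbert_mult[OF hilbert_compose[OF _ 2(3)] homog_compose[OF homog_lf]])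
    then have hl: "hilbert k (\<lambda>x. h (w *v x) * lf l (w *v x))" by simp
    have h2: "g (r *v y) = g y + lf l y * h y" for y using h(2)[of y] by (simp add: algebra_simps)
    from hilbert.add[OF hl 2(4)]
    show ?case
      by (rule hilbert_cong) (auto simp: matrix_vector_mul_assoc[symmetric] h2 mult.commute)
  qed
  have "hilbert k (average g)"
    using hilbert.gen[OF inv_homog_average[OF g] k homog.const[of 1]] by simp
  moreover have "hilbert (k + 0) (\<lambda>x. (\<Sum>w\<in>W. g (w *v x) - g x) * (- (1 / of_nat (card W))))"
    by (intro hilbert_mult hilbert_sum homog.const d)
  then have "hilbert k (\<lambda>x. (\<Sum>w\<in>W. g (w *v x) - g x) * (- (1 / of_nat (card W))))" by simp
  with calculation have "hilbert k (\<lambda>x. average g x + (\<Sum>w\<in>W. g (w *v x) - g x) * (- (1 / of_nat (card W))))"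
    by (rule hilbert.add)
  then show ?thesis
    by (rule hilbert_cong) (use card_W_pos in \<open>auto simp: average_def sum_subtractf field_simps\<close>)
qed

text \<open>
  Applying a reflection to the relation and dividing by its linear form yields a relation with the
  same invariants \<open>f i\<close> and with the difference quotients of the \<open>g i\<close>, of smaller degree. At the
  bottom of the induction \<open>g b\<close> is a constant, and averaging the relation would express \<open>f b\<close>
  through the other invariants unless that constant is \<open>0\<close>.
\<close>

lemma chevalley_relation:
  assumes B: "finite B" "b \<in> B"
    and f: "\<And>i. i \<in> B \<Longrightarrow> inv_homog (m i) (f i)"
    and indep: "\<not> (\<exists>c. (\<forall>i\<in>B-{b}. inv_homog (m b - m i) (c i)) \<and> (\<forall>x. f b x = (\<Sum>i\<in>B-{b}. c i x * f i x)))"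
  shows "(\<And>i. i \<in> B \<Longrightarrow> homog (k - m i) (g i)) \<Longrightarrow> (\<And>x. (\<Sum>i\<in>B. f i x * g i x) = 0) \<Longrightarrow>
    hilbert (k - m b) (g b)"
proof (induction "nat (k - m b)" arbitrary: k g rule: less_induct)
  case less
  note g = less.prems(1) and rel = less.prems(2)
  consider "k - m b < 0" | "k - m b = 0" | "k - m b > 0" by linarith
  then show ?case
  proof cases
    case 1
    then have "g b x = 0" for x using homog_neg g B by blast
    then show ?thesis using hilbert_cong[OF hilbert.zero refl] by simp
  next
    case 2
    obtain c where c: "\<And>x. g b x = c" using homog_degree_0[OF g[OF B(2)] 2] by metis
    have "c = 0"
    proof (rule ccontr)
      assume nz: "c \<noteq> 0"
      have fi: "invariant (f i)" if "i \<in> B" for i using f that by (simp add: inv_homog_def)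
      have avg: "(\<Sum>i\<in>B. f i x * average (g i) x) = 0" for x
      proof -
        have "(\<Sum>i\<in>B. f i x * average (g i) x) = average (\<lambda>x. \<Sum>i\<in>B. f i x * g i x) x"
          unfolding average_sum by (intro sum.cong refl) (simp add: average_invariant_mult fi)
        also have "\<dots> = 0" by (simp add: rel average_def)
        finally show ?thesis .
      qed
      have cb: "average (g b) x = c" for x using card_W_pos by (simp add: average_def c)
      have "f b x = (\<Sum>i\<in>B-{b}. (- 1 / c * average (g i) x) * f i x)" for x
      proof -
        have "f b x * c + (\<Sum>i\<in>B-{b}. f i x * average (g i) x) = 0"
          using avg[of x] cb[of x] by (simp add: sum.remove[OF B])
        then have "f b x = - 1 / c * (\<Sum>i\<in>B-{b}. f i x * average (g i) x)"
          using nz by (simp add: field_simps add_eq_0_iff)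
        then show ?thesis by (simp add: sum_distrib_left algebra_simps)
      qed
      moreover have "inv_homog (m b - m i) (\<lambda>x. - 1 / c * average (g i) x)" if "i \<in> B - {b}" for i
      proof -
        have e: "k - m i = m b - m i" using 2 by simp
        show ?thesis using inv_homog_scale[OF inv_homog_average[OF g[of i]]] that unfolding e by blast
      qed
      ultimately have "\<exists>c. (\<forall>i\<in>B-{b}. inv_homog (m b - m i) (c i)) \<and> (\<forall>x. f b x = (\<Sum>i\<in>B-{b}. c i x * f i x))"
        by (intro exI[of _ "\<lambda>i x. - 1 / c * average (g i) x"] conjI ballI allI)
      then show False using indep by contradiction
    qed
    then have "g b x = 0" for x using c by simp
    then show ?thesis using hilbert_cong[OF hilbert.zero refl] by simp
  next
    case 3
    show ?thesis
    proof (rule hilbert_if_quotients[OF g[OF B(2)] 3])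
      fix l a r h
      assume r: "r \<in> W" and l: "l \<noteq> 0" "\<And>x. r *v x = x + lf l x *s a"
        and h: "homog (k - m b - 1) h" "\<And>x. g b (r *v x) - g b x = lf l x * h x"
      have "\<exists>h. homog (k - m i - 1) h \<and> (\<forall>x. g i (r *v x) - g i x = lf l x * h x)" if "i \<in> B" for i
        using homog_reflection_quotient[OF l(2) g[OF that]] by blast
      then obtain h' where h': "\<And>i. i \<in> B \<Longrightarrow> homog (k - m i - 1) (h' i)"
        "\<And>i x. i \<in> B \<Longrightarrow> g i (r *v x) - g i x = lf l x * h' i x" by metis
      define h'' where "h'' = h'(b := h)"
      have h'': "homog (k - 1 - m i) (h'' i)" "g i (r *v x) - g i x = lf l x * h'' i x"
        if "i \<in> B" for i x
        using h h'[OF that] by (cases "i = b"; simp add: h''_def diff_diff_eq add.commute)+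
      have z: "lf l x * (\<Sum>i\<in>B. f i x * h'' i x) = 0" for x
      proof -
        have "lf l x * (\<Sum>i\<in>B. f i x * h'' i x) = (\<Sum>i\<in>B. f i x * (g i (r *v x) - g i x))"
          by (simp add: sum_distrib_left h''(2) algebra_simps cong: sum.cong)
        also have "\<dots> = (\<Sum>i\<in>B. f i (r *v x) * g i (r *v x)) - (\<Sum>i\<in>B. f i x * g i x)"
          by (simp add: algebra_simps sum_subtractf inv_homogD(2)[OF f r] cong: sum.cong)
        finally show ?thesis using rel by simp
      qed
      have "homog (k - 1) (\<lambda>x. \<Sum>i\<in>B. f i x * h'' i x)"
        by (intro homog_sum homog_cong[OF homog_mult[OF inv_homogD(1)[OF f] h''(1)]]) auto
      then have "(\<Sum>i\<in>B. f i x * h'' i x) = 0" for x by (rule lf_cancel[OF l(1) _ z])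
      then have "hilbert (k - 1 - m b) (h'' b)"
        using less.hyps[of "k - 1" h'', OF _ h''(1)] 3 by simp
      then show "hilbert (k - m b - 1) h" by (simp add: h''_def algebra_simps)
    qed
  qed
qed

end

section \<open>Freeness over the invariants\<close>

context finite_matrix_group
begin

definition spans_over_invariants :: "'b set \<Rightarrow> ('b \<Rightarrow> int) \<Rightarrow> ('b \<Rightarrow> complex^'n \<Rightarrow> complex) \<Rightarrow> int \<Rightarrow> (complex^'n \<Rightarrow> complex) \<Rightarrow> bool" where
  "spans_over_invariants E n e k s \<longleftrightarrow>
     (\<exists>r. (\<forall>a\<in>E. inv_homog (k - n a) (r a)) \<and> (\<forall>x. s x = (\<Sum>a\<in>E. r a x * e a x)))"

lemma span_zero: "spans_over_invariants E n e k (\<lambda>x. 0)"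
  unfolding spans_over_invariants_def
  by (intro exI[of _ "\<lambda>a x. 0"]) (auto intro: inv_homog_zero)

lemma span_add:
  assumes "spans_over_invariants E n e k s" "spans_over_invariants E n e k t"
  shows "spans_over_invariants E n e k (\<lambda>x. s x + t x)"
proof -
  obtain r q where r: "\<forall>a\<in>E. inv_homog (k - n a) (r a)" "\<forall>x. s x = (\<Sum>a\<in>E. r a x * e a x)"
    and q: "\<forall>a\<in>E. inv_homog (k - n a) (q a)" "\<forall>x. t x = (\<Sum>a\<in>E. q a x * e a x)"
    using assms unfolding spans_over_invariants_def by blast
  then show ?thesis unfolding spans_over_invariants_def
    by (intro exI[of _ "\<lambda>a x. r a x + q a x"])
      (auto intro: inv_homog_add simp: algebra_simps sum.distrib)
qed

lemma span_sum:
  "(\<And>a. a \<in> A \<Longrightarrow> spans_over_invariants E n e k (f a)) \<Longrightarrow> spans_over_invariants E n e k (\<lambda>x. \<Sum>a\<in>A. f a x)"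
  by (induction A rule: infinite_finite_induct) (auto intro: span_zero span_add)

lemma span_mult:
  assumes f: "inv_homog m f" and s: "spans_over_invariants E n e k s"
  shows "spans_over_invariants E n e (m + k) (\<lambda>x. f x * s x)"
proof -
  obtain r where r: "\<forall>a\<in>E. inv_homog (k - n a) (r a)" "\<forall>x. s x = (\<Sum>a\<in>E. r a x * e a x)"
    using s unfolding spans_over_invariants_def by blast
  have "inv_homog (m + k - n a) (\<lambda>x. f x * r a x)" if "a \<in> E" for a
    by (rule inv_homog_cong[OF inv_homog_mult[OF f r(1)[rule_format, OF that]]]) auto
  then show ?thesis unfolding spans_over_invariants_def
    by (intro exI[of _ "\<lambda>a x. f x * r a x"]) (auto simp: r(2) sum_distrib_left mult.assoc)
qed

lemma span_cong: "spans_over_invariants E n e k s \<Longrightarrow> k = k' \<Longrightarrow> (\<And>x. s x = t x) \<Longrightarrow> spans_over_invariants E n e k' t"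
  by (metis ext)

lemma span_generator:
  assumes "finite E" "b \<in> E" "k = n b"
  shows "spans_over_invariants E n e k (e b)"
proof -
  have "(\<Sum>a\<in>E. (if a = b then 1 else 0) * e a x) = e b x" for x
    using assms sum.delta[of E b "\<lambda>a. e a x"] by (simp add: if_distrib if_distribR cong: if_cong)
  moreover have "inv_homog (k - n a) (\<lambda>x. if a = b then 1 else 0)" for a
    using assms by (cases "a = b") (auto intro: inv_homog_const inv_homog_zero)
  ultimately show ?thesis unfolding spans_over_invariants_def
    by (intro exI[of _ "\<lambda>a x. if a = b then 1 else 0"]) auto
qed

definition generates_polynomials :: "'b set \<Rightarrow> ('b \<Rightarrow> int) \<Rightarrow> ('b \<Rightarrow> complex^'n \<Rightarrow> complex) \<Rightarrow> bool" where
  "generates_polynomials E n e \<longleftrightarrow> (\<forall>k s. homog k s \<longrightarrow> spans_over_invariants E n e k s)"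

text \<open>
  The coordinate is a root of the polynomial whose roots are its values on the orbit of \<open>x\<close>; the
  coefficients of that polynomial are invariant.
\<close>

lemma coordinate_integral:
  "\<exists>c. (\<forall>j<card W. inv_homog (int (card W) - int j) (c j)) \<and>
     (\<forall>x. x $ i ^ card W = (\<Sum>j<card W. c j x * x $ i ^ j))"
proof -
  define P where "P x = (\<Prod>w\<in>W. [:- ((w *v x) $ i), 1:])" for x :: "complex^'n"
  have deg: "degree (P x) = card W" for x
    by (simp add: P_def degree_prod_eq_sum_degree)
  have lead: "Polynomial.coeff (P x) (card W) = 1" for x
  proof -
    have "lead_coeff (P x) = (\<Prod>w\<in>W. lead_coeff [:- ((w *v x) $ i), 1:])"
      unfolding P_def by (rule lead_coeff_prod)
    then show ?thesis by (simp add: deg)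
  qed
  have inv: "P (u *v x) = P x" if "u \<in> W" for u x
    using prod.reindex_bij_betw[OF bij_betw_mult_right[OF that], of "\<lambda>w. [:- ((w *v x) $ i), 1:]"]
    by (simp add: P_def matrix_vector_mul_assoc)
  have zero: "poly (P x) (x $ i) = 0" for x
    unfolding P_def poly_prod by (rule prod_zero[OF finite_W]) (use one_W in \<open>auto intro!: bexI[of _ "mat 1"]\<close>)
  have coeff: "inv_homog (int (card W) - int j) (\<lambda>x. - Polynomial.coeff (P x) j)" for j
  proof -
    have "homog (int (card W) - int j) (\<lambda>x. Polynomial.coeff (P x) j)"
      unfolding P_def by (rule homog_coeff_prod_linear[OF finite_W homog_matrix_coord])
    then show ?thesis by (auto simp: inv_homog_def invariant_def inv intro: homog_uminus)
  qed
  have "x $ i ^ card W = (\<Sum>j<card W. - Polynomial.coeff (P x) j * x $ i ^ j)" for x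
  proof -
    have "0 = (\<Sum>j\<le>card W. Polynomial.coeff (P x) j * x $ i ^ j)"
      using zero[of x] by (simp add: poly_altdef deg)
    also have "\<dots> = (\<Sum>j<card W. Polynomial.coeff (P x) j * x $ i ^ j) + x $ i ^ card W"
      by (simp add: lessThan_Suc_atMost[symmetric] lead)
    finally show ?thesis by (simp add: sum_negf eq_neg_iff_add_eq_0 add.commute)
  qed
  with coeff show ?thesis by (intro exI[of _ "\<lambda>j x. - Polynomial.coeff (P x) j"]) auto
qed

text \<open>
  The monomials in which every exponent is smaller than the order of the group suffice: higher
  powers of a coordinate reduce by \<open>coordinate_integral\<close>.
\<close>

lemma finite_generation:
  "\<exists>(E::('n \<Rightarrow> nat) set) n e. finite E \<and> (\<forall>a\<in>E. homog (n a) (e a)) \<and> generates_polynomials E n e"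
proof -
  let ?N = "card W"
  define E where "E = {\<alpha>::'n \<Rightarrow> nat. \<forall>i. \<alpha> i < ?N}"
  define n where "n \<alpha> = (\<Sum>i\<in>UNIV. int (\<alpha> i))" for \<alpha> :: "'n \<Rightarrow> nat"
  define e where "e \<alpha> x = (\<Prod>i\<in>UNIV. x $ i ^ \<alpha> i)" for \<alpha> :: "'n \<Rightarrow> nat" and x :: "complex^'n"
  have "E = (\<Pi>\<^sub>E i\<in>UNIV. {..<?N})" by (auto simp: E_def PiE_def)
  then have finE: "finite E" by (simp add: finite_PiE)
  have he: "homog (n \<alpha>) (e \<alpha>)" for \<alpha>
    unfolding n_def e_def
    by (intro homog_prod homog_cong[OF homog_power[OF homog_coord]]) auto
  have e_upd: "e (\<alpha>(i := j)) x = x $ i ^ j * (\<Prod>i'\<in>UNIV-{i}. x $ i' ^ \<alpha> i')" for \<alpha> i j x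
    unfolding e_def by (subst prod.remove[of UNIV i]) (auto intro!: prod.cong)
  have n_upd: "n (\<alpha>(i := j)) = int j + (\<Sum>i'\<in>UNIV-{i}. int (\<alpha> i'))" for \<alpha> i j
    unfolding n_def by (subst sum.remove[of UNIV i]) (auto intro!: sum.cong)
  have mono: "spans_over_invariants E n e (n \<alpha> + 1) (\<lambda>x. x $ i * e \<alpha> x)" if \<alpha>: "\<alpha> \<in> E" for \<alpha> i
  proof (cases "\<alpha> i + 1 < ?N")
    case True
    then have "\<alpha>(i := \<alpha> i + 1) \<in> E" using \<alpha> by (auto simp: E_def)
    from span_generator[OF finE this refl]
    have "spans_over_invariants E n e (n (\<alpha>(i := \<alpha> i + 1))) (e (\<alpha>(i := \<alpha> i + 1)))" .
    then show ?thesis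
      by (rule span_cong)
        (use n_upd[of \<alpha> i "\<alpha> i"] e_upd[of \<alpha> i "\<alpha> i"] in \<open>auto simp: n_upd e_upd\<close>)
  next
    case False
    then have N: "\<alpha> i + 1 = ?N" using \<alpha> unfolding E_def by (metis (mono_tags, lifting) Suc_eq_plus1 Suc_lessI mem_Collect_eq)
    obtain c where c: "\<And>j. j < ?N \<Longrightarrow> inv_homog (int ?N - int j) (c j)"
      "\<And>x. x $ i ^ ?N = (\<Sum>j<?N. c j x * x $ i ^ j)" using coordinate_integral[of i] by blast
    have "spans_over_invariants E n e (n \<alpha> + 1) (\<lambda>x. c j x * e (\<alpha>(i := j)) x)" if "j < ?N" for j
    proof -
      have "\<alpha>(i := j) \<in> E" using \<alpha> that by (auto simp: E_def)
      from span_mult[OF c(1)[OF that] span_generator[OF finE this refl]]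
      show ?thesis
        by (rule span_cong) (use n_upd[of \<alpha> i "\<alpha> i"] N in \<open>auto simp: n_upd\<close>)
    qed
    then have "spans_over_invariants E n e (n \<alpha> + 1) (\<lambda>x. \<Sum>j<?N. c j x * e (\<alpha>(i := j)) x)"
      by (intro span_sum) auto
    then show ?thesis
    proof (rule span_cong)
      fix x :: "complex^'n"
      let ?R = "\<Prod>i'\<in>UNIV-{i}. x $ i' ^ \<alpha> i'"
      have "(\<Sum>j<?N. c j x * e (\<alpha>(i := j)) x) = (\<Sum>j<?N. c j x * x $ i ^ j) * ?R"
        by (simp add: e_upd sum_distrib_right mult.assoc)
      also have "\<dots> = x $ i ^ (\<alpha> i + 1) * ?R" by (simp only: N c(2))
      also have "\<dots> = x $ i * e \<alpha> x" using e_upd[of \<alpha> i "\<alpha> i" x] by simp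
      finally show "(\<Sum>j<?N. c j x * e (\<alpha>(i := j)) x) = x $ i * e \<alpha> x" .
    qed auto
  qed
  have "spans_over_invariants E n e k s" if "homog k s" for k s
    using that
  proof (induction rule: homog.induct)
    case (zero k)
    show ?case by (rule span_zero)
  next
    case (const c)
    have "(\<lambda>_. 0) \<in> E" using card_W_pos by (simp add: E_def)
    from span_mult[OF inv_homog_const[of c] span_generator[OF finE this refl]]
    show ?case by (rule span_cong) (auto simp: n_def e_def)
  next
    case (add k f g)
    then show ?case by (intro span_add)
  next
    case (coord k f i)
    then obtain r where r: "\<And>a. a \<in> E \<Longrightarrow> inv_homog (k - n a) (r a)" "\<And>x. f x = (\<Sum>a\<in>E. r a x * e a x)"
      unfolding spans_over_invariants_def by blast
    have "spans_over_invariants E n e (k + 1) (\<lambda>x. \<Sum>a\<in>E. r a x * (x $ i * e a x))"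
      by (intro span_sum span_cong[OF span_mult[OF r(1) mono]]) auto
    then show ?case
      by (rule span_cong) (auto simp: r(2) sum_distrib_left algebra_simps)
  qed
  then have "generates_polynomials E n e" by (simp add: generates_polynomials_def)
  with finE he show ?thesis by blast
qed

lemma minimal_generation:
  "\<exists>(E::('n \<Rightarrow> nat) set) n e. finite E \<and> (\<forall>a\<in>E. homog (n a) (e a)) \<and> generates_polynomials E n e \<and>
     (\<forall>b\<in>E. \<not> spans_over_invariants (E - {b}) n e (n b) (e b))"
proof -
  obtain E0 :: "('n \<Rightarrow> nat) set" and n e where E0: "finite E0" "\<forall>a\<in>E0. homog (n a) (e a)"
    "generates_polynomials E0 n e" using finite_generation by blast
  let ?P = "\<lambda>E. E \<subseteq> E0 \<and> generates_polynomials E n e"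
  have "?P E0" using E0 by blast
  then obtain E where E: "?P E" and min: "\<And>F. ?P F \<Longrightarrow> card E \<le> card F"
    using ex_has_least_nat[of ?P E0 card] by blast
  have finE: "finite E" using E E0 finite_subset by blast
  have "\<not> spans_over_invariants (E - {b}) n e (n b) (e b)" if b: "b \<in> E" for b
  proof
    assume sb: "spans_over_invariants (E - {b}) n e (n b) (e b)"
    have "spans_over_invariants (E - {b}) n e k s" if s: "homog k s" for k s
    proof -
      obtain r where r: "\<And>a. a \<in> E \<Longrightarrow> inv_homog (k - n a) (r a)" "\<And>x. s x = (\<Sum>a\<in>E. r a x * e a x)"
        using E s unfolding generates_polynomials_def spans_over_invariants_def by blast
      have *: "spans_over_invariants (E - {b}) n e (n a) (e a)" if "a \<in> E" for a
        using sb span_generator[of "E - {b}" a] finE that by (cases "a = b") auto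
      have "spans_over_invariants (E - {b}) n e k (\<lambda>x. \<Sum>a\<in>E. r a x * e a x)"
        by (intro span_sum span_cong[OF span_mult[OF r(1) *]]) auto
      then show ?thesis by (rule span_cong) (auto simp: r(2))
    qed
    then have "?P (E - {b})" using E by (auto simp: generates_polynomials_def)
    then have "card E \<le> card (E - {b})" using min by blast
    then show False using b finE by (metis card_Diff1_less linorder_not_less)
  qed
  with finE E E0 show ?thesis by blast
qed

text \<open>
  Modulo the Hilbert ideal only constant coefficients survive, since a coefficient of an ideal
  element has positive degree or vanishes.
\<close>

lemma hilbert_span:
  assumes E: "generates_polynomials E n e" and h: "hilbert k g"
  shows "\<exists>t. (\<forall>a\<in>E. inv_homog (k - n a) (t a) \<and> (k \<le> n a \<longrightarrow> (\<forall>x. t a x = 0))) \<and> (\<forall>x. g x = (\<Sum>a\<in>E. t a x * e a x))"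
  using h
proof (induction rule: hilbert.induct)
  case (zero k)
  show ?case by (intro exI[of _ "\<lambda>a x. 0"]) (auto intro: inv_homog_zero)
next
  case (add k f g)
  then obtain t u where "\<forall>a\<in>E. inv_homog (k - n a) (t a) \<and> (k \<le> n a \<longrightarrow> (\<forall>x. t a x = 0))"
    "\<forall>x. f x = (\<Sum>a\<in>E. t a x * e a x)"
    "\<forall>a\<in>E. inv_homog (k - n a) (u a) \<and> (k \<le> n a \<longrightarrow> (\<forall>x. u a x = 0))"
    "\<forall>x. g x = (\<Sum>a\<in>E. u a x * e a x)" by blast
  then show ?case by (intro exI[of _ "\<lambda>a x. t a x + u a x"])
      (auto intro: inv_homog_add simp: algebra_simps sum.distrib)
next
  case (gen m f k h)
  obtain r where r: "\<And>a. a \<in> E \<Longrightarrow> inv_homog (k - n a) (r a)" "\<And>x. h x = (\<Sum>a\<in>E. r a x * e a x)"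
    using E gen(3) unfolding generates_polynomials_def spans_over_invariants_def by blast
  have "inv_homog (m + k - n a) (\<lambda>x. f x * r a x)" if "a \<in> E" for a
    by (rule inv_homog_cong[OF inv_homog_mult[OF gen(1) r(1)[OF that]]]) auto
  moreover have "f x * r a x = 0" if "a \<in> E" "m + k \<le> n a" for a x
    using homog_neg[OF inv_homogD(1)[OF r(1)[OF that(1)]]] that(2) gen(2) by simp
  ultimately show ?case
    by (intro exI[of _ "\<lambda>a x. f x * r a x"]) (auto simp: r(2) sum_distrib_left mult.assoc)
qed

end

context reflection_group
begin

text \<open>
  In a nontrivial relation, write all coefficients as combinations of as few of them as possible.
  By \<open>chevalley_relation\<close> each combination of generators that then multiplies one of these
  coefficients lies in the Hilbert ideal. It contains the generator \<open>e b\<close> itself with coefficient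
  \<open>1\<close>, while by \<open>hilbert_span\<close> the coefficient of \<open>e b\<close> in an ideal element of its own degree can
  be taken to be \<open>0\<close>. So \<open>e b\<close> is redundant.
\<close>

lemma minimal_generators_independent:
  assumes finE: "finite E" and he: "\<And>a. a \<in> E \<Longrightarrow> homog (n a) (e a)"
    and gen: "generates_polynomials E n e"
    and min: "\<And>b. b \<in> E \<Longrightarrow> \<not> spans_over_invariants (E - {b}) n e (n b) (e b)"
    and r: "\<And>a. a \<in> E \<Longrightarrow> inv_homog (k - n a) (r a)"
    and rel: "\<And>x. (\<Sum>a\<in>E. r a x * e a x) = 0"
    and a: "a \<in> E"
  shows "r a x = 0"
proof -
  let ?P = "\<lambda>B. B \<subseteq> E \<and> (\<exists>c. \<forall>a\<in>E. (\<forall>b\<in>B. inv_homog (n b - n a) (c a b)) \<and> (\<forall>x. r a x = (\<Sum>b\<in>B. c a b x * r b x)))"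
  have "?P E"
  proof (intro conjI exI[of _ "\<lambda>a b x. if a = b then 1 else 0"] ballI allI)
    fix a b x
    show "inv_homog (n b - n a) (\<lambda>x. if a = b then 1 else 0)"
      by (cases "a = b") (auto intro: inv_homog_const inv_homog_zero)
    assume "a \<in> E"
    then show "r a x = (\<Sum>b\<in>E. (if a = b then 1 else 0) * r b x)"
      using finE sum.delta'[of E a "\<lambda>b. r b x"] by (simp add: if_distrib if_distribR cong: if_cong)
  qed auto
  then obtain B where PB: "?P B" and minB: "\<And>F. ?P F \<Longrightarrow> card B \<le> card F"
    using ex_has_least_nat[of ?P E card] by blast
  obtain c where c: "\<And>a b. a \<in> E \<Longrightarrow> b \<in> B \<Longrightarrow> inv_homog (n b - n a) (c a b)"
    "\<And>a x. a \<in> E \<Longrightarrow> r a x = (\<Sum>b\<in>B. c a b x * r b x)" and BE: "B \<subseteq> E" using PB by blast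
  have finB: "finite B" using BE finE finite_subset by blast
  show ?thesis
  proof (cases "B = {}")
    case True
    then show ?thesis using c(2)[OF a] by simp
  next
    case False
    then obtain b where b: "b \<in> B" by blast
    have indep: "\<not> (\<exists>d. (\<forall>i\<in>B-{b}. inv_homog ((k - n b) - (k - n i)) (d i)) \<and> (\<forall>x. r b x = (\<Sum>i\<in>B-{b}. d i x * r i x)))"
    proof
      assume "\<exists>d. (\<forall>i\<in>B-{b}. inv_homog ((k - n b) - (k - n i)) (d i)) \<and> (\<forall>x. r b x = (\<Sum>i\<in>B-{b}. d i x * r i x))"
      then obtain d where d: "\<And>i. i \<in> B - {b} \<Longrightarrow> inv_homog (n i - n b) (d i)"
        "\<And>x. r b x = (\<Sum>i\<in>B-{b}. d i x * r i x)" by auto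
      have "?P (B - {b})"
      proof (intro conjI exI[of _ "\<lambda>a i x. c a i x + c a b x * d i x"] ballI allI)
        show "B - {b} \<subseteq> E" using BE by blast
        fix a assume a: "a \<in> E"
        show "inv_homog (n i - n a) (\<lambda>x. c a i x + c a b x * d i x)" if "i \<in> B - {b}" for i
          by (intro inv_homog_add c(1) inv_homog_cong[OF inv_homog_mult[OF c(1)[OF a b] d(1)[OF that]]])
            (use a that in auto)
        show "r a x = (\<Sum>i\<in>B-{b}. (c a i x + c a b x * d i x) * r i x)" for x
        proof -
          have "r a x = c a b x * r b x + (\<Sum>i\<in>B-{b}. c a i x * r i x)"
            using c(2)[OF a, of x] by (simp add: sum.remove[OF finB b])
          then show ?thesis by (simp add: d(2) sum_distrib_left algebra_simps sum.distrib)
        qed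
      qed
      then have "card B \<le> card (B - {b})" using minB by blast
      then show False using b finB by (metis card_Diff1_less linorder_not_less)
    qed
    \<comment> \<open>the coefficients indexed by \<open>B\<close> are expressed trivially by themselves\<close>
    define c' where "c' a i = (if a \<in> B then (\<lambda>x. if a = i then 1 else 0) else c a i)" for a i
    have c'1: "inv_homog (n i - n a) (c' a i)" if "a \<in> E" "i \<in> B" for a i
      using c(1)[OF that] by (auto simp: c'_def inv_homog_const inv_homog_zero)
    have c'2: "r a x = (\<Sum>i\<in>B. c' a i x * r i x)" if "a \<in> E" for a x
    proof (cases "a \<in> B")
      case True
      then show ?thesis using finB sum.delta'[of B a "\<lambda>b. r b x"]
        by (simp add: c'_def if_distrib if_distribR cong: if_cong)
    qed (use c(2)[OF that] in \<open>simp add: c'_def\<close>)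
    define g where "g i x = (\<Sum>a\<in>E. c' a i x * e a x)" for i x
    have hg: "homog (k - (k - n i)) (g i)" if "i \<in> B" for i
      unfolding g_def
      by (intro homog_sum homog_cong[OF homog_mult[OF inv_homogD(1)[OF c'1] he]]) (use that in auto)
    have rg: "(\<Sum>i\<in>B. r i x * g i x) = 0" for x
    proof -
      have "(\<Sum>i\<in>B. r i x * g i x) = (\<Sum>i\<in>B. \<Sum>a\<in>E. c' a i x * r i x * e a x)"
        by (simp add: g_def sum_distrib_left algebra_simps)
      also have "\<dots> = (\<Sum>a\<in>E. (\<Sum>i\<in>B. c' a i x * r i x) * e a x)"
        by (subst sum.swap) (simp add: sum_distrib_right)
      also have "\<dots> = 0" using rel[of x] by (simp add: c'2[symmetric])
      finally show ?thesis .
    qed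
    have rB: "inv_homog (k - n i) (r i)" if "i \<in> B" for i using r BE that by blast
    have "hilbert (k - (k - n b)) (g b)"
      using chevalley_relation[OF finB b rB indep hg rg] by blast
    then have "hilbert (n b) (g b)" by simp
    then obtain t where t: "\<And>a. a \<in> E \<Longrightarrow> inv_homog (n b - n a) (t a)"
      "\<And>a x. a \<in> E \<Longrightarrow> n b \<le> n a \<Longrightarrow> t a x = 0" "\<And>x. g b x = (\<Sum>a\<in>E. t a x * e a x)"
      using hilbert_span[OF gen] by blast
    have bE: "b \<in> E" using b BE by blast
    have "e b x = (\<Sum>a\<in>E-{b}. (t a x - c' a b x) * e a x)" for x
    proof -
      have "g b x = e b x + (\<Sum>a\<in>E-{b}. c' a b x * e a x)"
        by (simp add: g_def sum.remove[OF finE bE]) (simp add: c'_def b)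
      moreover have "g b x = (\<Sum>a\<in>E-{b}. t a x * e a x)"
        using t(2)[OF bE] by (simp add: t(3) sum.remove[OF finE bE])
      ultimately show ?thesis by (simp add: algebra_simps sum_subtractf)
    qed
    moreover have "inv_homog (n b - n a) (\<lambda>x. t a x - c' a b x)" if "a \<in> E - {b}" for a
      using t(1)[of a] c'1[of a b] that b by (intro inv_homog_diff) auto
    ultimately have "spans_over_invariants (E - {b}) n e (n b) (e b)"
      unfolding spans_over_invariants_def
      by (intro exI[of _ "\<lambda>a x. t a x - c' a b x"]) auto
    then show ?thesis using min[OF bE] by contradiction
  qed
qed

definition free_basis :: "('n \<Rightarrow> nat) set \<Rightarrow> (('n \<Rightarrow> nat) \<Rightarrow> int) \<Rightarrow> (('n \<Rightarrow> nat) \<Rightarrow> complex^'n \<Rightarrow> complex) \<Rightarrow> bool" where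
  "free_basis E n e \<longleftrightarrow> finite E \<and> (\<forall>a\<in>E. homog (n a) (e a)) \<and> generates_polynomials E n e \<and>
     (\<forall>k r. (\<forall>a\<in>E. inv_homog (k - n a) (r a)) \<longrightarrow> (\<forall>x. (\<Sum>a\<in>E. r a x * e a x) = 0) \<longrightarrow>
        (\<forall>a\<in>E. \<forall>x. r a x = 0))"

text \<open>A generating set of minimal size is a basis.\<close>

theorem free_over_invariants: "\<exists>E n e. free_basis E n e"
proof -
  obtain E :: "('n \<Rightarrow> nat) set" and n e where
    E: "finite E" "\<forall>a\<in>E. homog (n a) (e a)" "generates_polynomials E n e"
      "\<forall>b\<in>E. \<not> spans_over_invariants (E - {b}) n e (n b) (e b)"
    using minimal_generation by blast
  have "r a x = 0"
    if "\<forall>a\<in>E. inv_homog (k - n a) (r a)" "\<forall>x. (\<Sum>a\<in>E. r a x * e a x) = 0" "a \<in> E" for k r a x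
    by (rule minimal_generators_independent[OF E(1) E(2)[rule_format] E(3) E(4)[rule_format]
          that(1)[rule_format] that(2)[rule_format] that(3)])
  then show ?thesis unfolding free_basis_def
    by (intro exI[of _ E] exI[of _ n] exI[of _ e] conjI E(1-3) allI impI ballI)
qed

end

text \<open>
  Induction on the number of subspaces: a line through a vector that avoids all but the last of
  them, in a direction outside the last one, meets each subspace in at most one point.
\<close>

lemma avoid_proper_subspaces:
  fixes \<S> :: "(complex^'n) set set"
  assumes "finite \<S>" "\<And>S. S \<in> \<S> \<Longrightarrow> vec.subspace S" "\<And>S. S \<in> \<S> \<Longrightarrow> S \<noteq> UNIV"
  shows "\<exists>v. \<forall>S\<in>\<S>. v \<notin> S"
  using assms
proof (induction \<S> rule: finite_induct)
  case (insert S \<S>)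
  then obtain v where v: "\<forall>T\<in>\<S>. v \<notin> T" by blast
  show ?case
  proof (cases "v \<in> S")
    case True
    obtain u where u: "u \<notin> S" using insert.prems(2) by blast
    define bad where "bad T = {t::complex. v + t *s u \<in> T}" for T
    have "finite (bad T)" if "T \<in> \<S>" for T
    proof -
      have T: "vec.subspace T" using insert.prems(1) that by blast
      have "t = t'" if t: "t \<in> bad T" "t' \<in> bad T" for t t'
      proof (rule ccontr)
        assume ne: "t \<noteq> t'"
        have "(v + t *s u) - (v + t' *s u) \<in> T"
          by (rule vec.subspace_diff[OF T]) (use t in \<open>auto simp: bad_def\<close>)
        then have "(t - t') *s u \<in> T" by (simp add: vec.scale_left_diff_distrib)
        then have "(1 / (t - t')) *s ((t - t') *s u) \<in> T" by (rule vec.subspace_scale[OF T])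
        moreover have "(1 / (t - t')) *s ((t - t') *s u) = u"
          unfolding vector_smult_assoc using ne by simp
        ultimately have uT: "u \<in> T" by simp
        have "(v + t *s u) - t *s u \<in> T"
          by (rule vec.subspace_diff[OF T _ vec.subspace_scale[OF T uT]]) (use t in \<open>simp add: bad_def\<close>)
        then show False using v \<open>T \<in> \<S>\<close> by simp
      qed
      then have "bad T \<subseteq> {SOME t. t \<in> bad T}" by (metis someI singleton_iff subsetI)
      then show ?thesis by (rule finite_subset) simp
    qed
    then have "finite (insert 0 (\<Union>T\<in>\<S>. bad T))" using insert.hyps(1) by blast
    then obtain t where t: "t \<notin> insert 0 (\<Union>T\<in>\<S>. bad T)"
      using ex_new_if_finite[OF infinite_UNIV_char_0] by blast
    have S: "vec.subspace S" using insert.prems(1) by blast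
    have "v + t *s u \<notin> S"
    proof
      assume "v + t *s u \<in> S"
      then have "(v + t *s u) - v \<in> S" using True by (rule vec.subspace_diff[OF S])
      then have "t *s u \<in> S" by simp
      then have "(1 / t) *s (t *s u) \<in> S" by (rule vec.subspace_scale[OF S])
      moreover have "(1 / t) *s (t *s u) = u" unfolding vector_smult_assoc using t by simp
      ultimately show False using u by simp
    qed
    moreover have "\<forall>T\<in>\<S>. v + t *s u \<notin> T" using t by (auto simp: bad_def)
    ultimately show ?thesis by blast
  qed (use v in blast)
qed simp

section \<open>Interpolation on free orbits\<close>

context finite_matrix_group
begin

text \<open>
  Lagrange interpolation on the orbit of \<open>z\<close>, with the values of a linear form \<open>l\<close> as nodes:
  \<open>node_poly\<close> vanishes at the nodes of all points of the orbit other than \<open>z\<close>, and \<open>node_diff\<close> is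
  its value at the node of \<open>z\<close>.
\<close>

definition node_poly :: "complex^'n \<Rightarrow> complex^'n \<Rightarrow> complex poly" where
  "node_poly l z = (\<Prod>u\<in>W-{mat 1}. [:- lf l (u *v z), 1:])"

definition node_diff :: "complex^'n \<Rightarrow> complex^'n \<Rightarrow> complex" where
  "node_diff l z = poly (node_poly l z) (lf l z)"

lemma poly_node_poly: "poly (node_poly l z) T = (\<Prod>u\<in>W-{mat 1}. T - lf l (u *v z))"
  by (simp add: node_poly_def poly_prod)

lemma card_W_minus_one: "card (W - {mat 1}) = card W - 1"
  using finite_W one_W by simp

lemma poly_node_poly_sum:
  "poly (node_poly l z) T = (\<Sum>j<card W. Polynomial.coeff (node_poly l z) j * T ^ j)"
proof -
  have "degree (node_poly l z) = card W - 1"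
    by (simp add: node_poly_def degree_prod_eq_sum_degree finite_W card_W_minus_one one_W)
  then have "{..degree (node_poly l z)} = {..<card W}" using card_W_pos by auto
  then show ?thesis by (simp add: poly_altdef)
qed

lemma homog_coeff_node_poly:
  "homog (int (card W) - 1 - int j) (\<lambda>z. Polynomial.coeff (node_poly l z) j)"
  unfolding node_poly_def
  by (rule homog_cong[OF homog_coeff_prod_linear[OF _ homog_compose[OF homog_lf]]])
    (use finite_W card_W_pos in \<open>auto simp: card_W_minus_one\<close>)

lemma homog_node_diff: "homog (int (card W) - 1) (node_diff l)"
proof -
  have "homog (\<Sum>u\<in>W-{mat 1}. 1) (\<lambda>z. \<Prod>u\<in>W-{mat 1}. lf l z - lf l (u *v z))"
    by (intro homog_prod homog_diff homog_lf homog_compose[OF homog_lf]) (simp add: finite_W)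
  then show ?thesis
    by (rule homog_cong) (use card_W_pos in \<open>auto simp: node_diff_def poly_node_poly card_W_minus_one\<close>)
qed

lemma node_poly_at_node:
  assumes "w \<in> W" shows "poly (node_poly l z) (lf l (w *v z)) = (if w = mat 1 then node_diff l z else 0)"
proof (cases "w = mat 1")
  case False
  then show ?thesis using assms
    by (auto simp: poly_node_poly intro!: prod_zero finite_W bexI[of _ w])
qed (simp add: node_diff_def)

lemma node_poly_translate:
  assumes "w \<in> W" shows "poly (node_poly l (w *v z)) (lf l z) = (if w = mat 1 then node_diff l z else 0)"
proof -
  obtain v where v: "v \<in> W" "v ** w = mat 1" "w ** v = mat 1" using inv_W assms by blast
  have "poly (node_poly l (w *v z)) (lf l (v *v (w *v z))) = (if v = mat 1 then node_diff l (w *v z) else 0)"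
    by (rule node_poly_at_node[OF v(1)])
  moreover have "v = mat 1 \<longleftrightarrow> w = mat 1" using v by auto
  ultimately show ?thesis by (auto simp: matrix_vector_mul_assoc v)
qed

definition discriminant_form :: "complex^'n \<Rightarrow> complex^'n \<Rightarrow> complex" where
  "discriminant_form l z = (\<Prod>w\<in>W. node_diff l (w *v z))"

lemma inv_homog_discriminant:
  "inv_homog (int (card W) * (int (card W) - 1)) (discriminant_form l)"
proof -
  have "homog (\<Sum>w\<in>W. int (card W) - 1) (discriminant_form l)"
    unfolding discriminant_form_def[abs_def]
    by (intro homog_prod finite_W homog_compose[OF homog_node_diff])
  moreover have "discriminant_form l (u *v x) = discriminant_form l x" if "u \<in> W" for u x
    using prod.reindex_bij_betw[OF bij_betw_mult_right[OF that], of "\<lambda>w. node_diff l (w *v x)"]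
    by (simp add: discriminant_form_def matrix_vector_mul_assoc)
  ultimately show ?thesis by (simp add: inv_homog_def invariant_def)
qed

definition free_points :: "(complex^'n) set" where
  "free_points = {z. \<forall>w\<in>W. w \<noteq> mat 1 \<longrightarrow> w *v z \<noteq> z}"

text \<open>The element \<open>g\<close> is the quotient of \<open>w\<close> by \<open>u\<close>.\<close>

lemma transporter:
  assumes "w \<in> W" "u \<in> W" "w *v x = u *v y"
  shows "\<exists>g\<in>W. g *v x = y \<and> (g = mat 1 \<longrightarrow> w = u)"
proof -
  obtain v where v: "v \<in> W" "v ** u = mat 1" "u ** v = mat 1" using inv_W assms(2) by blast
  have "(v ** w) *v x = v *v (u *v y)" using assms(3) by (simp add: matrix_vector_mul_assoc[symmetric])
  also have "\<dots> = y" by (simp add: matrix_vector_mul_assoc v)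
  finally have "(v ** w) *v x = y" .
  moreover have "w = u" if "v ** w = mat 1"
  proof -
    have "u ** (v ** w) = u" using that by simp
    then show ?thesis by (simp add: matrix_mul_assoc v)
  qed
  ultimately show ?thesis using mult_W[OF v(1) assms(1)] by blast
qed

lemma free_points_cancel:
  assumes "x \<in> free_points" "w \<in> W" "u \<in> W" "w *v x = u *v x" shows "w = u"
  using transporter[OF assms(2,3,4)] assms(1) by (auto simp: free_points_def)

lemma left_unit_W:
  assumes "w \<in> W" "u ** w = w" shows "u = mat 1"
  using inv_W[OF assms(1)] assms(2) by (metis matrix_mul_assoc matrix_mul_rid)

text \<open>
  The differences of distinct points of a free orbit are finitely many nonzero vectors, so a
  generic form is nonzero on all of them.
\<close>

lemma free_point_separated:
  assumes "z \<in> free_points"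
  shows "\<exists>l. discriminant_form l z \<noteq> 0"
proof -
  define K where "K d = {l. lf l d = 0}" for d :: "complex^'n"
  define D where "D = (\<lambda>(u, w). w *v z - u *v (w *v z)) ` ((W - {mat 1}) \<times> W)"
  have nz: "d \<noteq> 0" if d: "d \<in> D" for d
  proof
    assume "d = 0"
    obtain u w where uw': "u \<in> W" "u \<noteq> mat 1" "w \<in> W" "d = w *v z - u *v (w *v z)"
      using d by (auto simp: D_def)
    then have "u *v (w *v z) = w *v z" using \<open>d = 0\<close> by (metis right_minus_eq)
    note uw = uw'(1-3) this
    have "u ** w = w"
      by (rule free_points_cancel[OF assms mult_W[OF uw(1,3)] uw(3)])
        (use uw(4) in \<open>simp add: matrix_vector_mul_assoc\<close>)
    then have "u = mat 1" by (rule left_unit_W[OF uw(3)])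
    then show False using uw by simp
  qed
  have "\<exists>l. \<forall>S\<in>K ` D. l \<notin> S"
  proof (rule avoid_proper_subspaces)
    show "finite (K ` D)" using finite_W by (simp add: D_def)
    fix S assume "S \<in> K ` D"
    then obtain d where d: "d \<in> D" "S = K d" by blast
    show "vec.subspace S"
      by (auto simp: d K_def vec.subspace_def lf_add lf_scale lf_zero lf_commute[of _ d])
    show "S \<noteq> UNIV" using nz[OF d(1)] lf_eq_0_iff[of d] by (auto simp: d K_def lf_commute)
  qed
  then obtain l where l: "\<And>d. d \<in> D \<Longrightarrow> lf l d \<noteq> 0" by (auto simp: K_def)
  have "lf l (w *v z) - lf l (u *v (w *v z)) \<noteq> 0" if "w \<in> W" "u \<in> W - {mat 1}" for u w
  proof -
    have "w *v z - u *v (w *v z) \<in> D" unfolding D_def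
      by (rule image_eqI[of _ _ "(u, w)"]) (use that in auto)
    then show ?thesis using l by (simp add: lf_diff[symmetric] del: right_minus_eq)
  qed
  then have "node_diff l (w *v z) \<noteq> 0" if "w \<in> W" for w
    using that finite_W by (simp add: node_diff_def poly_node_poly)
  then show ?thesis using finite_W by (auto simp: discriminant_form_def)
qed

end

lemma prod_sum_swap:
  fixes f :: "'a \<Rightarrow> 'b \<Rightarrow> 'c::comm_semiring_0"
  shows "(\<Sum>a\<in>A. (\<Sum>b\<in>B. f b a) * g a) = (\<Sum>b\<in>B. \<Sum>a\<in>A. f b a * g a)"
  by (subst sum.swap) (simp add: sum_distrib_right)

context reflection_group
begin

text \<open>
  The functions \<open>b a\<close> are the basis dual to \<open>e\<close> for the form \<open>(f, g) \<mapsto> \<Sum>w\<in>W. f (w p) * g (w p)\<close>.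
  For a linear form \<open>l\<close> that separates the orbit of \<open>p\<close>, interpolation gives \<open>b a = B l a /
  node_diff l\<close>, where \<open>B l a\<close> is built from the coordinates of the powers of \<open>l\<close> in the basis.
  Linear independence of the basis over the invariants shows that this quotient does not depend on
  \<open>l\<close>; as some \<open>l\<close> separates any given free orbit, the functions are regular at all free points. A
  single \<open>l\<close> does not suffice, since \<open>node_diff l\<close> vanishes on a hypersurface if \<open>W\<close> is not
  trivial.
\<close>

lemma trace_dual_basis:
  "\<exists>(E::('n \<Rightarrow> nat) set) e b. finite E \<and>
     (\<forall>a\<in>E. \<exists>k. homog k (e a)) \<and>
     (\<forall>p\<in>free_points. \<forall>w\<in>W. (\<Sum>a\<in>E. b a p * e a (w *v p)) = (if w = mat 1 then 1 else 0)) \<and>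
     (\<forall>p\<in>free_points. \<exists>U. open U \<and> p \<in> U \<and>
        (\<forall>a\<in>E. \<exists>j k f g. homog j f \<and> homog k g \<and> (\<forall>q\<in>U. g q \<noteq> 0 \<and> b a q = f q / g q)))"
proof -
  obtain E :: "('n \<Rightarrow> nat) set" and n e where "free_basis E n e"
    using free_over_invariants by (elim exE) (rule that)
  note fb = this[unfolded free_basis_def]
  note finE = fb[THEN conjunct1] and he = fb[THEN conjunct2, THEN conjunct1]
    and gen = fb[THEN conjunct2, THEN conjunct2, THEN conjunct1]
    and ind = fb[THEN conjunct2, THEN conjunct2, THEN conjunct2]
  let ?N = "int (card W)"
  have ex: "\<exists>r. (\<forall>a\<in>E. inv_homog (int j - n a) (r a)) \<and> (\<forall>x. lf l x ^ j = (\<Sum>a\<in>E. r a x * e a x))" for l j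
  proof -
    have "homog (int j) (\<lambda>x. lf l x ^ j)" by (rule homog_cong[OF homog_power[OF homog_lf]]) auto
    then show ?thesis using gen unfolding generates_polynomials_def spans_over_invariants_def by blast
  qed
  define rr where "rr l j = (SOME r. (\<forall>a\<in>E. inv_homog (int j - n a) (r a)) \<and>
      (\<forall>x. lf l x ^ j = (\<Sum>a\<in>E. r a x * e a x)))" for l j
  have rr: "a \<in> E \<Longrightarrow> inv_homog (int j - n a) (rr l j a)"
    "lf l x ^ j = (\<Sum>a\<in>E. rr l j a x * e a x)" for l j a x
    using someI_ex[OF ex[of j l], folded rr_def] by blast+
  define B where "B l a z = (\<Sum>j<card W. Polynomial.coeff (node_poly l z) j * rr l j a z)" for l a z
  have hB: "homog (?N - 1 - n a) (B l a)" if "a \<in> E" for l a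
    unfolding B_def
    by (intro homog_sum homog_cong[OF homog_mult[OF homog_coeff_node_poly inv_homogD(1)[OF rr(1)[OF that]]]]) auto
  have sumB: "(\<Sum>a\<in>E. B l a z * e a (w *v z)) = poly (node_poly l z) (lf l (w *v z))" if w: "w \<in> W" for l z w
  proof -
    have "(\<Sum>a\<in>E. B l a z * e a (w *v z)) =
        (\<Sum>j<card W. \<Sum>a\<in>E. Polynomial.coeff (node_poly l z) j * rr l j a z * e a (w *v z))"
      unfolding B_def by (rule prod_sum_swap)
    also have "\<dots> = (\<Sum>j<card W. Polynomial.coeff (node_poly l z) j * (\<Sum>a\<in>E. rr l j a (w *v z) * e a (w *v z)))"
      by (simp add: sum_distrib_left mult.assoc inv_homogD(2)[OF rr(1) w] cong: sum.cong)
    finally show ?thesis by (simp add: rr(2)[symmetric] poly_node_poly_sum)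
  qed
  define G where "G l z = (\<Prod>u\<in>W-{mat 1}. node_diff l (u *v z))" for l z
  have hG: "homog ((?N - 1) * (?N - 1)) (G l)" for l
  proof -
    have "homog (\<Sum>u\<in>W-{mat 1}. ?N - 1) (G l)"
      unfolding G_def[abs_def] by (intro homog_prod homog_compose[OF homog_node_diff]) (simp add: finite_W)
    then show ?thesis by (rule homog_cong) (use card_W_pos in \<open>auto simp: card_W_minus_one\<close>)
  qed
  have DG: "discriminant_form l z = node_diff l z * G l z" for l z
    unfolding discriminant_form_def G_def by (subst prod.remove[OF finite_W one_W]) simp
  \<comment> \<open>both sides are coordinates of \<open>discriminant_form l * e a'\<close>, by Lagrange interpolation\<close>
  have dual: "(\<Sum>w\<in>W. e a' (w *v z) * B l a (w *v z) * G l (w *v z)) = (if a = a' then discriminant_form l z else 0)"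
    if a': "a' \<in> E" and a: "a \<in> E" for l a a' z
  proof -
    define T where "T a z = (\<Sum>w\<in>W. e a' (w *v z) * B l a (w *v z) * G l (w *v z))" for a z
    define k where "k = n a' + ?N * (?N - 1)"
    define r where "r a z = T a z - (if a = a' then discriminant_form l z else 0)" for a z
    have "inv_homog (k - n a) (T a)" if "a \<in> E" for a
    proof -
      have "homog (k - n a) (\<lambda>z. e a' z * B l a z * G l z)"
        by (rule homog_cong[OF homog_mult[OF homog_mult[OF he[rule_format, OF a'] hB[OF that]] hG]])
          (auto simp: k_def algebra_simps)
      then show ?thesis unfolding T_def by (rule inv_homog_orbit_sum)
    qed
    moreover have "inv_homog (k - n a) (\<lambda>z. if a = a' then discriminant_form l z else 0)" for a
      using inv_homog_discriminant[of l] by (cases "a = a'") (auto simp: k_def inv_homog_zero)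
    ultimately have "\<forall>a\<in>E. inv_homog (k - n a) (r a)"
      unfolding r_def by (auto intro!: inv_homog_diff)
    moreover have "\<forall>z. (\<Sum>a\<in>E. r a z * e a z) = 0"
    proof
      fix z
      have "(\<Sum>a\<in>E. T a z * e a z) =
          (\<Sum>w\<in>W. \<Sum>a\<in>E. e a' (w *v z) * B l a (w *v z) * G l (w *v z) * e a z)"
        unfolding T_def by (rule prod_sum_swap)
      also have "\<dots> = (\<Sum>w\<in>W. if w = mat 1 then e a' z * G l z * node_diff l z else 0)"
      proof (rule sum.cong[OF refl])
        fix w assume w: "w \<in> W"
        obtain v where v: "v \<in> W" "v ** w = mat 1" "w ** v = mat 1" using inv_W w by blast
        have "(\<Sum>a\<in>E. e a' (w *v z) * B l a (w *v z) * G l (w *v z) * e a z) =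
          e a' (w *v z) * G l (w *v z) * (\<Sum>a\<in>E. B l a (w *v z) * e a z)"
          by (simp add: sum_distrib_left algebra_simps)
        also have "(\<Sum>a\<in>E. B l a (w *v z) * e a z) = poly (node_poly l (w *v z)) (lf l z)"
          using sumB[OF v(1), of l "w *v z"] by (simp add: matrix_vector_mul_assoc v)
        finally show "(\<Sum>a\<in>E. e a' (w *v z) * B l a (w *v z) * G l (w *v z) * e a z) =
            (if w = mat 1 then e a' z * G l z * node_diff l z else 0)"
          by (simp add: node_poly_translate[OF w])
      qed
      also have "\<dots> = e a' z * discriminant_form l z"
        using finite_W one_W by (simp add: DG)
      finally have "(\<Sum>a\<in>E. T a z * e a z) = discriminant_form l z * e a' z" by simp
      moreover have "(\<Sum>a\<in>E. (if a = a' then discriminant_form l z else 0) * e a z) = discriminant_form l z * e a' z"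
        using finE a' sum.delta[of E a' "\<lambda>a. discriminant_form l z * e a z"]
        by (simp add: if_distrib if_distribR cong: if_cong)
      ultimately show "(\<Sum>a\<in>E. r a z * e a z) = 0"
        by (simp add: r_def left_diff_distrib sum_subtractf)
    qed
    ultimately have "\<forall>a\<in>E. \<forall>z. r a z = 0"
      by (rule ind[THEN spec, of k, THEN spec, of r, THEN mp, THEN mp])
    then have "r a z = 0" using a by blast
    then show ?thesis by (simp add: r_def T_def)
  qed
  have indep_of_form: "B l a z / node_diff l z = B l' a z / node_diff l' z"
    if nz: "discriminant_form l z \<noteq> 0" "discriminant_form l' z \<noteq> 0" and a: "a \<in> E" for l l' a z
  proof -
    have nd: "node_diff l z \<noteq> 0" "node_diff l' z \<noteq> 0" using nz by (auto simp: DG)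
    have "discriminant_form l' z * B l a z = (\<Sum>a'\<in>E. (if a = a' then discriminant_form l' z else 0) * B l a' z)"
      using finE a sum.delta'[of E a "\<lambda>a'. discriminant_form l' z * B l a' z"]
      by (simp add: if_distrib if_distribR cong: if_cong)
    also have "\<dots> = (\<Sum>a'\<in>E. (\<Sum>w\<in>W. e a' (w *v z) * B l' a (w *v z) * G l' (w *v z)) * B l a' z)"
      by (intro sum.cong refl) (simp add: dual a)
    also have "\<dots> = (\<Sum>w\<in>W. \<Sum>a'\<in>E. e a' (w *v z) * B l' a (w *v z) * G l' (w *v z) * B l a' z)"
      by (rule prod_sum_swap)
    also have "\<dots> = (\<Sum>w\<in>W. B l' a (w *v z) * G l' (w *v z) * (\<Sum>a'\<in>E. B l a' z * e a' (w *v z)))"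
      by (simp add: sum_distrib_left algebra_simps)
    also have "\<dots> = (\<Sum>w\<in>W. if w = mat 1 then B l' a z * G l' z * node_diff l z else 0)"
      by (intro sum.cong refl) (simp add: sumB node_poly_at_node)
    also have "\<dots> = B l' a z * G l' z * node_diff l z"
      using finite_W one_W by simp
    finally have "node_diff l' z * G l' z * B l a z = B l' a z * G l' z * node_diff l z"
      by (simp add: DG)
    moreover have "G l' z \<noteq> 0" using nz by (auto simp: DG)
    ultimately show ?thesis using nd by (simp add: field_simps)
  qed
  define b where "b a p = (let l = SOME l. discriminant_form l p \<noteq> 0 in B l a p / node_diff l p)" for a p
  have b_eq: "b a p = B l a p / node_diff l p" if "discriminant_form l p \<noteq> 0" "a \<in> E" for a l p
    unfolding b_def Let_def
    by (rule indep_of_form[OF _ that]) (rule someI[of "\<lambda>l. discriminant_form l p \<noteq> 0", OF that(1)])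
  have F1: "(\<Sum>a\<in>E. b a p * e a (w *v p)) = (if w = mat 1 then 1 else 0)"
    if p: "p \<in> free_points" and w: "w \<in> W" for p w
  proof -
    obtain l where l: "discriminant_form l p \<noteq> 0" using free_point_separated p by blast
    have "(\<Sum>a\<in>E. b a p * e a (w *v p)) = (\<Sum>a\<in>E. B l a p * e a (w *v p)) / node_diff l p"
      by (simp add: b_eq[OF l] sum_divide_distrib)
    also have "\<dots> = (if w = mat 1 then 1 else 0)"
      using l by (auto simp: sumB[OF w] node_poly_at_node[OF w] DG)
    finally show ?thesis .
  qed
  have F2: "\<exists>U. open U \<and> p \<in> U \<and>
        (\<forall>a\<in>E. \<exists>j k f g. homog j f \<and> homog k g \<and> (\<forall>q\<in>U. g q \<noteq> 0 \<and> b a q = f q / g q))"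
    if p: "p \<in> free_points" for p
  proof -
    obtain l where l: "discriminant_form l p \<noteq> 0" using free_point_separated p by blast
    define U where "U = {q. discriminant_form l q \<noteq> 0}"
    have "continuous_on UNIV (discriminant_form l)"
      by (rule continuous_on_homog[OF inv_homogD(1)[OF inv_homog_discriminant] continuous_on_id])
    then have oU: "open U" unfolding U_def
      by (rule open_Collect_neq[OF _ continuous_on_const])
    have pU: "p \<in> U" using l by (simp add: U_def)
    have *: "\<forall>q\<in>U. node_diff l q \<noteq> 0 \<and> b a q = B l a q / node_diff l q" if "a \<in> E" for a
      using b_eq that by (auto simp: U_def DG)
    have "\<exists>j k f g. homog j f \<and> homog k g \<and> (\<forall>q\<in>U. g q \<noteq> 0 \<and> b a q = f q / g q)"
      if a: "a \<in> E" for a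
      by (intro exI[of _ "?N - 1 - n a"] exI[of _ "?N - 1"] exI[of _ "B l a"] exI[of _ "node_diff l"]
          conjI hB a homog_node_diff) (rule *[OF a])
    then show ?thesis by (intro exI[of _ U] conjI ballI oU pU)
  qed
  have F3: "\<exists>k. homog k (e a)" if "a \<in> E" for a using he that by blast
  show ?thesis
    by (intro exI[of _ E] exI[of _ e] exI[of _ b] conjI ballI finE F1 F2 F3)
qed

end

section \<open>Freeness of the action on the hyperplane complement\<close>

context reflection_group
begin

text \<open>A fixed space of codimension one would be a reflecting hyperplane through \<open>x\<close>.\<close>

lemma fixed_space_codim:
  assumes w: "w \<in> W" "w \<noteq> mat 1" and x: "w *v x = x" "x \<in> hyperplane_complement W"
  shows "vec.dim {y. w *v y = y} + 1 < CARD('n)"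
proof -
  let ?F = "{y. w *v y = y}"
  have F: "vec.subspace ?F"
    by (auto simp: vec.subspace_def matrix_vector_right_distrib vector_scalar_commute)
  have "?F \<noteq> UNIV"
  proof
    assume "?F = UNIV"
    then have "w *v y = mat 1 *v y" for y by auto
    then have "w = mat 1" by (simp add: matrix_eq)
    then show False using w by simp
  qed
  then have "vec.dim ?F < CARD('n)" by (rule vec_dim_proper_subspace[OF F])
  moreover have "vec.dim ?F + 1 \<noteq> CARD('n)"
  proof
    assume "vec.dim ?F + 1 = CARD('n)"
    then have H: "hyperplane ?F" using F by (simp add: hyperplane_def)
    have f: "fixes_pointwise w ?F" by (simp add: fixes_pointwise_def)
    have "invertible w" using inv_W[OF w(1)] by (auto simp: invertible_def)
    then have "is_reflection w" using H f w by (auto simp: is_reflection_def)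
    then have "?F \<in> reflecting_hyperplanes W" using H f w by (auto simp: reflecting_hyperplanes_def)
    then show False using x by (auto simp: hyperplane_complement_def)
  qed
  ultimately show ?thesis by linarith
qed

text \<open>
  Assume that \<open>u \<noteq> 1\<close> fixes \<open>x\<close>. By \<open>fixed_space_codim\<close> a generic plane \<open>x + s v' + t v\<close> meets the
  set of points with nontrivial stabiliser only in \<open>x\<close>, locally. For \<open>s \<noteq> 0\<close> the dual basis is
  holomorphic in \<open>t\<close>, so its value at \<open>p = x + s v'\<close> is bounded by its maximum over the compact
  set where \<open>t\<close> has norm \<open>\<epsilon>\<close> and \<open>s\<close> has norm at most \<open>\<epsilon>\<close>. The duality relations for \<open>1\<close> and \<open>u\<close>
  give \<open>1 = (\<Sum>a. b a p * (e a p - e a (u p)))\<close>, and the right hand side tends to \<open>0\<close> with \<open>s\<close>.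
\<close>

theorem steinberg:
  assumes x: "x \<in> hyperplane_complement W" and u: "u \<in> W" "u *v x = x"
  shows "u = mat 1"
proof (rule ccontr)
  assume u1: "u \<noteq> mat 1"
  define Fx where "Fx w = {y. w *v y = y}" for w :: "complex^'n^'n"
  define G where "G = {w\<in>W. w \<noteq> mat 1 \<and> w *v x = x}"
  have finG: "finite G" using finite_W by (simp add: G_def)
  have dimF: "vec.dim (Fx w) + 1 < CARD('n)" if "w \<in> G" for w
    using fixed_space_codim[of w x] that x by (auto simp: G_def Fx_def)
  have subF: "vec.subspace (Fx w)" for w
    by (auto simp: Fx_def vec.subspace_def matrix_vector_right_distrib vector_scalar_commute)
  have "\<exists>v. \<forall>S\<in>Fx ` G. v \<notin> S"
    by (rule avoid_proper_subspaces)
      (use finG subF dimF vec_dim_card[where 'n='n and 'a=complex] in \<open>fastforce+\<close>)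
  then obtain v where v: "\<And>w. w \<in> G \<Longrightarrow> v \<notin> Fx w" by blast
  have "\<exists>v'. \<forall>S\<in>(\<lambda>w. vec.span (insert v (Fx w))) ` G. v' \<notin> S"
  proof (rule avoid_proper_subspaces)
    fix S assume "S \<in> (\<lambda>w. vec.span (insert v (Fx w))) ` G"
    then obtain w where w: "w \<in> G" "S = vec.span (insert v (Fx w))" by blast
    show "vec.subspace S" by (simp add: w)
    have "vec.dim S < CARD('n)"
      using dimF[OF w(1)] by (simp add: w vec.dim_insert)
    then show "S \<noteq> UNIV" using vec_dim_card[where 'n='n and 'a=complex] by fastforce
  qed (use finG in auto)
  then obtain v' where v': "\<And>w. w \<in> G \<Longrightarrow> v' \<notin> vec.span (insert v (Fx w))" by blast
  define h where "h s t = x + s *s v' + t *s v" for s t :: complex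
  have h_fixed: "s = 0 \<and> t = 0" if "w \<in> G" "w *v h s t = h s t" for w s t
  proof -
    have "w *v x = x" using that by (simp add: G_def)
    then have y: "s *s v' + t *s v \<in> Fx w"
      using that(2) by (simp add: Fx_def h_def matrix_vector_right_distrib)
    have "s = 0"
    proof (rule ccontr)
      assume s: "s \<noteq> 0"
      have "s *s v' + t *s v \<in> vec.span (insert v (Fx w))"
        "t *s v \<in> vec.span (insert v (Fx w))"
        using y by (auto intro: vec.span_base vec.span_scale)
      then have "(s *s v' + t *s v) - t *s v \<in> vec.span (insert v (Fx w))" by (rule vec.span_diff)
      then have "s *s v' \<in> vec.span (insert v (Fx w))" by simp
      then have "(1 / s) *s (s *s v') \<in> vec.span (insert v (Fx w))" by (rule vec.span_scale)
      moreover have "(1 / s) *s (s *s v') = v'" unfolding vector_smult_assoc using s by simp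
      ultimately show False using v' that by simp
    qed
    moreover have "t = 0"
    proof (rule ccontr)
      assume t: "t \<noteq> 0"
      have "t *s v \<in> Fx w" using y \<open>s = 0\<close> by simp
      then have "(1 / t) *s (t *s v) \<in> Fx w" by (rule vec.subspace_scale[OF subF])
      moreover have "(1 / t) *s (t *s v) = v" unfolding vector_smult_assoc using t by simp
      ultimately show False using v that by simp
    qed
    ultimately show ?thesis by simp
  qed
  define N where "N = (\<Inter>w\<in>{w\<in>W. w *v x \<noteq> x}. {y. w *v y \<noteq> y})"
  have "open N" unfolding N_def
    by (intro open_INT) (use finite_W in \<open>auto intro!: open_Collect_neq continuous_intros\<close>)
  moreover have conth: "continuous_on UNIV (\<lambda>p. h (fst p) (snd p))"
    unfolding h_def by (intro continuous_intros)
  ultimately have "open ((\<lambda>p. h (fst p) (snd p)) -` N)" by (rule open_vimage)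
  moreover have "(0, 0) \<in> (\<lambda>p. h (fst p) (snd p)) -` N" by (simp add: h_def N_def)
  ultimately obtain A B where AB: "open A" "open B" "(0, 0) \<in> A \<times> B" "A \<times> B \<subseteq> (\<lambda>p. h (fst p) (snd p)) -` N"
    by (rule open_prod_elim)
  have "0 \<in> A" "0 \<in> B" using AB(3) by auto
  then obtain \<epsilon>1 \<epsilon>2 where e1: "\<epsilon>1 > 0" "cball 0 \<epsilon>1 \<subseteq> A" and e2: "\<epsilon>2 > 0" "cball 0 \<epsilon>2 \<subseteq> B"
    using open_contains_cball_eq[OF AB(1)] open_contains_cball_eq[OF AB(2)] by blast
  define \<epsilon> where "\<epsilon> = min \<epsilon>1 \<epsilon>2"
  have eps: "\<epsilon> > 0" using e1 e2 by (simp add: \<epsilon>_def)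
  have h_free: "h s t \<in> free_points" if st: "norm s \<le> \<epsilon>" "norm t \<le> \<epsilon>" "s \<noteq> 0 \<or> t \<noteq> 0" for s t
  proof -
    have "s \<in> cball 0 \<epsilon>1" "t \<in> cball 0 \<epsilon>2" using st by (auto simp: \<epsilon>_def)
    then have "(s, t) \<in> A \<times> B" using e1 e2 by blast
    then have "h s t \<in> N" using AB(4) by auto
    then show ?thesis using h_fixed st(3) by (auto simp: free_points_def N_def G_def)
  qed
  obtain E :: "('n \<Rightarrow> nat) set" and e b where
    basis: "finite E \<and> (\<forall>a\<in>E. \<exists>k. homog k (e a)) \<and>
     (\<forall>p\<in>free_points. \<forall>w\<in>W. (\<Sum>a\<in>E. b a p * e a (w *v p)) = (if w = mat 1 then 1 else 0)) \<and>
     (\<forall>p\<in>free_points. \<exists>U. open U \<and> p \<in> U \<and>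
        (\<forall>a\<in>E. \<exists>j k f g. homog j f \<and> homog k g \<and> (\<forall>q\<in>U. g q \<noteq> 0 \<and> b a q = f q / g q)))"
    using trace_dual_basis by (elim exE) (rule that)
  note finE = basis[THEN conjunct1] and he = basis[THEN conjunct2, THEN conjunct1, rule_format]
    and dual = basis[THEN conjunct2, THEN conjunct2, THEN conjunct1, rule_format]
    and local_form = basis[THEN conjunct2, THEN conjunct2, THEN conjunct2, rule_format]
  have local_form': "\<exists>U j k f g. open U \<and> p \<in> U \<and> homog j f \<and> homog k g \<and> (\<forall>q\<in>U. g q \<noteq> 0 \<and> b a q = f q / g q)"
    if "p \<in> free_points" "a \<in> E" for p a
    using local_form[OF that(1)] that(2) by meson
  have cont_b: "continuous (at p) (b a)" if pa: "p \<in> free_points" "a \<in> E" for p a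
  proof -
    obtain U j k f g where U: "open U" "p \<in> U" "homog j f" "homog k g" "\<forall>q\<in>U. g q \<noteq> 0 \<and> b a q = f q / g q"
      using local_form'[OF pa] by blast
    have "continuous_on U (\<lambda>q. f q / g q)"
      using U by (intro continuous_on_divide continuous_on_homog[OF U(3) continuous_on_id]
          continuous_on_homog[OF U(4) continuous_on_id]) auto
    then have "continuous_on U (b a)" by (rule continuous_on_eq) (use U in auto)
    then show ?thesis using U(2) continuous_on_eq_continuous_at[OF U(1)] by blast
  qed
  have bound: "\<exists>C. \<forall>s. s \<noteq> 0 \<longrightarrow> norm s \<le> \<epsilon> \<longrightarrow> norm (b a (h s 0)) \<le> C" if a: "a \<in> E" for a
  proof -
    let ?K = "cball 0 \<epsilon> \<times> sphere 0 \<epsilon> :: (complex \<times> complex) set"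
    have "continuous_on ?K (\<lambda>p. b a (h (fst p) (snd p)))"
    proof (intro continuous_at_imp_continuous_on ballI)
      fix p :: "complex \<times> complex" assume p: "p \<in> ?K"
      have "h (fst p) (snd p) \<in> free_points" by (rule h_free) (use p eps in auto)
      then have "isCont (b a) (h (fst p) (snd p))" using cont_b a by blast
      moreover have "isCont (\<lambda>p. h (fst p) (snd p)) p"
        using conth continuous_on_eq_continuous_at[OF open_UNIV] by blast
      ultimately show "isCont (\<lambda>p. b a (h (fst p) (snd p))) p"
        using isCont_o2[of p "\<lambda>p. h (fst p) (snd p)" "b a"] by simp
    qed
    moreover have "compact ?K" by (intro compact_Times compact_cball compact_sphere)
    ultimately have "bounded ((\<lambda>p. b a (h (fst p) (snd p))) ` ?K)"
      using compact_continuous_image compact_imp_bounded by blast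
    then obtain C where "\<forall>y\<in>(\<lambda>p. b a (h (fst p) (snd p))) ` ?K. norm y \<le> C"
      unfolding bounded_iff by (elim exE)
    then have C: "norm (b a (h (fst p) (snd p))) \<le> C" if "p \<in> ?K" for p using that by blast
    have "norm (b a (h s 0)) \<le> C" if s: "s \<noteq> 0" "norm s \<le> \<epsilon>" for s
    proof -
      have "(\<lambda>t. b a (h s t)) holomorphic_on cball 0 \<epsilon>"
        unfolding holomorphic_on_def
      proof
        fix t :: complex assume t: "t \<in> cball 0 \<epsilon>"
        have hf: "h s t \<in> free_points" using h_free s t by auto
        obtain U j k f g where U: "open U" "h s t \<in> U" "homog j f" "homog k g"
          "\<forall>q\<in>U. g q \<noteq> 0 \<and> b a q = f q / g q"
          using local_form'[OF hf a] by blast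
        have "continuous_on UNIV (h s)" unfolding h_def by (intro continuous_intros)
        then have oU: "open (h s -` U)" using U(1) open_vimage by blast
        have "(\<lambda>t. f (h s t) / g (h s t)) holomorphic_on (h s -` U)"
          unfolding h_def
          by (intro holomorphic_on_divide holomorphic_on_homog[OF U(3)] holomorphic_on_homog[OF U(4)])
            (use U(5) in \<open>auto simp: h_def\<close>)
        then have "(\<lambda>t. b a (h s t)) holomorphic_on (h s -` U)"
          by (rule holomorphic_transform) (use U(5) in auto)
        then have "(\<lambda>t. b a (h s t)) field_differentiable at t"
          using holomorphic_on_imp_differentiable_at[OF _ oU] U(2) by simp
        then show "(\<lambda>t. b a (h s t)) field_differentiable at t within cball 0 \<epsilon>"
          by (rule field_differentiable_at_within)
      qed
      then have hol: "(\<lambda>t. b a (h s t)) holomorphic_on cball 0 \<epsilon>" .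
      show ?thesis
      proof (rule maximum_modulus_frontier[of "\<lambda>t. b a (h s t)" "cball 0 \<epsilon>"])
        show "(\<lambda>t. b a (h s t)) holomorphic_on interior (cball 0 \<epsilon>)"
          by (rule holomorphic_on_subset[OF hol interior_subset])
        show "continuous_on (closure (cball 0 \<epsilon>)) (\<lambda>t. b a (h s t))"
          using holomorphic_on_imp_continuous_on[OF hol] by simp
        show "norm (b a (h s z)) \<le> C" if "z \<in> frontier (cball 0 \<epsilon>)" for z
          using C[of "(s, z)"] that s eps by (simp add: frontier_cball)
      qed (use eps in auto)
    qed
    then show ?thesis by blast
  qed
  then obtain C where C: "\<And>a s. a \<in> E \<Longrightarrow> s \<noteq> 0 \<Longrightarrow> norm s \<le> \<epsilon> \<Longrightarrow> norm (b a (h s 0)) \<le> C a"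
    by metis
  define \<Phi> where "\<Phi> s = (\<Sum>a\<in>E. C a * norm (e a (h s 0) - e a (u *v h s 0)))" for s
  have conte: "continuous_on UNIV (\<lambda>s. e a (w *v h s 0))" if "a \<in> E" for a and w :: "complex^'n^'n"
  proof -
    obtain k where "homog k (e a)" using he \<open>a \<in> E\<close> by blast
    then show ?thesis unfolding h_def by (rule continuous_on_homog) (intro continuous_intros)
  qed
  have "continuous_on UNIV \<Phi>" unfolding \<Phi>_def
    by (intro continuous_intros conte conte[of _ "mat 1", simplified])
  then have "(\<Phi> \<longlongrightarrow> \<Phi> 0) (at 0)" unfolding continuous_on_def by blast
  moreover have "\<Phi> 0 = 0" by (simp add: \<Phi>_def h_def u)
  ultimately have "\<forall>\<^sub>F s in at 0. \<Phi> s < 1" using order_tendstoD(2)[of \<Phi> 0 "at 0" 1] by simp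
  moreover have "\<forall>\<^sub>F s in at (0::complex). norm s \<le> \<epsilon> \<and> s \<noteq> 0"
    using eps by (auto simp: eventually_at intro!: exI[of _ \<epsilon>])
  ultimately have "\<forall>\<^sub>F s in at (0::complex). \<Phi> s < 1 \<and> norm s \<le> \<epsilon> \<and> s \<noteq> 0"
    by (rule eventually_conj)
  then obtain s where s: "\<Phi> s < 1" "norm s \<le> \<epsilon>" "s \<noteq> 0"
    using eventually_happens at_neq_bot by blast
  have free: "h s 0 \<in> free_points" using h_free s eps by auto
  have "(\<Sum>a\<in>E. b a (h s 0) * (e a (h s 0) - e a (u *v h s 0))) = 1"
    using dual[OF free one_W] dual[OF free u(1)] u1 by (simp add: algebra_simps sum_subtractf)
  then have "1 = norm (\<Sum>a\<in>E. b a (h s 0) * (e a (h s 0) - e a (u *v h s 0)))" by simp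
  also have "\<dots> \<le> \<Phi> s" unfolding \<Phi>_def
    by (rule sum_norm_le) (auto simp: norm_mult intro!: mult_right_mono C s)
  finally show False using s(1) by simp
qed

end

section \<open>The fundamental group of a topology is a group\<close>

definition loop_class :: "'a topology \<Rightarrow> 'a \<Rightarrow> (real \<Rightarrow> 'a) \<Rightarrow> (real \<Rightarrow> 'a) set" where
  "loop_class T a p = {r. homotopic_loops_at T a p r}"

lemma homotopic_loops_at_sym: "homotopic_loops_at T a p q \<Longrightarrow> homotopic_loops_at T a q p"
  by (simp add: homotopic_loops_at_def homotopic_with_sym)

lemma homotopic_loops_at_trans:
  "homotopic_loops_at T a p q \<Longrightarrow> homotopic_loops_at T a q r \<Longrightarrow> homotopic_loops_at T a p r"
  unfolding homotopic_loops_at_def by (rule homotopic_with_trans)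

lemma homotopic_loops_at_refl: "homotopic_loops_at T a p p \<longleftrightarrow> loop_at T a p"
  by (auto simp: homotopic_loops_at_def loop_at_def pathin_def)

lemma homotopic_loops_at_imp_loop:
  assumes "homotopic_loops_at T a p q" shows "loop_at T a p" "loop_at T a q"
  using assms homotopic_loops_at_refl homotopic_loops_at_sym homotopic_loops_at_trans by metis+

lemma homotopic_loops_at_eq:
  assumes "homotopic_loops_at T a p q" "\<And>t. t \<in> {0..1} \<Longrightarrow> p' t = p t" "\<And>t. t \<in> {0..1} \<Longrightarrow> q' t = q t"
  shows "homotopic_loops_at T a p' q'"
  unfolding homotopic_loops_at_def
  by (rule homotopic_with_eq[OF assms(1)[unfolded homotopic_loops_at_def]]) (use assms in auto)

lemma loop_class_eq_iff:
  assumes "loop_at T a p" "loop_at T a q"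
  shows "loop_class T a p = loop_class T a q \<longleftrightarrow> homotopic_loops_at T a p q"
proof
  assume "loop_class T a p = loop_class T a q"
  moreover have "q \<in> loop_class T a q" using assms by (simp add: loop_class_def homotopic_loops_at_refl)
  ultimately have "q \<in> loop_class T a p" by simp
  then show "homotopic_loops_at T a p q" by (simp add: loop_class_def)
next
  assume "homotopic_loops_at T a p q"
  then show "loop_class T a p = loop_class T a q" unfolding loop_class_def
    by (auto intro: homotopic_loops_at_trans homotopic_loops_at_trans[OF homotopic_loops_at_sym])
qed

lemma loop_class_eqI: "homotopic_loops_at T a p q \<Longrightarrow> loop_class T a p = loop_class T a q"
  using homotopic_loops_at_imp_loop loop_class_eq_iff by metis

lemma mem_loop_class_self: "loop_at T a p \<Longrightarrow> p \<in> loop_class T a p"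
  by (simp add: loop_class_def homotopic_loops_at_refl)

lemma mem_loop_class: "q \<in> loop_class T a p \<longleftrightarrow> homotopic_loops_at T a p q"
  by (simp add: loop_class_def)

lemma carrier_fundamental_group:
  "carrier (fundamental_group T a) = loop_class T a ` Collect (loop_at T a)"
  by (auto simp: fundamental_group_def quotient_def loop_class_def)

lemma prod_topology_top_of_set:
  "prod_topology (top_of_set A) (top_of_set B) = top_of_set (A \<times> B)"
  by (simp add: subtopology_Times[symmetric])

text \<open>
  Two homotopies with fixed end points are pasted along the line where the parameter of the loop
  is \<open>1/2\<close>; both are equal to \<open>a\<close> there.
\<close>

lemma homotopic_loops_at_join:
  assumes "homotopic_loops_at T a p p'" "homotopic_loops_at T a q q'"
  shows "homotopic_loops_at T a (join_loops p q) (join_loops p' q')"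
proof -
  let ?I = "{0..1::real}"
  obtain h where h: "continuous_map (top_of_set (?I \<times> ?I)) T h" "\<forall>x. h (0, x) = p x" "\<forall>x. h (1, x) = p' x"
    "\<forall>t\<in>?I. h (t, 0) = a \<and> h (t, 1) = a"
    using assms(1) unfolding homotopic_loops_at_def homotopic_with_def prod_topology_top_of_set by blast
  obtain k where k: "continuous_map (top_of_set (?I \<times> ?I)) T k" "\<forall>x. k (0, x) = q x" "\<forall>x. k (1, x) = q' x"
    "\<forall>t\<in>?I. k (t, 0) = a \<and> k (t, 1) = a"
    using assms(2) unfolding homotopic_loops_at_def homotopic_with_def prod_topology_top_of_set by blast
  define H where "H z = (if snd z \<le> 1/2 then h (fst z, 2 * snd z) else k (fst z, 2 * snd z - 1))"
    for z :: "real \<times> real"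
  have "continuous_map (top_of_set (?I \<times> ?I)) T H"
    unfolding H_def
  proof (rule continuous_map_cases_le)
    show "continuous_map (top_of_set (?I \<times> ?I)) euclideanreal snd"
      "continuous_map (top_of_set (?I \<times> ?I)) euclideanreal (\<lambda>x. 1 / 2)"
      by (auto intro!: continuous_intros)
    let ?A = "?I \<times> ?I \<inter> {x \<in> ?I \<times> ?I. snd x \<le> 1/2}" and ?B = "?I \<times> ?I \<inter> {x \<in> ?I \<times> ?I. 1/2 \<le> snd x}"
    have "continuous_map (top_of_set ?A) (top_of_set (?I \<times> ?I)) (\<lambda>z. (fst z, 2 * snd z))"
      by (auto intro!: continuous_intros)
    from continuous_map_compose[OF this h(1)]
    show "continuous_map (subtopology (top_of_set (?I \<times> ?I)) {x \<in> topspace (top_of_set (?I \<times> ?I)). snd x \<le> 1/2}) T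
        (\<lambda>z. h (fst z, 2 * snd z))"
      by (simp add: subtopology_subtopology o_def)
    have "continuous_map (top_of_set ?B) (top_of_set (?I \<times> ?I)) (\<lambda>z. (fst z, 2 * snd z - 1))"
      by (auto intro!: continuous_intros)
    from continuous_map_compose[OF this k(1)]
    show "continuous_map (subtopology (top_of_set (?I \<times> ?I)) {x \<in> topspace (top_of_set (?I \<times> ?I)). 1/2 \<le> snd x}) T
        (\<lambda>z. k (fst z, 2 * snd z - 1))"
      by (simp add: subtopology_subtopology o_def)
    show "h (fst x, 2 * snd x) = k (fst x, 2 * snd x - 1)"
      if "x \<in> topspace (top_of_set (?I \<times> ?I))" "snd x = 1/2" for x
    proof -
      have "fst x \<in> ?I" using that(1) by auto
      then have "h (fst x, 1) = k (fst x, 0)" using h(4) k(4) by simp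
      then show ?thesis by (simp add: that(2))
    qed
  qed
  moreover have "H (0, t) = join_loops p q t" "H (1, t) = join_loops p' q' t" for t
    using h k by (auto simp: H_def join_loops_def)
  moreover have "H (s, 0) = a" "H (s, 1) = a" if "s \<in> ?I" for s
    using h(4) k(4) that by (auto simp: H_def)
  ultimately show ?thesis
    unfolding homotopic_loops_at_def homotopic_with_def prod_topology_top_of_set by blast
qed

lemma loop_at_join: "loop_at T a p \<Longrightarrow> loop_at T a q \<Longrightarrow> loop_at T a (join_loops p q)"
  using homotopic_loops_at_join homotopic_loops_at_refl by metis

lemma loop_at_const: "a \<in> topspace T \<Longrightarrow> loop_at T a (\<lambda>_. a)"
  by (simp add: loop_at_def pathin_def)

lemma mult_fundamental_group:
  assumes "loop_at T a p" "loop_at T a q"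
  shows "loop_class T a p \<otimes>\<^bsub>fundamental_group T a\<^esub> loop_class T a q = loop_class T a (join_loops p q)"
proof
  show "loop_class T a (join_loops p q) \<subseteq> loop_class T a p \<otimes>\<^bsub>fundamental_group T a\<^esub> loop_class T a q"
    using assms mem_loop_class_self by (fastforce simp: fundamental_group_def mem_loop_class)
  show "loop_class T a p \<otimes>\<^bsub>fundamental_group T a\<^esub> loop_class T a q \<subseteq> loop_class T a (join_loops p q)"
    by (auto simp: fundamental_group_def mem_loop_class
        intro: homotopic_loops_at_trans[OF homotopic_loops_at_join])
qed

lemma one_fundamental_group: "\<one>\<^bsub>fundamental_group T a\<^esub> = loop_class T a (\<lambda>_. a)"
  by (simp add: fundamental_group_def loop_class_def)

text \<open>
  Every homotopy needed for the group laws is a reparametrisation: two self-maps of the unit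
  interval with the same endpoints are homotopic by convexity.
\<close>

lemma homotopic_loops_at_reparam:
  assumes P: "pathin T P" and \<phi>: "continuous_on {0..1} \<phi>" "\<phi> ` {0..1} \<subseteq> {0..1}"
    and \<psi>: "continuous_on {0..1} \<psi>" "\<psi> ` {0..1} \<subseteq> {0..1}"
    and ends: "\<phi> 0 = \<psi> 0" "\<phi> 1 = \<psi> 1" "P (\<phi> 0) = a" "P (\<phi> 1) = a"
  shows "homotopic_loops_at T a (P \<circ> \<phi>) (P \<circ> \<psi>)"
proof -
  have "homotopic_paths {0..1} \<phi> \<psi>"
  proof (rule homotopic_paths_linear)
    show "closed_segment (\<phi> t) (\<psi> t) \<subseteq> {0..1}" if "t \<in> {0..1}" for t
    proof (rule closed_segment_subset)
      show "\<phi> t \<in> {0..1}" "\<psi> t \<in> {0..1}" using that \<phi>(2) \<psi>(2) by blast+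
    qed simp
  qed (use \<phi> \<psi> ends in \<open>auto simp: path_def pathstart_def pathfinish_def\<close>)
  then show ?thesis
    unfolding homotopic_loops_at_def homotopic_paths_def
    by (rule homotopic_with_compose_continuous_map_left)
      (use P ends in \<open>auto simp: pathin_def pathstart_def pathfinish_def\<close>)
qed

lemma loop_atD:
  assumes "loop_at T a p" shows "pathin T p" "p 0 = a" "p 1 = a"
  using assms by (auto simp: loop_at_def)

lemma continuous_on_piecewise_real:
  fixes f g :: "real \<Rightarrow> real"
  assumes "continuous_on UNIV f" "continuous_on UNIV g" "f c = g c"
  shows "continuous_on S (\<lambda>t. if t \<le> c then f t else g t)"
proof -
  have "continuous_on ({..c} \<union> {c..}) (\<lambda>t. if t \<le> c then f t else g t)"
    by (rule continuous_on_If) (use assms in \<open>auto intro: continuous_on_subset\<close>)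
  then show ?thesis by (rule continuous_on_subset) auto
qed

lemma homotopic_join_assoc:
  assumes p: "loop_at T a p" and q: "loop_at T a q" and r: "loop_at T a r"
  shows "homotopic_loops_at T a (join_loops (join_loops p q) r) (join_loops p (join_loops q r))"
proof -
  let ?P = "join_loops p (join_loops q r)"
  define \<phi> :: "real \<Rightarrow> real" where
    "\<phi> t = (if t \<le> 1/2 then (if t \<le> 1/4 then 2 * t else t + 1/4) else t / 2 + 1/2)" for t
  have P: "loop_at T a ?P" by (intro loop_at_join p q r)
  have "continuous_on {0..1} \<phi>"
  proof -
    have "continuous_on UNIV (\<lambda>t::real. if t \<le> 1/4 then 2 * t else t + 1/4)"
      by (rule continuous_on_piecewise_real) (auto intro!: continuous_intros)
    then show ?thesis unfolding \<phi>_def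
      by (rule continuous_on_piecewise_real) (auto intro!: continuous_intros)
  qed
  then have "homotopic_loops_at T a (?P \<circ> \<phi>) (?P \<circ> id)"
    by (rule homotopic_loops_at_reparam[OF loop_atD(1)[OF P]])
      (use loop_atD[OF P] in \<open>auto simp: \<phi>_def\<close>)
  moreover have "(?P \<circ> \<phi>) t = join_loops (join_loops p q) r t" for t
  proof -
    have e: "2 * (2 * (t + 1 / 4) - 1) = 2 * (2 * t) - 1" "2 * (t / 2 + 1 / 2) - 1 = t" by simp_all
    consider "t \<le> 1/4" | "1/4 < t" "t \<le> 1/2" | "1/2 < t" by linarith
    then show ?thesis
    proof cases
      case 2
      then have "\<not> t + 1/4 \<le> 1/2" "2 * (t + 1/4) - 1 \<le> 1/2" "\<not> 2 * t \<le> 1/2" "\<not> t \<le> 1/4" by simp_all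
      then show ?thesis using 2 by (simp only: join_loops_def \<phi>_def o_def e if_True if_False)
    next
      case 3
      then have "\<not> t / 2 + 1/2 \<le> 1/2" "\<not> t \<le> 1/2" by simp_all
      then show ?thesis by (simp only: join_loops_def \<phi>_def o_def e if_True if_False)
    qed (simp add: join_loops_def \<phi>_def)
  qed
  ultimately show ?thesis
    using homotopic_loops_at_eq[of T a "?P \<circ> \<phi>" "?P \<circ> id"] by simp
qed

lemma homotopic_join_const_left:
  assumes p: "loop_at T a p" shows "homotopic_loops_at T a (join_loops (\<lambda>_. a) p) p"
proof -
  define \<phi> :: "real \<Rightarrow> real" where "\<phi> t = (if t \<le> 1/2 then 0 else 2 * t - 1)" for t
  have "continuous_on {0..1} \<phi>"
    unfolding \<phi>_def by (rule continuous_on_piecewise_real) (auto intro!: continuous_intros)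
  then have "homotopic_loops_at T a (p \<circ> \<phi>) (p \<circ> id)"
    by (rule homotopic_loops_at_reparam[OF loop_atD(1)[OF p]])
      (use loop_atD[OF p] in \<open>auto simp: \<phi>_def\<close>)
  moreover have "(p \<circ> \<phi>) t = join_loops (\<lambda>_. a) p t" for t
    using p by (auto simp: join_loops_def \<phi>_def loop_at_def)
  ultimately show ?thesis
    using homotopic_loops_at_eq[of T a "p \<circ> \<phi>" "p \<circ> id"] by simp
qed

lemma loop_at_reverse: "loop_at T a p \<Longrightarrow> loop_at T a (\<lambda>t. p (1 - t))"
proof -
  assume p: "loop_at T a p"
  have "continuous_map (top_of_set {0..1}) (top_of_set {0..1}) (\<lambda>t::real. 1 - t)"
    by (auto intro!: continuous_intros)
  from continuous_map_compose[OF this, of T p] show ?thesis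
    using p by (simp add: loop_at_def pathin_def o_def)
qed

lemma homotopic_join_reverse:
  assumes p: "loop_at T a p" shows "homotopic_loops_at T a (join_loops (\<lambda>t. p (1 - t)) p) (\<lambda>_. a)"
proof -
  define \<phi> :: "real \<Rightarrow> real" where "\<phi> t = (if t \<le> 1/2 then 1 - 2 * t else 2 * t - 1)" for t
  have "continuous_on {0..1} \<phi>"
    unfolding \<phi>_def by (rule continuous_on_piecewise_real) (auto intro!: continuous_intros)
  then have "homotopic_loops_at T a (p \<circ> \<phi>) (p \<circ> (\<lambda>_. 1))"
    by (rule homotopic_loops_at_reparam[OF loop_atD(1)[OF p]])
      (use loop_atD[OF p] in \<open>auto simp: \<phi>_def\<close>)
  moreover have "(p \<circ> \<phi>) t = join_loops (\<lambda>t. p (1 - t)) p t" for t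
    by (auto simp: join_loops_def \<phi>_def)
  ultimately show ?thesis using p homotopic_loops_at_eq[of T a "p \<circ> \<phi>" "p \<circ> (\<lambda>_. 1)"]
    by (simp add: loop_at_def)
qed

theorem group_fundamental_group:
  assumes a: "a \<in> topspace T" shows "group (fundamental_group T a)"
proof (rule groupI)
  note [simp] = carrier_fundamental_group one_fundamental_group mult_fundamental_group loop_at_join
  show "\<one>\<^bsub>fundamental_group T a\<^esub> \<in> carrier (fundamental_group T a)"
    using loop_at_const[OF a] by auto
  fix x assume "x \<in> carrier (fundamental_group T a)"
  then obtain p where p: "x = loop_class T a p" "loop_at T a p" by auto
  show "\<one>\<^bsub>fundamental_group T a\<^esub> \<otimes>\<^bsub>fundamental_group T a\<^esub> x = x"
    using p loop_at_const[OF a] loop_class_eqI[OF homotopic_join_const_left[OF p(2)]] by simp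
  show "\<exists>y\<in>carrier (fundamental_group T a). y \<otimes>\<^bsub>fundamental_group T a\<^esub> x = \<one>\<^bsub>fundamental_group T a\<^esub>"
    using p loop_at_reverse[OF p(2)] loop_class_eqI[OF homotopic_join_reverse[OF p(2)]] by auto
  fix y assume "y \<in> carrier (fundamental_group T a)"
  then obtain q where q: "y = loop_class T a q" "loop_at T a q" by auto
  show "x \<otimes>\<^bsub>fundamental_group T a\<^esub> y \<in> carrier (fundamental_group T a)" using p q by auto
  fix z assume "z \<in> carrier (fundamental_group T a)"
  then obtain r where r: "z = loop_class T a r" "loop_at T a r" by auto
  show "x \<otimes>\<^bsub>fundamental_group T a\<^esub> y \<otimes>\<^bsub>fundamental_group T a\<^esub> z =
    x \<otimes>\<^bsub>fundamental_group T a\<^esub> (y \<otimes>\<^bsub>fundamental_group T a\<^esub> z)"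
    using p q r loop_class_eqI[OF homotopic_join_assoc[OF p(2) q(2) r(2)]] by simp
qed

lemma homotopic_loops_at_compose:
  assumes "homotopic_loops_at T a p q" "continuous_map T T' f"
  shows "homotopic_loops_at T' (f a) (f \<circ> p) (f \<circ> q)"
  using assms unfolding homotopic_loops_at_def
  by (rule homotopic_with_compose_continuous_map_left) auto

lemma fundamental_group_map_loop_class:
  assumes f: "continuous_map T T' f" and p: "loop_at T a p"
  shows "fundamental_group_map T' (f a) f (loop_class T a p) = loop_class T' (f a) (f \<circ> p)"
proof -
  have "homotopic_loops_at T' (f a) (f \<circ> p) r"
    if "homotopic_loops_at T a p q" "homotopic_loops_at T' (f a) (f \<circ> q) r" for q r
    by (rule homotopic_loops_at_trans[OF homotopic_loops_at_compose[OF that(1) f] that(2)])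
  then show ?thesis using mem_loop_class_self[OF p]
    by (auto simp: fundamental_group_map_def mem_loop_class)
qed

lemma loop_at_compose:
  "continuous_map T T' f \<Longrightarrow> loop_at T a p \<Longrightarrow> loop_at T' (f a) (f \<circ> p)"
  using homotopic_loops_at_compose homotopic_loops_at_refl by metis

lemma compose_join_loops: "f \<circ> join_loops p q = join_loops (f \<circ> p) (f \<circ> q)"
  by (auto simp: join_loops_def)

lemma hom_fundamental_group_map:
  assumes f: "continuous_map T T' f"
  shows "fundamental_group_map T' (f a) f \<in> hom (fundamental_group T a) (fundamental_group T' (f a))"
proof (rule homI)
  fix x assume "x \<in> carrier (fundamental_group T a)"
  then obtain p where p: "x = loop_class T a p" "loop_at T a p" by (auto simp: carrier_fundamental_group)
  show "fundamental_group_map T' (f a) f x \<in> carrier (fundamental_group T' (f a))"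
    using p loop_at_compose[OF f] by (auto simp: carrier_fundamental_group fundamental_group_map_loop_class[OF f])
  fix y assume "y \<in> carrier (fundamental_group T a)"
  then obtain q where q: "y = loop_class T a q" "loop_at T a q" by (auto simp: carrier_fundamental_group)
  show "fundamental_group_map T' (f a) f (x \<otimes>\<^bsub>fundamental_group T a\<^esub> y) =
    fundamental_group_map T' (f a) f x \<otimes>\<^bsub>fundamental_group T' (f a)\<^esub> fundamental_group_map T' (f a) f y"
    using p q loop_at_compose[OF f]
    by (simp add: mult_fundamental_group loop_at_join fundamental_group_map_loop_class[OF f] compose_join_loops)
qed

text \<open>
  The two notions of homotopy agree because both fix the end points; this makes the classical
  theorems on paths and coverings applicable to the complement.
\<close>

lemma loop_at_top_of_set:
  "loop_at (top_of_set S) a p \<longleftrightarrow> path p \<and> path_image p \<subseteq> S \<and> pathstart p = a \<and> pathfinish p = a"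
  by (auto simp: loop_at_def pathin_def path_def path_image_def pathstart_def pathfinish_def)

lemma homotopic_loops_at_top_of_set:
  "homotopic_loops_at (top_of_set S) a p q \<longleftrightarrow> pathstart p = a \<and> pathfinish p = a \<and> homotopic_paths S p q"
proof
  assume h: "homotopic_loops_at (top_of_set S) a p q"
  from homotopic_loops_at_imp_loop[OF this]
  have "pathstart p = a \<and> pathfinish p = a" by (auto simp: loop_at_top_of_set)
  with h show "pathstart p = a \<and> pathfinish p = a \<and> homotopic_paths S p q"
    by (auto simp: homotopic_loops_at_def homotopic_paths_def pathstart_def pathfinish_def)
qed (auto simp: homotopic_loops_at_def homotopic_paths_def pathstart_def pathfinish_def)

lemma join_loops_eq_joinpaths: "join_loops = (+++)"
  by (auto simp: join_loops_def joinpaths_def fun_eq_iff)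

section \<open>Functors on paths\<close>

definition path_in :: "'a::topological_space set \<Rightarrow> (real \<Rightarrow> 'a) \<Rightarrow> bool" where
  "path_in S p \<longleftrightarrow> path p \<and> path_image p \<subseteq> S"

lemma path_in_join: "path_in S p \<Longrightarrow> path_in S q \<Longrightarrow> pathfinish p = pathstart q \<Longrightarrow> path_in S (p +++ q)"
  by (simp add: path_in_def path_image_join)

lemma path_in_reverse: "path_in S (reversepath p) \<longleftrightarrow> path_in S p"
  by (simp add: path_in_def)

lemma path_in_const: "path_in S (linepath a a) \<longleftrightarrow> a \<in> S"
  by (simp add: path_in_def)

lemma path_in_mono: "path_in S p \<Longrightarrow> S \<subseteq> T \<Longrightarrow> path_in T p"
  by (auto simp: path_in_def)

lemma path_in_compose:
  "path_in S p \<Longrightarrow> continuous_on S f \<Longrightarrow> f ` S \<subseteq> T \<Longrightarrow> path_in T (f \<circ> p)"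
  by (auto simp: path_in_def path_image_compose intro!: path_continuous_image intro: continuous_on_subset)

lemma path_in_ends: "path_in S p \<Longrightarrow> pathstart p \<in> S" "path_in S p \<Longrightarrow> pathfinish p \<in> S"
  by (auto simp: path_in_def)

lemma loop_at_path_in: "loop_at (top_of_set S) a p \<longleftrightarrow> path_in S p \<and> pathstart p = a \<and> pathfinish p = a"
  by (auto simp: loop_at_top_of_set path_in_def)

text \<open>
  A functor from the fundamental groupoid of \<open>S\<close> to a group. In contrast to a homomorphism on the
  fundamental group, it can be evaluated on short paths far away from the base point, which is
  what local arguments need.
\<close>

locale path_functor = group K for K :: "('k, 'm) monoid_scheme" (structure) +
  fixes S :: "'v::real_normed_vector set" and \<phi> :: "(real \<Rightarrow> 'v) \<Rightarrow> 'k"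
  assumes closed: "path_in S p \<Longrightarrow> \<phi> p \<in> carrier K"
    and join: "path_in S p \<Longrightarrow> path_in S q \<Longrightarrow> pathfinish p = pathstart q \<Longrightarrow> \<phi> (p +++ q) = \<phi> p \<otimes> \<phi> q"
    and homotopic: "homotopic_paths S p q \<Longrightarrow> \<phi> p = \<phi> q"
begin

lemma eq_paths:
  assumes "path_in S p" "\<And>t. t \<in> {0..1} \<Longrightarrow> p t = q t" shows "\<phi> p = \<phi> q"
  using assms by (intro homotopic homotopic_paths_eq) (auto simp: path_in_def)

lemma const: "a \<in> S \<Longrightarrow> \<phi> (linepath a a) = \<one>"
proof -
  assume a: "a \<in> S"
  have p: "path_in S (linepath a a)" using a by (simp add: path_in_const)
  have "\<phi> (linepath a a +++ linepath a a) = \<phi> (linepath a a)"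
    by (rule eq_paths[symmetric, OF p]) (simp add: joinpaths_def linepath_refl)
  then have "\<phi> (linepath a a) \<otimes> \<phi> (linepath a a) = \<phi> (linepath a a)"
    using join[OF p p] by simp
  then show ?thesis using closed[OF p] by (metis l_cancel_one)
qed

lemma reverse: "path_in S p \<Longrightarrow> \<phi> (reversepath p) = inv (\<phi> p)"
proof -
  assume p: "path_in S p"
  have "\<phi> (p +++ reversepath p) = \<phi> (linepath (pathstart p) (pathstart p))"
    by (rule homotopic[OF homotopic_paths_rinv]) (use p in \<open>auto simp: path_in_def\<close>)
  then have "\<phi> p \<otimes> \<phi> (reversepath p) = \<one>"
    using p by (simp add: join path_in_reverse const path_in_ends)
  then show ?thesis using p by (metis closed inv_equality inv_inv path_in_reverse inv_closed)
qed

lemma same_ends: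
  assumes T: "T \<subseteq> S" and kill: "\<And>c. path_in T c \<Longrightarrow> pathfinish c = pathstart c \<Longrightarrow> \<phi> c = \<one>"
    and p: "path_in T p" and q: "path_in T q" and ends: "pathstart p = pathstart q" "pathfinish p = pathfinish q"
  shows "\<phi> p = \<phi> q"
proof -
  have pq: "path_in S p" "path_in S q" using p q T by (auto intro: path_in_mono)
  have "\<phi> (p +++ reversepath q) = \<one>"
    by (rule kill) (use p q ends in \<open>auto intro!: path_in_join simp: path_in_reverse\<close>)
  then have "\<phi> p \<otimes> inv (\<phi> q) = \<one>" using pq ends by (simp add: join path_in_reverse reverse)
  then show ?thesis using pq closed by (metis inv_closed inv_equality inv_inv)
qed

text \<open>In a convex set the path \<open>P\<close> is homotopic to the segment between its ends.\<close>

lemma convex_image_ends: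
  assumes C: "convex C" and E: "continuous_on C E" "E ` C \<subseteq> S" and P: "path_in C P"
  shows "\<phi> (E \<circ> P) = \<phi> (E \<circ> linepath (pathstart P) (pathfinish P))"
proof -
  have "homotopic_paths C P (linepath (pathstart P) (pathfinish P))"
    using convex_imp_simply_connected[OF C] P C path_in_ends[OF P]
    unfolding simply_connected_eq_homotopic_paths path_in_def
    by (auto simp: path_image_linepath closed_segment_subset)
  then show ?thesis
    by (intro homotopic homotopic_paths_continuous_image[OF _ E(1)]) (use E(2) in auto)
qed

end

lemma compose_joinpaths: "f \<circ> (p +++ q) = (f \<circ> p) +++ (f \<circ> q)"
  by (auto simp: joinpaths_def)

text \<open>
  Each point \<open>y\<close> is joined to the base point by a chosen path \<open>w y\<close>, which turns a path \<open>p\<close> into a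
  loop. The path chosen for \<open>x0\<close> is constant, so that loops at \<open>x0\<close> keep their value.
\<close>

lemma path_functor_extension:
  fixes S :: "'a::real_normed_vector set"
  assumes S: "path_connected S" "x0 \<in> S" and K: "group K"
    and \<Psi>: "\<Psi> \<in> hom (fundamental_group (top_of_set S) x0) K"
  shows "\<exists>\<phi> w. path_functor K S \<phi> \<and>
    (\<forall>p. loop_at (top_of_set S) x0 p \<longrightarrow> \<phi> p = \<Psi> (loop_class (top_of_set S) x0 p)) \<and>
    (\<forall>y\<in>S. path_in S (w y) \<and> pathstart (w y) = x0 \<and> pathfinish (w y) = y) \<and>
    (\<forall>p. \<phi> p = \<Psi> (loop_class (top_of_set S) x0 (w (pathstart p) +++ (p +++ reversepath (w (pathfinish p))))))"
proof -
  let ?F = "fundamental_group (top_of_set S) x0"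
  let ?cl = "loop_class (top_of_set S) x0"
  define w where "w y = (if y = x0 then linepath x0 x0 else SOME p. path_in S p \<and> pathstart p = x0 \<and> pathfinish p = y)" for y
  have w: "path_in S (w y) \<and> pathstart (w y) = x0 \<and> pathfinish (w y) = y" if y: "y \<in> S" for y
  proof (cases "y = x0")
    case False
    have "\<exists>p. path_in S p \<and> pathstart p = x0 \<and> pathfinish p = y"
      using S y unfolding path_connected_def path_in_def by blast
    from someI_ex[OF this] show ?thesis using False by (simp add: w_def)
  qed (simp add: w_def path_in_const S(2))
  define L where "L p = w (pathstart p) +++ (p +++ reversepath (w (pathfinish p)))" for p
  define \<phi> where "\<phi> p = \<Psi> (?cl (L p))" for p
  interpret \<Psi>: group_hom ?F K \<Psi>
    by (intro group_hom.intro group_hom_axioms.intro group_fundamental_group K \<Psi>) (use S in auto)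
  have wy: "path_in S (w y)" "pathstart (w y) = x0" "pathfinish (w y) = y" if "y \<in> S" for y
    using w[OF that] by auto
  have L: "loop_at (top_of_set S) x0 (L p)" if p: "path_in S p" for p
    unfolding loop_at_path_in L_def
    using wy[OF path_in_ends(1)[OF p]] wy[OF path_in_ends(2)[OF p]] p
    by (auto intro!: path_in_join simp: path_in_reverse)
  have hL: "homotopic_paths S (L p) (L q)" if pq: "homotopic_paths S p q" for p q
  proof -
    have e: "pathstart p = pathstart q" "pathfinish p = pathfinish q"
      using homotopic_paths_imp_pathstart[OF pq] homotopic_paths_imp_pathfinish[OF pq] by auto
    have "path_in S q" using pq homotopic_paths_imp_path homotopic_paths_imp_subset
      unfolding path_in_def by blast
    then show ?thesis unfolding L_def e
      using wy[OF path_in_ends(1)[of S q]] wy[OF path_in_ends(2)[of S q]] pq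
      by (intro homotopic_paths_join) (auto simp: path_in_def e)
  qed
  have \<phi>: "path_functor K S \<phi>"
  proof (intro path_functor.intro path_functor_axioms.intro K)
    show "\<phi> p \<in> carrier K" if "path_in S p" for p
      unfolding \<phi>_def using L[OF that] by (intro \<Psi>.hom_closed) (auto simp: carrier_fundamental_group)
    show "\<phi> p = \<phi> q" if "homotopic_paths S p q" for p q
    proof -
      have "path_in S p" using that homotopic_paths_imp_path homotopic_paths_imp_subset
        unfolding path_in_def by blast
      from L[OF this] have "homotopic_loops_at (top_of_set S) x0 (L p) (L q)"
        using hL[OF that] by (simp add: homotopic_loops_at_top_of_set loop_at_path_in)
      from loop_class_eqI[OF this] show ?thesis by (simp add: \<phi>_def)
    qed
    show "\<phi> (p +++ q) = \<phi> p \<otimes>\<^bsub>K\<^esub> \<phi> q" if p: "path_in S p" and q: "path_in S q" and pq: "pathfinish p = pathstart q" for p q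
    proof -
      define a b c where "a = w (pathstart p)" and "b = w (pathstart q)" and "c = w (pathfinish q)"
      have abc: "path_in S a" "path_in S b" "path_in S c" "pathstart a = x0" "pathstart b = x0" "pathstart c = x0"
        "pathfinish a = pathstart p" "pathfinish b = pathstart q" "pathfinish c = pathfinish q"
        using wy[OF path_in_ends(1)[OF p]] wy[OF path_in_ends(1)[OF q]] wy[OF path_in_ends(2)[OF q]]
        by (auto simp: a_def b_def c_def)
      note facts = abc p q pq
      have paths: "path a" "path b" "path c" "path p" "path q"
        "path_image a \<subseteq> S" "path_image b \<subseteq> S" "path_image c \<subseteq> S" "path_image p \<subseteq> S" "path_image q \<subseteq> S"
        using facts by (auto simp: path_in_def)
      let ?b' = "reversepath b" and ?c' = "reversepath c"
      have S1: "homotopic_paths S ((a +++ (p +++ ?b')) +++ (b +++ (q +++ ?c'))) (a +++ ((p +++ ?b') +++ (b +++ (q +++ ?c'))))"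
        by (rule homotopic_paths_sym[OF homotopic_paths_assoc])
          (use paths facts in \<open>auto simp: path_image_join\<close>)
      have S2: "homotopic_paths S ((p +++ ?b') +++ (b +++ (q +++ ?c'))) (p +++ (?b' +++ (b +++ (q +++ ?c'))))"
        by (rule homotopic_paths_sym[OF homotopic_paths_assoc])
          (use paths facts in \<open>auto simp: path_image_join\<close>)
      have S3: "homotopic_paths S (?b' +++ (b +++ (q +++ ?c'))) ((?b' +++ b) +++ (q +++ ?c'))"
        by (rule homotopic_paths_assoc) (use paths facts in \<open>auto simp: path_image_join\<close>)
      have S4: "homotopic_paths S (?b' +++ b) (linepath (pathstart q) (pathstart q))"
        using homotopic_paths_rinv[of ?b' S] paths facts by simp
      have "homotopic_paths S ((?b' +++ b) +++ (q +++ ?c')) (linepath (pathstart q) (pathstart q) +++ (q +++ ?c'))"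
        by (rule homotopic_paths_join[OF S4 homotopic_paths_refl[THEN iffD2]])
          (use paths facts in \<open>auto simp: path_image_join\<close>)
      moreover have "homotopic_paths S (linepath (pathstart q) (pathstart q) +++ (q +++ ?c')) (q +++ ?c')"
        using homotopic_paths_lid[of "q +++ ?c'" S] paths facts by (simp add: path_image_join)
      ultimately have S5: "homotopic_paths S (?b' +++ (b +++ (q +++ ?c'))) (q +++ ?c')"
        using S3 homotopic_paths_trans by blast
      have "homotopic_paths S (p +++ (?b' +++ (b +++ (q +++ ?c')))) (p +++ (q +++ ?c'))"
        by (rule homotopic_paths_join[OF homotopic_paths_refl[THEN iffD2] S5])
          (use paths facts in auto)
      moreover have "homotopic_paths S (p +++ (q +++ ?c')) ((p +++ q) +++ ?c')"
        by (rule homotopic_paths_assoc) (use paths facts in auto)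
      ultimately have S6: "homotopic_paths S ((p +++ ?b') +++ (b +++ (q +++ ?c'))) ((p +++ q) +++ ?c')"
        using S2 homotopic_paths_trans by blast
      have "homotopic_paths S (a +++ ((p +++ ?b') +++ (b +++ (q +++ ?c')))) (a +++ ((p +++ q) +++ ?c'))"
        by (rule homotopic_paths_join[OF homotopic_paths_refl[THEN iffD2] S6])
          (use paths facts in auto)
      then have "homotopic_paths S (L p +++ L q) (L (p +++ q))"
        using S1 homotopic_paths_trans pq unfolding L_def a_def b_def c_def by fastforce
      then have "homotopic_loops_at (top_of_set S) x0 (L p +++ L q) (L (p +++ q))"
        using L[OF p] L[OF q] by (simp add: homotopic_loops_at_top_of_set loop_at_path_in)
      from loop_class_eqI[OF this]
      have "?cl (L (p +++ q)) = ?cl (L p) \<otimes>\<^bsub>?F\<^esub> ?cl (L q)"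
        using L[OF p] L[OF q] by (simp add: mult_fundamental_group join_loops_eq_joinpaths)
      then show ?thesis using L[OF p] L[OF q]
        by (simp add: \<phi>_def \<Psi>.hom_mult carrier_fundamental_group)
    qed
  qed
  moreover have "\<phi> p = \<Psi> (?cl p)" if p: "loop_at (top_of_set S) x0 p" for p
  proof -
    have pp: "path p" "path_image p \<subseteq> S" "pathstart p = x0" "pathfinish p = x0"
      using p by (auto simp: loop_at_top_of_set)
    have Lp: "L p = linepath x0 x0 +++ (p +++ linepath x0 x0)"
      using pp by (simp add: L_def w_def)
    have "homotopic_paths S (linepath x0 x0 +++ (p +++ linepath x0 x0)) (p +++ linepath x0 x0)"
      using homotopic_paths_lid[of "p +++ linepath x0 x0" S] pp S(2) by (simp add: path_image_join)
    moreover have "homotopic_paths S (p +++ linepath x0 x0) p"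
      using homotopic_paths_rid[of p S] pp by simp
    ultimately have "homotopic_paths S (L p) p" unfolding Lp by (rule homotopic_paths_trans)
    then have "homotopic_loops_at (top_of_set S) x0 (L p) p"
      using L[of p] p by (simp add: homotopic_loops_at_top_of_set loop_at_path_in)
    from loop_class_eqI[OF this] show ?thesis by (simp add: \<phi>_def)
  qed
  moreover have "\<phi> p = \<Psi> (?cl (w (pathstart p) +++ (p +++ reversepath (w (pathfinish p)))))" for p
    by (simp add: \<phi>_def L_def)
  ultimately show ?thesis
    by (intro exI[of _ \<phi>] exI[of _ w] conjI allI impI ballI w)
qed

section \<open>Locally additive functions\<close>

text \<open>
  A one-cocycle of Alexander and Spanier on a bounded convex set is a coboundary. The potential at
  \<open>x\<close> is the product of \<open>f\<close> along a fine subdivision of the segment from \<open>0\<close> to \<open>x\<close>; for two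
  nearby points the subdivided segments run close to each other, and local additivity moves \<open>f\<close>
  from one to the other step by step.
\<close>

lemma (in group) locally_additive_potential:
  fixes f :: "'v::real_normed_vector \<Rightarrow> 'v \<Rightarrow> 'a"
  assumes Q: "convex Q" "0 \<in> Q" "bounded Q" and \<epsilon>: "\<epsilon> > 0"
    and f: "\<And>x y. x \<in> Q \<Longrightarrow> y \<in> Q \<Longrightarrow> f x y \<in> carrier G"
    and add: "\<And>x y z. x \<in> Q \<Longrightarrow> y \<in> Q \<Longrightarrow> z \<in> Q \<Longrightarrow> dist x y < \<epsilon> \<Longrightarrow> dist y z < \<epsilon> \<Longrightarrow> dist x z < \<epsilon> \<Longrightarrow>
      f x y \<otimes> f y z = f x z"
  shows "\<exists>g. (\<forall>x\<in>Q. g x \<in> carrier G) \<and> (\<forall>x\<in>Q. \<forall>y\<in>Q. dist x y < \<epsilon> / 2 \<longrightarrow> g x \<otimes> f x y = g y)"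
proof -
  obtain R where R: "R > 0" "\<And>x. x \<in> Q \<Longrightarrow> norm x \<le> R" using Q(3) bounded_pos by metis
  obtain m :: nat where m: "2 * R / \<epsilon> < real m" using reals_Archimedean2 by blast
  have m0: "m > 0" using m R \<epsilon> by (cases m) (auto simp: field_simps)
  define pt where "pt i x = (real i / real m) *\<^sub>R x" for i :: nat and x :: 'v
  define P where "P i x = rec_nat \<one> (\<lambda>i a. a \<otimes> f (pt i x) (pt (Suc i) x)) i" for i x
  have P0: "P 0 x = \<one>" and PS: "P (Suc i) x = P i x \<otimes> f (pt i x) (pt (Suc i) x)" for i x
    by (auto simp: P_def)
  have ptQ: "pt i x \<in> Q" if "i \<le> m" "x \<in> Q" for i x
    using convexD_alt[OF Q(1,2) that(2), of "real i / real m"] that m0 by (simp add: pt_def)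
  have Pc: "i \<le> m \<Longrightarrow> x \<in> Q \<Longrightarrow> P i x \<in> carrier G" for i x
    by (induction i) (auto simp: P0 PS intro!: f ptQ)
  have step: "dist (pt i x) (pt (Suc i) x) < \<epsilon> / 2" if "x \<in> Q" for i x
  proof -
    have "pt (Suc i) x - pt i x = (1 / real m) *\<^sub>R x"
      by (simp add: pt_def scaleR_left_diff_distrib[symmetric] diff_divide_distrib[symmetric])
    then have "dist (pt i x) (pt (Suc i) x) = norm x / real m"
      by (simp add: dist_norm norm_minus_commute[of "pt i x"])
    also have "\<dots> \<le> R / real m" using R(2)[OF that] m0 by (simp add: divide_right_mono)
    also have "\<dots> < \<epsilon> / 2" using m m0 \<epsilon> by (simp add: field_simps)
    finally show ?thesis .
  qed
  have side: "dist (pt i x) (pt i y) < \<epsilon> / 2" if "i \<le> m" "dist x y < \<epsilon> / 2" for i x y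
  proof -
    have "dist (pt i x) (pt i y) = (real i / real m) * dist x y"
      by (simp add: pt_def dist_norm scaleR_diff_right[symmetric])
    also have "\<dots> \<le> 1 * dist x y" by (intro mult_right_mono) (use that m0 in auto)
    finally show ?thesis using that by simp
  qed
  have main: "i \<le> m \<Longrightarrow> P i x \<otimes> f (pt i x) (pt i y) = P i y"
    if xy: "x \<in> Q" "y \<in> Q" "dist x y < \<epsilon> / 2" for x y i
  proof (induction i)
    case 0
    have "f 0 0 \<otimes> f 0 0 = f 0 0" using add[of 0 0 0] Q \<epsilon> by simp
    then have "f 0 0 = \<one>" using f[of 0 0] Q by (metis l_cancel_one)
    then show ?case by (simp add: P0 pt_def)
  next
    case (Suc i)
    let ?a = "pt i x" and ?b = "pt (Suc i) x" and ?c = "pt i y" and ?d = "pt (Suc i) y"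
    have Qs: "?a \<in> Q" "?b \<in> Q" "?c \<in> Q" "?d \<in> Q" using ptQ Suc.prems xy by auto
    have d: "dist ?a ?b < \<epsilon> / 2" "dist ?c ?d < \<epsilon> / 2" "dist ?a ?c < \<epsilon> / 2" "dist ?b ?d < \<epsilon> / 2"
      using step side[OF _ xy(3)] xy Suc.prems by auto
    then have ad: "dist ?a ?d < \<epsilon>" using dist_triangle_half_r dist_commute
      by (metis dist_triangle_half_l)
    have "f ?a ?b \<otimes> f ?b ?d = f ?a ?d" "f ?a ?c \<otimes> f ?c ?d = f ?a ?d"
      using add Qs d ad \<epsilon> by auto
    then have "P i x \<otimes> f ?a ?b \<otimes> f ?b ?d = P i x \<otimes> f ?a ?c \<otimes> f ?c ?d"
      using Pc[of i x] f Qs Suc.prems xy by (simp add: m_assoc)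
    then show ?case using Suc by (simp add: PS)
  qed
  show ?thesis
  proof (intro exI[of _ "P m"] conjI ballI impI)
    show "P m x \<in> carrier G" if "x \<in> Q" for x using Pc that by simp
    show "P m x \<otimes> f x y = P m y" if "x \<in> Q" "y \<in> Q" "dist x y < \<epsilon> / 2" for x y
      using main[OF that, of m] m0 by (simp add: pt_def)
  qed
qed

section \<open>Complements of hyperplanes\<close>

text \<open>Linear forms stand for the hyperplanes; several of them may define the same hyperplane.\<close>

definition arr_complement :: "(complex^'n) set \<Rightarrow> (complex^'n) set" where
  "arr_complement A = {x. \<forall>l\<in>A. lf l x \<noteq> 0}"

lemma open_arr_complement: "finite A \<Longrightarrow> open (arr_complement A)"
proof -
  assume A: "finite A"
  have "arr_complement A = (\<Inter>l\<in>A. {x. lf l x \<noteq> 0})" by (auto simp: arr_complement_def)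
  moreover have "open {x. lf l x \<noteq> 0}" for l :: "complex^'n"
    by (intro open_Collect_neq continuous_intros)
  ultimately show ?thesis using A by auto
qed

text \<open>
  Two points lie on a complex line, in which only finitely many points have to be avoided. The
  condition on \<open>U\<close> covers open convex sets as well as complex subspaces.
\<close>

lemma path_connected_minus_hyperplanes:
  fixes U :: "(complex^'n) set"
  assumes U: "\<And>a b. a \<in> U \<Longrightarrow> b \<in> U \<Longrightarrow> open {s::complex. a + s *s (b - a) \<in> U} \<and> convex {s::complex. a + s *s (b - a) \<in> U}"
    and A: "finite A"
  shows "path_connected (U \<inter> arr_complement A)"
  unfolding path_connected_def
proof (intro ballI)
  fix a b assume a: "a \<in> U \<inter> arr_complement A" and b: "b \<in> U \<inter> arr_complement A"
  define T where "T = {s::complex. a + s *s (b - a) \<in> U}"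
  define bad where "bad = (\<Union>l\<in>A. {s. lf l (a + s *s (b - a)) = 0})"
  have "finite {s. lf l (a + s *s (b - a)) = 0}" if l: "l \<in> A" for l
  proof -
    have la: "lf l a \<noteq> 0" using a l by (auto simp: arr_complement_def)
    have "{s. lf l (a + s *s (b - a)) = 0} \<subseteq> {- lf l a / lf l (b - a)}"
    proof
      fix s assume "s \<in> {s. lf l (a + s *s (b - a)) = 0}"
      then have e: "lf l a + s * lf l (b - a) = 0" by (simp only: mem_Collect_eq lf_add lf_scale)
      then have "lf l (b - a) \<noteq> 0" using la by auto
      then show "s \<in> {- lf l a / lf l (b - a)}" using e
        by (simp add: field_simps eq_neg_iff_add_eq_0)
    qed
    then show ?thesis by (rule finite_subset) simp
  qed
  then have "finite bad" using A by (simp add: bad_def)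
  then have "countable bad" by (rule countable_finite)
  have T: "open T" "convex T" using U[of a b] a b by (auto simp: T_def)
  have "path_connected (T - bad)"
    by (rule path_connected_open_diff_countable) (use T \<open>countable bad\<close> in \<open>auto intro: convex_connected\<close>)
  moreover have "0 \<in> T - bad" "1 \<in> T - bad"
    using a b by (auto simp: T_def bad_def arr_complement_def)
  ultimately obtain g where g: "path g" "path_image g \<subseteq> T - bad" "pathstart g = 0" "pathfinish g = 1"
    unfolding path_connected_def by blast
  let ?h = "\<lambda>s. a + s *s (b - a)"
  have h: "continuous_on UNIV ?h" by (intro continuous_intros)
  have "path (?h \<circ> g)"
    by (rule path_continuous_image[OF g(1) continuous_on_subset[OF h]]) simp
  moreover have "path_image (?h \<circ> g) \<subseteq> U \<inter> arr_complement A"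
    using g(2) by (force simp: path_image_compose T_def bad_def arr_complement_def)
  moreover have "pathstart (?h \<circ> g) = a" "pathfinish (?h \<circ> g) = b"
    using g by (simp_all add: pathstart_compose pathfinish_compose)
  ultimately show "\<exists>g. path g \<and> path_image g \<subseteq> U \<inter> arr_complement A \<and> pathstart g = a \<and> pathfinish g = b"
    by blast
qed

lemma convex_line_preimage:
  fixes U :: "(complex^'n) set"
  assumes "convex U" shows "convex {s::complex. a + s *s v \<in> U}"
proof (rule convexI)
  fix x y :: complex and u w :: real
  assume x: "x \<in> {s. a + s *s v \<in> U}" and y: "y \<in> {s. a + s *s v \<in> U}" and uw: "u \<ge> 0" "w \<ge> 0" "u + w = 1"
  have "u *\<^sub>R (a + x *s v) + w *\<^sub>R (a + y *s v) = (u + w) *\<^sub>R a + (u *\<^sub>R x + w *\<^sub>R y) *s v"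
    by (simp add: vec_eq_iff scaleR_add_right scaleR_add_left distrib_right)
  moreover have "u *\<^sub>R (a + x *s v) + w *\<^sub>R (a + y *s v) \<in> U"
    using convexD[OF assms] x y uw by auto
  ultimately show "u *\<^sub>R x + w *\<^sub>R y \<in> {s. a + s *s v \<in> U}" using uw by simp
qed

lemma path_connected_open_convex_minus_hyperplanes:
  fixes U :: "(complex^'n) set"
  assumes "open U" "convex U" "finite A"
  shows "path_connected (U \<inter> arr_complement A)"
proof (rule path_connected_minus_hyperplanes[OF _ assms(3)])
  fix a b assume "a \<in> U" "b \<in> U"
  have "continuous_on UNIV (\<lambda>s::complex. a + s *s (b - a))" by (intro continuous_intros)
  then have "open ((\<lambda>s::complex. a + s *s (b - a)) -` U)" using assms(1) open_vimage by blast
  then show "open {s::complex. a + s *s (b - a) \<in> U} \<and> convex {s::complex. a + s *s (b - a) \<in> U}"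
    using convex_line_preimage[OF assms(2), of a "b - a"] unfolding vimage_def by blast
qed

lemma path_connected_arr_complement: "finite A \<Longrightarrow> path_connected (arr_complement A)"
  using path_connected_open_convex_minus_hyperplanes[of UNIV A] by simp

lemma path_connected_hyperplane_minus:
  "finite A \<Longrightarrow> path_connected ({x. lf l x = 0} \<inter> arr_complement A)"
  by (rule path_connected_minus_hyperplanes) (auto simp: lf_add lf_scale lf_diff)

section \<open>Loops that die when a hyperplane is put back\<close>

lemma constant_along_stationary_path:
  fixes g :: "'q::metric_space \<Rightarrow> 'k"
  assumes \<sigma>: "continuous_on {0..1::real} \<sigma>" "\<sigma> ` {0..1} \<subseteq> Q" and d: "d > 0"
    and g: "\<And>a b. a \<in> \<sigma> ` {0..1} \<Longrightarrow> b \<in> \<sigma> ` {0..1} \<Longrightarrow> dist a b < d \<Longrightarrow> g a = g b"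
  shows "g (\<sigma> 0) = g (\<sigma> 1)"
proof -
  have "(\<lambda>t. g (\<sigma> t)) constant_on {0..1}"
  proof (rule locally_constant_imp_constant)
    fix t :: real assume t: "t \<in> {0..1}"
    let ?T = "{0..1} \<inter> \<sigma> -` ball (\<sigma> t) d"
    have "openin (top_of_set {0..1}) ?T"
      by (rule continuous_openin_preimage_gen[OF \<sigma>(1)]) simp
    moreover have "t \<in> ?T" using t d by simp
    moreover have "g (\<sigma> x) = g (\<sigma> t)" if "x \<in> ?T" for x
      by (rule g) (use that t in \<open>auto simp: dist_commute\<close>)
    ultimately show "\<exists>T. openin (top_of_set {0..1}) T \<and> t \<in> T \<and> (\<forall>x\<in>T. g (\<sigma> x) = g (\<sigma> t))"
      by (intro exI[of _ ?T] conjI ballI)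
  qed simp
  then show ?thesis by (auto simp: constant_on_def)
qed

text \<open>
  Let \<open>h\<close> be a contraction of \<open>\<gamma>\<close> in \<open>S'\<close>, defined on the unit square. Move each point of its
  image that is not in \<open>S\<close> slightly, into \<open>S\<close>. For nearby points \<open>a\<close> and \<open>b\<close> of the square, the
  value \<open>f a b\<close> of the functor on a short path in \<open>S\<close> between the moved points depends on nothing
  else, because small loops are killed. So \<open>f\<close> is locally additive, and it has a potential \<open>g\<close> by
  \<open>locally_additive_potential\<close>. Along the bottom side the increments of \<open>g\<close> multiply up to the
  value on \<open>\<gamma>\<close>, while \<open>g\<close> is constant along the three sides on which \<open>h\<close> is constant.
\<close>

lemma (in path_functor) null_homotopic_killed:
  fixes S' :: "'v set"
  assumes S': "open S'" "S \<subseteq> S'"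
    and dense: "\<And>z r. z \<in> S' \<Longrightarrow> r > 0 \<Longrightarrow> \<exists>y\<in>S. dist z y < r"
    and pc: "\<And>z r. ball z r \<subseteq> S' \<Longrightarrow> path_connected (ball z r \<inter> S)"
    and local: "\<And>c. c \<in> S' \<Longrightarrow> \<exists>\<rho>>0. ball c \<rho> \<subseteq> S' \<and>
        (\<forall>p. path_in (ball c \<rho> \<inter> S) p \<longrightarrow> pathfinish p = pathstart p \<longrightarrow> \<phi> p = \<one>)"
    and \<gamma>: "path_in S \<gamma>" "pathstart \<gamma> = x" "pathfinish \<gamma> = x"
    and null: "homotopic_paths S' \<gamma> (linepath x x)"
  shows "\<phi> \<gamma> = \<one>"
proof -
  define Q where "Q = {0..1::real} \<times> {0..1::real}"
  obtain h where h: "continuous_on Q h" "h ` Q \<subseteq> S'" "\<And>t. t \<in> {0..1} \<Longrightarrow> h (0, t) = \<gamma> t"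
    "\<And>t. t \<in> {0..1} \<Longrightarrow> h (1, t) = x" "\<And>s. s \<in> {0..1} \<Longrightarrow> h (s, 0) = x" "\<And>s. s \<in> {0..1} \<Longrightarrow> h (s, 1) = x"
    using null \<gamma> unfolding homotopic_paths Q_def
    by (auto simp: pathstart_def pathfinish_def linepath_refl image_subset_iff Pi_iff)
  have x: "x \<in> S" using \<gamma> path_in_ends by blast
  have cQ: "compact Q" "convex Q" "(0, 0) \<in> Q" by (auto simp: Q_def intro: compact_Times convex_Times)
  have "\<forall>c\<in>S'. \<exists>\<rho>>0. ball c \<rho> \<subseteq> S' \<and>
        (\<forall>p. path_in (ball c \<rho> \<inter> S) p \<longrightarrow> pathfinish p = pathstart p \<longrightarrow> \<phi> p = \<one>)" using local by blast
  from bchoice[OF this] obtain \<rho> where \<rho>': "\<forall>c\<in>S'. \<rho> c > 0 \<and> ball c (\<rho> c) \<subseteq> S' \<and>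
        (\<forall>p. path_in (ball c (\<rho> c) \<inter> S) p \<longrightarrow> pathfinish p = pathstart p \<longrightarrow> \<phi> p = \<one>)" by (elim exE)
  note \<rho>1 = bspec[OF \<rho>', THEN conjunct1]
    and \<rho>2 = bspec[OF \<rho>', THEN conjunct2, THEN conjunct1]
    and \<rho>3 = bspec[OF \<rho>', THEN conjunct2, THEN conjunct2, rule_format]
  have "compact (h ` Q)" using h(1) cQ(1) by (rule compact_continuous_image)
  then obtain r where r: "r > 0" "\<And>y. y \<in> h ` Q \<Longrightarrow> \<exists>B\<in>(\<lambda>c. ball c (\<rho> c)) ` S'. ball y r \<subseteq> B"
  proof (rule Heine_Borel_lemma[where \<G> = "(\<lambda>c. ball c (\<rho> c)) ` S'"])
    show "h ` Q \<subseteq> \<Union> ((\<lambda>c. ball c (\<rho> c)) ` S')"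
    proof
      fix y assume "y \<in> h ` Q"
      then have "y \<in> S'" using h(2) by blast
      moreover from this have "y \<in> ball y (\<rho> y)" using \<rho>1 by simp
      ultimately show "y \<in> \<Union> ((\<lambda>c. ball c (\<rho> c)) ` S')" by blast
    qed
  qed auto
  have ballS': "ball z r \<subseteq> S'" if "z \<in> h ` Q" for z using r(2)[OF that] \<rho>2 by blast
  have ball_kill: "\<phi> p = \<one>" if z: "z \<in> h ` Q" and p: "path_in (ball z r \<inter> S) p" "pathfinish p = pathstart p" for z p
  proof -
    obtain c where "c \<in> S'" "ball z r \<subseteq> ball c (\<rho> c)" using r(2)[OF z] by blast
    then show ?thesis using \<rho>3[of c p] path_in_mono[OF p(1), of "ball c (\<rho> c) \<inter> S"] p(2) by blast
  qed
  obtain \<epsilon> where \<epsilon>: "\<epsilon> > 0" "\<And>a b. a \<in> Q \<Longrightarrow> b \<in> Q \<Longrightarrow> dist a b < \<epsilon> \<Longrightarrow> dist (h a) (h b) < r / 4"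
  proof -
    have "\<exists>d>0. \<forall>b\<in>Q. \<forall>a\<in>Q. dist a b < d \<longrightarrow> dist (h a) (h b) < r / 4"
      using spec[OF compact_uniformly_continuous[OF h(1) cQ(1), unfolded uniformly_continuous_on_def], of "r / 4"] r(1)
      by simp
    then show ?thesis using that by blast
  qed
  define y where "y a = (if h a \<in> S then h a else SOME u. u \<in> S \<and> dist (h a) u < r / 4)" for a
  have y: "y a \<in> S" "dist (h a) (y a) < r / 4" if a: "a \<in> Q" for a
  proof -
    have "h a \<in> S'" using h(2) a by blast
    then have "\<exists>u. u \<in> S \<and> dist (h a) u < r / 4" using dense[of "h a" "r / 4"] r(1) by auto
    from someI_ex[OF this] show "y a \<in> S" "dist (h a) (y a) < r / 4" using r(1) by (auto simp: y_def)
  qed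
  define f where "f a b = \<phi> (SOME p. path_in (ball (h a) r \<inter> S) p \<and> pathstart p = y a \<and> pathfinish p = y b)" for a b
  have f_eq: "f a b = \<phi> p" if a: "a \<in> Q" and p: "path_in (ball (h a) r \<inter> S) p" "pathstart p = y a" "pathfinish p = y b" for a b p
  proof -
    let ?q = "SOME p. path_in (ball (h a) r \<inter> S) p \<and> pathstart p = y a \<and> pathfinish p = y b"
    have "path_in (ball (h a) r \<inter> S) ?q \<and> pathstart ?q = y a \<and> pathfinish ?q = y b"
      by (rule someI[of _ p]) (use p in blast)
    then show ?thesis unfolding f_def
      by (intro same_ends[of "ball (h a) r \<inter> S"] ball_kill[of "h a"]) (use a p in auto)
  qed
  have ex_path: "\<exists>p. path_in (ball (h a) (r / 2) \<inter> S) p \<and> pathstart p = y b \<and> pathfinish p = y c"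
    if "a \<in> Q" "b \<in> Q" "c \<in> Q" "dist a b < \<epsilon>" "dist a c < \<epsilon>" for a b c
  proof -
    have "ball (h a) (r / 2) \<subseteq> S'" using ballS'[of "h a"] that(1) r(1) by (auto simp: subset_iff)
    then have "path_connected (ball (h a) (r / 2) \<inter> S)" by (rule pc)
    moreover have "y d \<in> ball (h a) (r / 2) \<inter> S" if "d \<in> Q" "dist a d < \<epsilon>" for d
      using y[OF that(1)] \<epsilon>(2)[OF \<open>a \<in> Q\<close> that] dist_triangle[of "h a" "y d" "h d"] by simp
    ultimately show ?thesis using that unfolding path_connected_def path_in_def by blast
  qed
  have add: "f a b \<otimes> f b c = f a c"
    if abc: "a \<in> Q" "b \<in> Q" "c \<in> Q" "dist a b < \<epsilon>" "dist b c < \<epsilon>" "dist a c < \<epsilon>" for a b c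
  proof -
    obtain p where p: "path_in (ball (h a) (r / 2) \<inter> S) p" "pathstart p = y a" "pathfinish p = y b"
      using ex_path[of a a b] abc \<epsilon>(1) by auto
    obtain q where q: "path_in (ball (h a) (r / 2) \<inter> S) q" "pathstart q = y b" "pathfinish q = y c"
      using ex_path[of a b c] abc by auto
    have sub: "ball (h a) (r / 2) \<inter> S \<subseteq> ball (h a) r \<inter> S" "ball (h a) (r / 2) \<inter> S \<subseteq> S" using r(1) by auto
    have subb: "ball (h a) (r / 2) \<inter> S \<subseteq> ball (h b) r \<inter> S"
    proof
      fix u assume u: "u \<in> ball (h a) (r / 2) \<inter> S"
      have "dist (h b) u < r" using u \<epsilon>(2)[OF abc(1,2,4)] dist_triangle[of "h b" u "h a"] r(1)
        by (simp add: dist_commute)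
      then show "u \<in> ball (h b) r \<inter> S" using u by simp
    qed
    have "f a b = \<phi> p" by (rule f_eq[OF abc(1) path_in_mono[OF p(1) sub(1)] p(2,3)])
    moreover have "f b c = \<phi> q" by (rule f_eq[OF abc(2) path_in_mono[OF q(1) subb] q(2,3)])
    moreover have "f a c = \<phi> (p +++ q)"
      by (rule f_eq[OF abc(1) path_in_mono[OF path_in_join[OF p(1) q(1)] sub(1)]]) (use p q in auto)
    ultimately show ?thesis
      using join[OF path_in_mono[OF p(1) sub(2)] path_in_mono[OF q(1) sub(2)]] p q by simp
  qed
  have trivial: "f a b = \<one>" if ab: "a \<in> Q" "h a = x" "h b = x" for a b
  proof -
    have "y a = x" "y b = x" using ab x by (auto simp: y_def)
    then have "f a b = \<phi> (linepath x x)"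
      by (intro f_eq ab(1)) (use ab x r(1) in \<open>auto simp: path_in_const\<close>)
    then show ?thesis by (simp add: const x)
  qed
  define f' where "f' a b = (if dist a b < \<epsilon> then f a b else \<one>)" for a b
  have f'c: "f' a b \<in> carrier K" if ab: "a \<in> Q" "b \<in> Q" for a b
  proof (cases "dist a b < \<epsilon>")
    case True
    then obtain p where p: "path_in (ball (h a) (r / 2) \<inter> S) p" "pathstart p = y a" "pathfinish p = y b"
      using ex_path[of a a b] ab \<epsilon>(1) by auto
    have "f a b = \<phi> p"
      by (rule f_eq[OF ab(1) path_in_mono[OF p(1)] p(2,3)]) (use r(1) in auto)
    then show ?thesis using closed[OF path_in_mono[OF p(1)]] True by (simp add: f'_def)
  qed (simp add: f'_def)
  have f'add: "f' a b \<otimes> f' b c = f' a c"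
    if "a \<in> Q" "b \<in> Q" "c \<in> Q" "dist a b < \<epsilon>" "dist b c < \<epsilon>" "dist a c < \<epsilon>" for a b c
    using add[OF that] that by (simp add: f'_def)
  have "\<exists>g. (\<forall>a\<in>Q. g a \<in> carrier K) \<and> (\<forall>a\<in>Q. \<forall>b\<in>Q. dist a b < \<epsilon> / 2 \<longrightarrow> g a \<otimes> f' a b = g b)"
    by (rule locally_additive_potential[OF cQ(2) cQ(3)[folded zero_prod_def] compact_imp_bounded[OF cQ(1)] \<epsilon>(1)];
        intro f'c f'add)
  then obtain g where g': "(\<forall>a\<in>Q. g a \<in> carrier K) \<and> (\<forall>a\<in>Q. \<forall>b\<in>Q. dist a b < \<epsilon> / 2 \<longrightarrow> g a \<otimes> f' a b = g b)"
    by (elim exE)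
  have g: "a \<in> Q \<Longrightarrow> g a \<in> carrier K"
    "a \<in> Q \<Longrightarrow> b \<in> Q \<Longrightarrow> dist a b < \<epsilon> / 2 \<Longrightarrow> g a \<otimes> f' a b = g b" for a b
    using g' by blast+
  have stat: "g (\<sigma> 0) = g (\<sigma> 1)" if \<sigma>: "continuous_on {0..1::real} \<sigma>" "\<sigma> ` {0..1} \<subseteq> Q" "\<And>t. t \<in> {0..1} \<Longrightarrow> h (\<sigma> t) = x" for \<sigma>
  proof (rule constant_along_stationary_path[OF \<sigma>(1,2), of "\<epsilon> / 2"])
    fix a b assume ab: "a \<in> \<sigma> ` {0..1}" "b \<in> \<sigma> ` {0..1}" "dist a b < \<epsilon> / 2"
    then have "f' a b = \<one>" using trivial[of a b] \<sigma> by (auto simp: f'_def)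
    then show "g a = g b" using g(2)[of a b] g(1)[of a] ab \<sigma>(2) by auto
  qed (use \<epsilon> in simp)
  have "g (0, 0) = g (1, 0)" 
    by (rule stat[of "\<lambda>t. (t, 0)"]) (use h(5) in \<open>auto simp: Q_def intro!: continuous_intros\<close>)
  also have "\<dots> = g (1, 1)" 
    by (rule stat[of "\<lambda>t. (1, t)"]) (use h(4) in \<open>auto simp: Q_def intro!: continuous_intros\<close>)
  also have "\<dots> = g (0, 1)" 
    by (rule stat[of "\<lambda>t. (t, 1)", symmetric]) (use h(6) in \<open>auto simp: Q_def intro!: continuous_intros\<close>)
  finally have g01: "g (0, 0) = g (0, 1)" .
  \<comment> \<open>\<open>k\<close> is constant: this compares the functor along \<open>\<gamma>\<close> with the potential along the bottom side\<close>
  define k where "k t = \<phi> (subpath 0 t \<gamma>) \<otimes> inv (g (0, t))" for t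
  have \<gamma>p: "path \<gamma>" "path_image \<gamma> \<subseteq> S" using \<gamma>(1) by (auto simp: path_in_def)
  have sp: "path_in S (subpath u v \<gamma>)" if "u \<in> {0..1}" "v \<in> {0..1}" for u v
    using path_image_subpath_subset[OF that, of \<gamma>] that \<gamma>p path_subpath[OF \<gamma>p(1) that] by (auto simp: path_in_def)
  have k: "k u = k v" if uv: "u \<in> {0..1}" "v \<in> {0..1}" "\<bar>u - v\<bar> < \<epsilon> / 2" for u v
  proof -
    have Quv: "(0, u) \<in> Q" "(0, v) \<in> Q" using uv by (auto simp: Q_def)
    have yuv: "y (0, u) = \<gamma> u" "y (0, v) = \<gamma> v"
      using h(3) uv \<gamma>p(2) by (auto simp: y_def path_image_def image_subset_iff)
    have "path_image (subpath u v \<gamma>) \<subseteq> ball (h (0, u)) r"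
    proof
      fix z assume "z \<in> path_image (subpath u v \<gamma>)"
      then obtain w where w: "w \<in> closed_segment u v" "z = \<gamma> w" unfolding path_image_subpath_gen by blast
      have w01: "w \<in> {0..1}" using w(1) uv by (auto simp: closed_segment_eq_real_ivl split: if_splits)
      have "\<bar>u - w\<bar> \<le> \<bar>u - v\<bar>" using w(1) by (auto simp: closed_segment_eq_real_ivl split: if_splits)
      then have "dist (0::real, u) (0, w) < \<epsilon>" using uv \<epsilon>(1) by (simp add: dist_Pair_Pair dist_real_def)
      then have "dist (h (0, u)) (h (0, w)) < r / 4" using \<epsilon>(2)[of "(0, u)" "(0, w)"] Quv w01 by (simp add: Q_def)
      then show "z \<in> ball (h (0, u)) r" using w h(3)[OF w01] r(1) by simp
    qed
    then have pin: "path_in (ball (h (0, u)) r \<inter> S) (subpath u v \<gamma>)" using sp[OF uv(1,2)] by (simp add: path_in_def)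
    have "f (0, u) (0, v) = \<phi> (subpath u v \<gamma>)"
      by (rule f_eq[OF Quv(1) pin]) (simp_all add: yuv)
    moreover have d: "dist (0::real, u) (0, v) < \<epsilon> / 2" using uv by (simp add: dist_Pair_Pair dist_real_def)
    ultimately have gv: "g (0, v) = g (0, u) \<otimes> \<phi> (subpath u v \<gamma>)"
      using g(2)[OF Quv d] \<epsilon>(1) by (simp add: f'_def)
    have "homotopic_paths S (subpath 0 u \<gamma> +++ subpath u v \<gamma>) (subpath 0 v \<gamma>)"
      using homotopic_join_subpaths[OF \<gamma>p, of 0 u v] uv by simp
    then have "\<phi> (subpath 0 v \<gamma>) = \<phi> (subpath 0 u \<gamma>) \<otimes> \<phi> (subpath u v \<gamma>)"
      using homotopic[of "subpath 0 u \<gamma> +++ subpath u v \<gamma>" "subpath 0 v \<gamma>"]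
        join[OF sp[of 0 u] sp[of u v]] uv by simp
    then show ?thesis
      using closed[OF sp[of 0 u]] closed[OF sp[of u v]] g(1)[OF Quv(1)] uv
      by (simp add: k_def gv inv_mult_group m_assoc) (simp add: m_assoc[symmetric])
  qed
  have "k (id 0) = k (id 1)"
  proof (rule constant_along_stationary_path[of id UNIV "\<epsilon> / 2"])
    show "k a = k b" if "a \<in> id ` {0..1}" "b \<in> id ` {0..1}" "dist a b < \<epsilon> / 2" for a b
      by (rule k) (use that in \<open>auto simp: dist_real_def\<close>)
  qed (use \<epsilon> in \<open>auto simp: continuous_on_id id_def\<close>)
  then have "\<phi> (subpath 0 0 \<gamma>) \<otimes> inv (g (0, 0)) = \<phi> \<gamma> \<otimes> inv (g (0, 0))"
    by (simp add: k_def g01)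
  moreover have "\<phi> (subpath 0 0 \<gamma>) = \<one>"
    using const[of x] x \<gamma>(2) by (simp add: subpath_refl pathstart_def linepath_refl[symmetric])
  ultimately show ?thesis
    using g(1)[OF cQ(3)] closed[OF \<gamma>(1)] by (metis inv_closed one_closed right_cancel)
qed

section \<open>Meridians\<close>

lemma linepath_compose_translate:
  assumes E: "\<And>z. E (z + v) = E z"
  shows "E \<circ> linepath (a + v) (b + v) = E \<circ> linepath a b"
proof
  fix t :: real
  have "linepath (a + v) (b + v) t = linepath a b t + v"
    by (simp add: linepath_def algebra_simps)
  then show "(E \<circ> linepath (a + v) (b + v)) t = (E \<circ> linepath a b) t" by (simp add: E)
qed

text \<open>
  The chart \<open>E\<close> models the universal covering of a neighbourhood of a point of the hyperplane,
  minus the hyperplane: there \<open>C\<close> is a piece of the hyperplane times a half plane, \<open>E\<close> is the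
  exponential in the transverse direction, and \<open>v\<close> is its period. Since \<open>C\<close> is convex, the functor
  is known on all paths from its values \<open>seg\<close> on segments.
\<close>

locale periodic_chart = path_functor K S \<phi> + comm_group K
  for K :: "('k, 'm) monoid_scheme" (structure) and S :: "'v::real_normed_vector set" and \<phi> +
  fixes C :: "'w::real_normed_vector set" and E :: "'w \<Rightarrow> 'v" and v :: 'w
  assumes C: "convex C" and E: "continuous_on C E" "E ` C \<subseteq> S"
    and period: "\<And>z. E (z + v) = E z" and shift: "\<And>z k. z \<in> C \<Longrightarrow> z + of_int k *\<^sub>R v \<in> C"
begin

definition seg :: "'w \<Rightarrow> 'w \<Rightarrow> 'k" where "seg a b = \<phi> (E \<circ> linepath a b)"

lemma path_in_seg: "a \<in> C \<Longrightarrow> b \<in> C \<Longrightarrow> path_in S (E \<circ> linepath a b)"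
  by (rule path_in_compose[OF _ E]) (auto simp: path_in_def closed_segment_subset[OF _ _ C])

lemma seg_closed: "a \<in> C \<Longrightarrow> b \<in> C \<Longrightarrow> seg a b \<in> carrier K"
  unfolding seg_def by (intro closed path_in_seg)

lemma seg_add: 
  assumes a: "a \<in> C" and b: "b \<in> C" and c: "c \<in> C" shows "seg a b \<otimes> seg b c = seg a c"
proof -
  have "seg a b \<otimes> seg b c = \<phi> ((E \<circ> linepath a b) +++ (E \<circ> linepath b c))"
    unfolding seg_def
    by (rule join[symmetric, OF path_in_seg path_in_seg]) (use a b c in \<open>auto simp: pathfinish_compose pathstart_compose\<close>)
  also have "\<dots> = \<phi> (E \<circ> (linepath a b +++ linepath b c))" by (simp add: compose_joinpaths)
  also have "\<dots> = seg a c"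
    using convex_image_ends[OF C E, of "linepath a b +++ linepath b c"] a b c
    by (auto simp: seg_def path_in_def path_image_join closed_segment_subset[OF _ _ C])
  finally show ?thesis .
qed

lemma shift1: "z \<in> C \<Longrightarrow> z + v \<in> C" using shift[of z 1] by simp

lemma seg_shift: "seg (a + v) (b + v) = seg a b"
  by (simp add: seg_def linepath_compose_translate[of E v, OF period])

text \<open>
  The parallelogram with vertices \<open>a\<close>, \<open>b\<close> and their translates by the period; its sides \<open>a b\<close>
  have the same image. The values cancel because the group is commutative.
\<close>

lemma seg_period_const: assumes a: "a \<in> C" and b: "b \<in> C" shows "seg a (a + v) = seg b (b + v)"
proof -
  have "seg a b \<otimes> seg b (b + v) = seg a (a + v) \<otimes> seg (a + v) (b + v)"
    using a b shift1 by (simp add: seg_add)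
  also have "\<dots> = seg a b \<otimes> seg a (a + v)"
    using a b shift1 by (simp add: seg_shift seg_closed m_comm)
  finally show ?thesis using a b shift1 by (simp add: seg_closed)
qed

lemma seg_inv: "a \<in> C \<Longrightarrow> b \<in> C \<Longrightarrow> seg a b = inv (seg b a)"
proof -
  assume a: "a \<in> C" and b: "b \<in> C"
  have "seg a a \<otimes> seg a a = seg a a" using a seg_add by blast
  then have "seg a a = \<one>" using seg_closed[OF a a] by (metis l_cancel_one)
  then have "seg a b \<otimes> seg b a = \<one>" using seg_add[OF a b a] by simp
  then show ?thesis using seg_closed a b by (metis inv_equality)
qed

lemma shift_nat: "z \<in> C \<Longrightarrow> z + real n *\<^sub>R v \<in> C" using shift[of z "int n"] by simp

lemma seg_nat: "a \<in> C \<Longrightarrow> seg a (a + real n *\<^sub>R v) = seg a (a + v) [^] n"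
proof (induction n)
  case 0
  then have "seg a a \<otimes> seg a a = seg a a" using seg_add by blast
  then have "seg a a = \<one>" using seg_closed[of a a] 0 by (metis l_cancel_one)
  then show ?case by simp
next
  case (Suc n)
  let ?b = "a + real n *\<^sub>R v"
  have b: "?b \<in> C" by (rule shift_nat[OF Suc.prems])
  have e: "a + real (Suc n) *\<^sub>R v = ?b + v" by (simp add: algebra_simps)
  have "seg a (?b + v) = seg a ?b \<otimes> seg ?b (?b + v)"
    by (rule seg_add[symmetric]) (use Suc.prems b shift1 in auto)
  then show ?case
    unfolding e using Suc seg_period_const[OF b Suc.prems] by simp
qed

lemma seg_int:
  assumes a: "a \<in> C" shows "seg a (a + of_int k *\<^sub>R v) = seg a (a + v) [^] k"
proof (cases "k \<ge> 0")
  case True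
  then obtain n where "k = int n" by (metis nonneg_int_cases)
  then show ?thesis using seg_nat[OF a, of n] by (simp add: int_pow_int)
next
  case False
  then obtain n where n: "k = - int n" by (metis int_cases2 of_nat_0_le_iff)
  let ?b = "a + of_int k *\<^sub>R v"
  have b: "?b \<in> C" by (rule shift[OF a])
  have "seg a ?b = inv (seg ?b (?b + real n *\<^sub>R v))"
    using seg_inv[OF a b] n by simp
  also have "\<dots> = inv (seg a (a + v) [^] n)"
    by (simp add: seg_nat[OF b] seg_period_const[OF b a])
  also have "\<dots> = seg a (a + v) [^] k"
    using n seg_closed[OF a shift1[OF a]] by (simp add: int_pow_neg int_pow_int)
  finally show ?thesis .
qed

end

lemma lf_path_image_compose:
  "path_in (arr_complement A) p \<Longrightarrow> l \<in> A \<Longrightarrow> path (lf l \<circ> p) \<and> 0 \<notin> path_image (lf l \<circ> p)"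
  by (auto simp: path_in_def path_image_compose arr_complement_def
      intro!: path_continuous_image continuous_intros)

text \<open>
  At a point \<open>c\<close> of the hyperplane, a small loop lifts through \<open>(h, s) \<mapsto> h + exp s e\<close> to a path
  whose ends differ by a multiple of the period, and that multiple is the winding number; so the
  functor sends it to the corresponding power of the meridian \<open>m c\<close>. Charts at nearby points
  overlap, hence \<open>m\<close> is locally constant on the hyperplane minus the others, and this set is
  connected. At a point \<open>c\<close> off the hyperplane, small loops are contractible. If the hyperplane
  does not meet the complement of the others, \<open>\<mu>\<close> is arbitrary.
\<close>

lemma meridian_exists:
  fixes A :: "(complex^'n) set" and K :: "('k, 'm) monoid_scheme"
  assumes A: "finite A" and l: "l \<noteq> 0"
    and \<phi>: "path_functor K (arr_complement (insert l A)) \<phi>" and K: "comm_group K"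
  shows "\<exists>\<mu>\<in>carrier K. \<forall>c\<in>arr_complement A. \<exists>\<rho>>0. ball c \<rho> \<subseteq> arr_complement A \<and>
    (\<forall>p k. path_in (ball c \<rho> \<inter> arr_complement (insert l A)) p \<longrightarrow> pathfinish p = pathstart p \<longrightarrow>
       winding_number (lf l \<circ> p) 0 = of_int k \<longrightarrow> \<phi> p = \<mu> [^]\<^bsub>K\<^esub> k)"
proof -
  define S where "S = arr_complement (insert l A)"
  define S' where "S' = arr_complement A"
  interpret \<phi>: path_functor K S \<phi> using \<phi> by (simp add: S_def)
  interpret K: comm_group K by (rule K)
  have S_eq: "S = {x\<in>S'. lf l x \<noteq> 0}" by (auto simp: S_def S'_def arr_complement_def)
  have oS: "open S" "open S'" using A by (auto simp: S_def S'_def intro: open_arr_complement)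
  obtain e where e: "lf l e = 1" using lf_nonzero_dual[OF l] by blast
  define E where "E z = fst z + exp (snd z) *s e" for z :: "(complex^'n) \<times> complex"
  define v :: "(complex^'n) \<times> complex" where "v = (0, 2 * of_real pi * \<i>)"
  define chart where "chart c r = {(h, z). lf l h = 0 \<and> dist c h < r \<and> Re z < ln r}" for c :: "complex^'n" and r
  define H where "H = {x. lf l x = 0} \<inter> S'"
  have contE: "continuous_on UNIV E" unfolding E_def by (intro continuous_intros)
  have lfE: "lf l (E (h, z)) = exp z" if "lf l h = 0" for h z using that by (simp add: E_def lf_add lf_scale e)
  have ex_r: "\<exists>r>0. \<forall>h s. dist c h < r \<longrightarrow> norm s < r \<longrightarrow> h + s *s e \<in> S'" if c: "c \<in> H" for c
  proof -
    have "continuous_on UNIV (\<lambda>p::(complex^'n) \<times> complex. fst p + snd p *s e)" by (intro continuous_intros)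
    then have "open ((\<lambda>p::(complex^'n) \<times> complex. fst p + snd p *s e) -` S')" using oS(2) open_vimage by blast
    moreover have "(c, 0) \<in> (\<lambda>p::(complex^'n) \<times> complex. fst p + snd p *s e) -` S'" using c by (simp add: H_def)
    ultimately obtain U V where UV: "open U" "open V" "(c, 0) \<in> U \<times> V"
      "U \<times> V \<subseteq> (\<lambda>p::(complex^'n) \<times> complex. fst p + snd p *s e) -` S'"
      by (rule open_prod_elim)
    have "c \<in> U" "0 \<in> V" using UV(3) by auto
    then obtain r1 r2 where r: "r1 > 0" "ball c r1 \<subseteq> U" "r2 > 0" "ball 0 r2 \<subseteq> V"
      using UV(1,2) open_contains_ball by metis
    have "h + s *s e \<in> S'" if "dist c h < min r1 r2" "norm s < min r1 r2" for h s
    proof -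
      have "h \<in> U" "s \<in> V" using that r by auto
      then show ?thesis using UV(4) by auto
    qed
    then show ?thesis using r by (intro exI[of _ "min r1 r2"]) auto
  qed
  define r where "r c = (SOME r. r > 0 \<and> (\<forall>h s. dist c h < r \<longrightarrow> norm s < r \<longrightarrow> h + s *s e \<in> S'))" for c
  have r: "r c > 0" "dist c h < r c \<Longrightarrow> norm s < r c \<Longrightarrow> h + s *s e \<in> S'" if c: "c \<in> H" for c h s
    using someI_ex[OF ex_r[OF c], folded r_def] by blast+
  have chart: "periodic_chart K S \<phi> (chart c (r c)) E v" if c: "c \<in> H" for c
  proof unfold_locales
    have "chart c (r c) = ({h. lf l h = 0} \<inter> ball c (r c)) \<times> {z. Re z < ln (r c)}" by (auto simp: chart_def)
    moreover have "convex {h. lf l h = 0}"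
    proof (rule convexI)
      fix x y :: "complex^'n" and u w :: real
      assume "x \<in> {h. lf l h = 0}" "y \<in> {h. lf l h = 0}"
      moreover have "u *\<^sub>R x + w *\<^sub>R y = of_real u *s x + of_real w *s y"
        unfolding vec_eq_iff vector_add_component vector_scaleR_component vector_smult_component
        by (simp only: scaleR_conv_of_real simp_thms)
      ultimately show "u *\<^sub>R x + w *\<^sub>R y \<in> {h. lf l h = 0}" by (simp add: lf_add lf_scale)
    qed
    ultimately show "convex (chart c (r c))"
      by (auto intro!: convex_Times convex_Int convex_halfspace_Re_lt)
    show "continuous_on (chart c (r c)) E" using contE continuous_on_subset by blast
    show "E ` chart c (r c) \<subseteq> S"
    proof
      fix y assume "y \<in> E ` chart c (r c)"
      then obtain h z where hz: "y = E (h, z)" "lf l h = 0" "dist c h < r c" "Re z < ln (r c)"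
        by (auto simp: chart_def)
      have "norm (exp z) < r c" using hz(4) r(1)[OF c] by (simp add: norm_exp_eq_Re) (metis exp_less_cancel_iff exp_ln)
      then have "y \<in> S'" using r(2)[OF c hz(3)] by (simp add: hz(1) E_def)
      then show "y \<in> S" using lfE[OF hz(2)] hz(1) by (simp add: S_eq)
    qed
    show "E (z + v) = E z" for z by (simp add: E_def v_def exp_add exp_two_pi_i[unfolded mult.assoc] exp_two_pi_i)
    show "z + of_int k *\<^sub>R v \<in> chart c (r c)" if "z \<in> chart c (r c)" for z k
      using that by (auto simp: chart_def v_def)
  qed
  define m where "m c = \<phi> (E \<circ> linepath (c, of_real (ln (r c) - 1)) ((c, of_real (ln (r c) - 1)) + v))" for c
  have base: "(c, of_real (ln (r c) - 1)) \<in> chart c (r c)" if "c \<in> H" for c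
    using that r(1)[OF that] by (simp add: chart_def H_def)
  have m_eq: "\<phi> (E \<circ> linepath z (z + v)) = m c" if c: "c \<in> H" and z: "z \<in> chart c (r c)" for c z
  proof -
    interpret periodic_chart K S \<phi> "chart c (r c)" E v by (rule chart[OF c])
    show ?thesis using seg_period_const[OF z base[OF c]] by (simp add: seg_def m_def)
  qed
  have "m constant_on H"
  proof (rule locally_constant_imp_constant)
    show "connected H" unfolding H_def S'_def
      by (rule path_connected_imp_connected[OF path_connected_hyperplane_minus[OF A]])
    fix c assume c: "c \<in> H"
    have "m c' = m c" if c': "c' \<in> H \<inter> ball c (r c)" for c'
    proof -
      let ?z = "(c', of_real (min (ln (r c)) (ln (r c')) - 1)) :: (complex^'n) \<times> complex"
      have "?z \<in> chart c (r c)" "?z \<in> chart c' (r c')"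
        using c' r(1)[of c'] by (auto simp: chart_def H_def)
      then show ?thesis using m_eq[OF c, of ?z] m_eq[of c' ?z] c' by simp
    qed
    moreover have "openin (top_of_set H) (H \<inter> ball c (r c))" by (simp add: openin_open_Int)
    moreover have "c \<in> H \<inter> ball c (r c)" using c r(1)[OF c] by simp
    ultimately show "\<exists>T. openin (top_of_set H) T \<and> c \<in> T \<and> (\<forall>x\<in>T. m x = m c)"
      by (intro exI[of _ "H \<inter> ball c (r c)"] conjI ballI)
  qed
  then obtain \<mu>0 where \<mu>0: "\<And>c. c \<in> H \<Longrightarrow> m c = \<mu>0" by (auto simp: constant_on_def)
  define \<mu> where "\<mu> = (if H = {} then \<one>\<^bsub>K\<^esub> else \<mu>0)"
  have m: "m c = \<mu>" if "c \<in> H" for c using \<mu>0[OF that] that by (auto simp: \<mu>_def)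
  have "m c \<in> carrier K" if c: "c \<in> H" for c
  proof -
    interpret periodic_chart K S \<phi> "chart c (r c)" E v by (rule chart[OF c])
    show ?thesis using seg_closed[OF base[OF c] shift1[OF base[OF c]]] by (simp add: seg_def m_def)
  qed
  then have \<mu>c: "\<mu> \<in> carrier K" using m by (cases "H = {}") (auto simp: \<mu>_def)
  have "\<exists>\<rho>>0. ball c \<rho> \<subseteq> S' \<and> (\<forall>p k. path_in (ball c \<rho> \<inter> S) p \<longrightarrow> pathfinish p = pathstart p \<longrightarrow>
       winding_number (lf l \<circ> p) 0 = of_int k \<longrightarrow> \<phi> p = \<mu> [^]\<^bsub>K\<^esub> k)" if cS': "c \<in> S'" for c
  proof (cases "c \<in> H")
    case False
    then have "c \<in> S" using cS' by (simp add: H_def S_eq)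
    then obtain \<rho> where \<rho>: "\<rho> > 0" "ball c \<rho> \<subseteq> S" using oS(1) open_contains_ball by blast
    have "\<phi> p = \<mu> [^]\<^bsub>K\<^esub> k" if p: "path_in (ball c \<rho> \<inter> S) p" "pathfinish p = pathstart p"
      "winding_number (lf l \<circ> p) 0 = of_int k" for p and k :: int
    proof -
      let ?a = "pathstart p"
      have pb: "path_in (ball c \<rho>) p" using p(1) by (auto simp: path_in_def)
      have a: "?a \<in> ball c \<rho>" using path_in_ends(1)[OF pb] .
      have hom: "homotopic_paths (ball c \<rho>) p (linepath ?a ?a)"
        using convex_imp_simply_connected[OF convex_ball, of c \<rho>] pb a p(2)
        unfolding simply_connected_eq_homotopic_paths path_in_def by auto
      then have "homotopic_paths (-{0}) (lf l \<circ> p) (lf l \<circ> linepath ?a ?a)"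
        by (rule homotopic_paths_continuous_image) (use \<rho> in \<open>auto intro!: continuous_intros simp: S_eq\<close>)
      then have "winding_number (lf l \<circ> p) 0 = winding_number (lf l \<circ> linepath ?a ?a) 0"
        by (rule winding_number_homotopic_paths)
      also have "lf l \<circ> linepath ?a ?a = linepath (lf l ?a) (lf l ?a)" by (auto simp: linepath_refl)
      also have "winding_number \<dots> 0 = 0" using a \<rho> by (intro winding_number_trivial) (auto simp: S_eq)
      finally have "winding_number (lf l \<circ> p) 0 = 0" .
      then have "k = 0" using p(3) by simp
      moreover have "\<phi> p = \<phi> (linepath ?a ?a)"
        by (rule \<phi>.homotopic[OF homotopic_paths_subset[OF hom \<rho>(2)]])
      ultimately show ?thesis using \<phi>.const[of ?a] a \<rho> by auto
    qed
    then show ?thesis using \<rho> by (intro exI[of _ \<rho>]) (auto simp: S_eq)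
  next
    case c: True
    interpret ch: periodic_chart K S \<phi> "chart c (r c)" E v by (rule chart[OF c])
    define pr where "pr x = x - lf l x *s e" for x
    have pr: "lf l (pr x) = 0" "pr x + lf l x *s e = x" for x by (simp_all add: pr_def lf_diff lf_scale e)
    define U where "U = {x. dist c (pr x) < r c} \<inter> {x. norm (lf l x) < r c}"
    have "open U" unfolding U_def pr_def
      by (intro open_Int open_Collect_less continuous_intros)
    moreover have "c \<in> U" using c r(1)[OF c] by (simp add: U_def pr_def H_def)
    ultimately obtain \<rho> where \<rho>: "\<rho> > 0" "ball c \<rho> \<subseteq> U" using open_contains_ball by blast
    have US': "U \<subseteq> S'"
    proof
      fix x assume "x \<in> U"
      then have "pr x + lf l x *s e \<in> S'" by (intro r(2)[OF c]) (auto simp: U_def)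
      then show "x \<in> S'" by (simp add: pr)
    qed
    have "\<phi> p = \<mu> [^]\<^bsub>K\<^esub> k" if p: "path_in (ball c \<rho> \<inter> S) p" "pathfinish p = pathstart p"
      "winding_number (lf l \<circ> p) 0 = of_int k" for p and k :: int
    proof -
      have pp: "path p" "path_image p \<subseteq> ball c \<rho>" "path_image p \<subseteq> S" using p(1) by (auto simp: path_in_def)
      have "path_in (arr_complement (insert l A)) p" using pp by (simp add: path_in_def S_def)
      then have lp: "path (lf l \<circ> p)" "0 \<notin> path_image (lf l \<circ> p)" using lf_path_image_compose by blast+
      obtain q where q: "path q" "pathfinish q - pathstart q = 2 * of_real pi * \<i> * winding_number (lf l \<circ> p) 0"
        "\<And>t. t \<in> {0..1} \<Longrightarrow> (lf l \<circ> p) t = 0 + exp (q t)"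
        using winding_number_as_continuous_log[OF lp] by blast
      define P where "P t = (pr (p t), q t)" for t
      have EP: "E (P t) = p t" if "t \<in> {0..1}" for t
        using q(3)[OF that] pr(2)[of "p t"] by (simp add: E_def P_def)
      have "continuous_on {0..1} P" unfolding P_def pr_def
        using pp(1) q(1) unfolding path_def by (intro continuous_intros) auto
      moreover have "P t \<in> chart c (r c)" if t: "t \<in> {0..1}" for t
      proof -
        have "p t \<in> U" using pp(2) \<rho>(2) t unfolding path_image_def by blast
        then have "dist c (pr (p t)) < r c" "norm (exp (q t)) < r c" using q(3)[OF t] by (auto simp: U_def)
        moreover from this have "Re (q t) < ln (r c)"
          using r(1)[OF c] by (simp add: norm_exp_eq_Re) (metis exp_less_cancel_iff exp_ln)
        ultimately show ?thesis by (simp add: chart_def P_def pr)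
      qed
      ultimately have P: "path_in (chart c (r c)) P" by (auto simp: path_in_def path_def path_image_def)
      have "pathfinish P = pathstart P + of_int k *\<^sub>R v"
        using q(2) p(2,3) by (simp add: P_def pathfinish_def pathstart_def v_def scaleR_conv_of_real algebra_simps)
      then have "\<phi> (E \<circ> P) = ch.seg (pathstart P) (pathstart P + of_int k *\<^sub>R v)"
        using \<phi>.convex_image_ends[OF ch.C ch.E P] by (simp add: ch.seg_def)
      also have "\<dots> = ch.seg (pathstart P) (pathstart P + v) [^]\<^bsub>K\<^esub> k"
        by (rule ch.seg_int[OF path_in_ends(1)[OF P]])
      also have "ch.seg (pathstart P) (pathstart P + v) = \<mu>"
        using m_eq[OF c path_in_ends(1)[OF P]] m[OF c] by (simp add: ch.seg_def)
      also have "\<phi> (E \<circ> P) = \<phi> p"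
        by (rule \<phi>.eq_paths[symmetric]) (use pp EP in \<open>auto simp: path_in_def\<close>)
      finally show ?thesis .
    qed
    then show ?thesis using \<rho> US' by (intro exI[of _ \<rho>]) auto
  qed
  then show ?thesis using \<mu>c unfolding S_def S'_def by blast
qed

section \<open>Winding numbers detect the abelianised fundamental group\<close>

lemma bounded_linear_lf: "bounded_linear (lf l)"
proof -
  have "linear (lf l)"
  proof (rule linearI)
    show "lf l (r *\<^sub>R x) = r *\<^sub>R lf l x" for r x
      unfolding lf_def by (simp add: scaleR_sum_right)
  qed (rule lf_add)
  then show ?thesis by (simp add: linear_conv_bounded_linear)
qed

lemma norm_vector_smult: "norm (c *s x) = norm c * norm (x :: complex^'n)"
  by (simp add: norm_vec_def norm_mult L2_set_right_distrib)

text \<open>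
  Replace \<open>p\<close> by a nearby polynomial path \<open>g\<close> and add a multiple of the bump \<open>t (1 - t)\<close> in a
  transverse direction. The factors for which the result still meets the hyperplane form a smooth
  curve in the complex plane, which has measure zero.
\<close>

lemma push_off_hyperplane:
  fixes S' :: "(complex^'n) set"
  assumes l: "l \<noteq> 0" and S': "open S'" and p: "path_in S' p"
    and ends: "lf l (pathstart p) \<noteq> 0" "lf l (pathfinish p) \<noteq> 0"
  obtains p' where "path_in {x\<in>S'. lf l x \<noteq> 0} p'" "homotopic_paths S' p p'"
proof -
  obtain \<delta> where \<delta>: "\<delta> > 0" "\<And>h. path h \<Longrightarrow> pathstart h = pathstart p \<Longrightarrow> pathfinish h = pathfinish p \<Longrightarrow>
      (\<forall>t\<in>{0..1}. norm (h t - p t) < \<delta>) \<Longrightarrow> homotopic_paths S' p h"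
    using homotopic_nearby_paths[of p S'] p S' unfolding path_in_def by metis
  obtain g where g: "polynomial_function g" "pathstart g = pathstart p" "pathfinish g = pathfinish p"
    "\<And>t. t \<in> {0..1} \<Longrightarrow> norm (g t - p t) < \<delta> / 2"
    using path_approx_polynomial_function[of p "\<delta> / 2"] p \<delta>(1) unfolding path_in_def by auto
  obtain e where e: "lf l e = 1" using lf_nonzero_dual[OF l] by blast
  define F where "F t = - lf l (g t) / of_real (t * (1 - t))" for t :: real
  have "F differentiable_on {0<..<1}"
  proof -
    have 1: "(\<lambda>t. lf l (g t)) differentiable_on {0<..<1}"
      by (rule differentiable_on_compose[OF differentiable_on_polynomial_function[OF g(1)]
            bounded_linear_imp_differentiable_on[OF bounded_linear_lf]])
    have "(\<lambda>t::real. t * (1 - t)) differentiable_on {0<..<1}"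
      by (auto simp: differentiable_on_def intro!: derivative_intros)
    then have 2: "(\<lambda>t. of_real (t * (1 - t)) :: complex) differentiable_on {0<..<1}"
      by (rule differentiable_on_compose[OF _ bounded_linear_imp_differentiable_on[OF bounded_linear_of_real]])
    show ?thesis
      unfolding F_def differentiable_on_def
    proof
      fix t :: real assume t: "t \<in> {0<..<1}"
      show "(\<lambda>t. - lf l (g t) / of_real (t * (1 - t))) differentiable at t within {0<..<1}"
        by (intro differentiable_divide differentiable_minus) (use 1 2 t in \<open>auto simp: differentiable_on_def\<close>)
    qed
  qed
  then have neg: "negligible (F ` {0<..<1})"
    by (rule negligible_differentiable_image_lowdim[rotated]) simp
  define \<eta> where "\<eta> = \<delta> / (2 * (norm e + 1))"
  have \<eta>: "\<eta> > 0" using \<delta>(1) by (simp add: \<eta>_def add_nonneg_pos)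
  have "\<not> ball 0 \<eta> \<subseteq> F ` {0<..<1}"
    using neg \<eta> open_not_negligible[of "ball (0::complex) \<eta>"] negligible_subset by (metis ball_eq_empty linorder_not_le open_ball)
  then obtain \<tau> where "\<tau> \<in> ball 0 \<eta>" and \<tau>2: "\<tau> \<notin> F ` {0<..<1}" by blast
  then have \<tau>: "norm \<tau> < \<eta>" "\<tau> \<notin> F ` {0<..<1}" by simp_all
  define h where "h t = g t + (\<tau> * of_real (t * (1 - t))) *s e" for t :: real
  have contg: "continuous_on {0..1} g"
    using g(1) continuous_on_polymonial_function by blast
  have h: "path h" unfolding path_def h_def
    by (intro continuous_intros contg)
  have hends: "pathstart h = pathstart p" "pathfinish h = pathfinish p"
    using g(2,3) by (simp_all add: h_def pathstart_def pathfinish_def)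
  have near: "norm (h t - p t) < \<delta>" if t: "t \<in> {0..1}" for t
  proof -
    have "norm ((\<tau> * of_real (t * (1 - t))) *s e) = norm \<tau> * (t * (1 - t)) * norm e"
      using t by (simp add: norm_vector_smult norm_mult del: of_real_mult of_real_diff)
    also have "\<dots> \<le> \<eta> * 1 * norm e"
      using t \<tau>(1) \<eta> by (intro mult_mono) (auto intro: mult_le_one)
    also have "\<dots> \<le> \<delta> / 2"
    proof -
      have "\<eta> * norm e \<le> \<eta> * (norm e + 1)" using \<eta> by (intro mult_left_mono) auto
      also have "\<dots> = \<delta> / 2" by (simp add: \<eta>_def field_simps add_nonneg_eq_0_iff)
      finally show ?thesis by simp
    qed
    finally have "norm ((\<tau> * of_real (t * (1 - t))) *s e) \<le> \<delta> / 2" .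
    moreover have "norm (h t - p t) = norm ((g t - p t) + (\<tau> * of_real (t * (1 - t))) *s e)"
      by (rule arg_cong[of _ _ norm]) (simp add: h_def)
    ultimately show ?thesis using g(4)[OF t] norm_triangle_ineq[of "g t - p t" "(\<tau> * of_real (t * (1 - t))) *s e"]
      by linarith
  qed
  have hom: "homotopic_paths S' p h" using \<delta>(2)[OF h hends] near by blast
  have "lf l (h t) \<noteq> 0" if t: "t \<in> {0..1}" for t
  proof (cases "t = 0 \<or> t = 1")
    case True
    then show ?thesis using ends hends by (auto simp: pathstart_def pathfinish_def)
  next
    case False
    then have t': "t \<in> {0<..<1}" using t by auto
    define c where "c = (of_real (t * (1 - t)) :: complex)"
    have "c \<noteq> 0" using t' by (auto simp: c_def)
    moreover have \<tau>t: "\<tau> \<noteq> - lf l (g t) / c" using \<tau>(2) t' unfolding F_def c_def by blast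
    moreover have "lf l (h t) = lf l (g t) + \<tau> * c"
      unfolding h_def c_def[symmetric] by (simp only: lf_add lf_scale e mult_1_right)
    ultimately show ?thesis using eq_divide_imp[of c \<tau> "- lf l (g t)"] by (auto simp: add_eq_0_iff)
  qed
  then have "path_in {x\<in>S'. lf l x \<noteq> 0} h"
    using homotopic_paths_imp_subset[OF hom] h by (auto simp: path_in_def path_image_def)
  then show ?thesis using that hom by blast
qed

lemma winding_lf_homotopic:
  assumes "homotopic_paths (arr_complement A) p q" "l \<in> A"
  shows "winding_number (lf l \<circ> p) 0 = winding_number (lf l \<circ> q) 0"
proof (rule winding_number_homotopic_paths)
  show "homotopic_paths (- {0}) (lf l \<circ> p) (lf l \<circ> q)"
    by (rule homotopic_paths_continuous_image[OF assms(1)])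
      (use assms(2) in \<open>auto intro!: continuous_intros simp: arr_complement_def\<close>)
qed

lemma winding_lf_join:
  assumes "path_in (arr_complement A) p" "path_in (arr_complement A) q" "pathfinish p = pathstart q" "l \<in> A"
  shows "winding_number (lf l \<circ> (p +++ q)) 0 = winding_number (lf l \<circ> p) 0 + winding_number (lf l \<circ> q) 0"
  unfolding compose_joinpaths
  using lf_path_image_compose[OF assms(1,4)] lf_path_image_compose[OF assms(2,4)] assms(3)
  by (intro winding_number_join) (auto simp: pathfinish_compose pathstart_compose)

lemma winding_lf_reverse:
  assumes "path_in (arr_complement A) p" "l \<in> A"
  shows "winding_number (lf l \<circ> reversepath p) 0 = - winding_number (lf l \<circ> p) 0"
  using winding_number_reversepath[of "lf l \<circ> p" 0] lf_path_image_compose[OF assms]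
  by (simp add: reversepath_o o_assoc reversepath_def o_def)

lemma winding_lf_int:
  assumes "path_in (arr_complement A) p" "pathfinish p = pathstart p" "l \<in> A"
  shows "\<exists>k::int. winding_number (lf l \<circ> p) 0 = of_int k"
  using integer_winding_number[of "lf l \<circ> p" 0] lf_path_image_compose[OF assms(1,3)] assms(2)
  by (auto simp: pathfinish_compose pathstart_compose elim: Ints_cases)

text \<open>
  Induction on the arrangement. By the induction hypothesis the loop is a product of commutators
  in the larger complement \<open>S'\<close>, and these lift to the smaller complement \<open>S\<close> by
  \<open>push_off_hyperplane\<close>. So modulo commutators of the fundamental group of \<open>S\<close> it is a loop that
  is contractible in \<open>S'\<close>. Let \<open>\<mu>\<close> be the meridian of the new hyperplane in the abelianisation
  \<open>Q\<close>. The map \<open>\<Psi>\<close>, which divides the class in \<open>Q\<close> by the power of \<open>\<mu>\<close> given by the winding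
  number, kills small loops around the hyperplane, hence also the contractible loop by
  \<open>null_homotopic_killed\<close>. As the winding number of the given loop is \<open>0\<close>, the value of \<open>\<Psi>\<close> on it
  is its class in \<open>Q\<close>.
\<close>

theorem zero_winding_imp_derived:
  fixes A :: "(complex^'n) set"
  assumes "finite A" "0 \<notin> A" "x0 \<in> arr_complement A"
    and "loop_at (top_of_set (arr_complement A)) x0 p"
    and "\<And>l. l \<in> A \<Longrightarrow> winding_number (lf l \<circ> p) 0 = 0"
  shows "loop_class (top_of_set (arr_complement A)) x0 p \<in>
    derived (fundamental_group (top_of_set (arr_complement A)) x0)
      (carrier (fundamental_group (top_of_set (arr_complement A)) x0))"
  using assms
proof (induction A arbitrary: p rule: finite_induct)
  case empty
  let ?T = "top_of_set (arr_complement {}) :: (complex^'n) topology"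
  interpret F: group "fundamental_group ?T x0" by (rule group_fundamental_group) (simp add: arr_complement_def)
  have p: "path p" "pathstart p = x0" "pathfinish p = x0" using empty.prems by (auto simp: loop_at_top_of_set)
  have "homotopic_paths UNIV p (linepath x0 x0)"
    using convex_imp_simply_connected[OF convex_UNIV, where 'a = "complex^'n"] p
    unfolding simply_connected_eq_homotopic_paths by auto
  then have "homotopic_loops_at ?T x0 p (linepath x0 x0)"
    unfolding homotopic_loops_at_top_of_set using p by (simp add: arr_complement_def)
  from loop_class_eqI[OF this] have "loop_class ?T x0 p = \<one>\<^bsub>fundamental_group ?T x0\<^esub>"
    by (simp add: one_fundamental_group linepath_refl)
  then show ?case using subgroup.one_closed[OF F.derived_is_subgroup] by simp
next
  case (insert l A)
  define S where "S = arr_complement (insert l A)"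
  define S' where "S' = arr_complement A"
  let ?F = "fundamental_group (top_of_set S) x0" and ?F' = "fundamental_group (top_of_set S') x0"
  let ?cl = "loop_class (top_of_set S) x0" and ?cl' = "loop_class (top_of_set S') x0"
  have l: "l \<noteq> 0" and A0: "0 \<notin> A" using insert.prems by auto
  have S_eq: "S = {x\<in>S'. lf l x \<noteq> 0}" by (auto simp: S_def S'_def arr_complement_def)
  have oS: "open S" "open S'" using insert.hyps by (auto simp: S_def S'_def intro: open_arr_complement)
  have x0: "x0 \<in> S" "x0 \<in> S'" using insert.prems by (auto simp: S_def S'_def arr_complement_def)
  have pcS: "path_connected S" unfolding S_def using insert.hyps by (intro path_connected_arr_complement) auto
  interpret F: group ?F by (rule group_fundamental_group) (use x0 in simp)
  interpret F': group ?F' by (rule group_fundamental_group) (use x0 in simp)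
  define D where "D = derived ?F (carrier ?F)"
  define Q where "Q = ?F Mod D"
  interpret Q: comm_group Q unfolding Q_def D_def by (rule F.derived_quot_is_comm_group)
  interpret D: normal D ?F unfolding D_def by (rule F.derived_is_normal[OF F.normal_self])
  define q where "q g = D #>\<^bsub>?F\<^esub> g" for g
  have q: "q \<in> hom ?F Q" unfolding q_def Q_def by (rule D.r_coset_hom_Mod)
  from path_functor_extension[OF pcS x0(1) Q.is_group q]
  obtain \<phi> where \<phi>: "path_functor Q S \<phi>"
    and \<phi>q': "\<forall>p. loop_at (top_of_set S) x0 p \<longrightarrow> \<phi> p = q (?cl p)"
    by (elim exE conjE)
  have \<phi>q: "\<phi> p = q (?cl p)" if "loop_at (top_of_set S) x0 p" for p using \<phi>q' that by blast
  interpret \<phi>: path_functor Q S \<phi> by (rule \<phi>)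
  obtain \<mu> where \<mu>: "\<mu> \<in> carrier Q" and \<mu>_local: "\<forall>c\<in>S'. \<exists>\<rho>>0. ball c \<rho> \<subseteq> S' \<and>
    (\<forall>p k. path_in (ball c \<rho> \<inter> S) p \<longrightarrow> pathfinish p = pathstart p \<longrightarrow>
       winding_number (lf l \<circ> p) 0 = of_int k \<longrightarrow> \<phi> p = \<mu> [^]\<^bsub>Q\<^esub> k)"
    using meridian_exists[OF insert.hyps(1) l \<phi>[unfolded S_def] Q.comm_group_axioms]
    unfolding S_def S'_def by blast
  define wn where "wn p = winding_number (lf l \<circ> p) 0" for p
  define N where "N g = (THE k::int. \<exists>p\<in>g. wn p = of_int k)" for g
  have loopS: "loop_at (top_of_set S) x0 p \<longleftrightarrow> path_in S p \<and> pathstart p = x0 \<and> pathfinish p = x0" for p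
    by (simp add: loop_at_path_in)
  have N: "N (?cl p) = k" if p: "loop_at (top_of_set S) x0 p" and k: "wn p = of_int k" for p k
    unfolding N_def
  proof (rule the_equality)
    show "\<exists>p\<in>?cl p. wn p = of_int k" using mem_loop_class_self[OF p] k by blast
    fix j :: int assume "\<exists>p\<in>?cl p. wn p = of_int j"
    then obtain p' where p': "p' \<in> ?cl p" "wn p' = of_int j" by blast
    then have "homotopic_paths S p p'" by (simp add: mem_loop_class homotopic_loops_at_top_of_set)
    then have "wn p = wn p'" unfolding wn_def S_def by (rule winding_lf_homotopic) simp
    then show "j = k" using k p' by simp
  qed
  have wn_int: "\<exists>k::int. wn p = of_int k" if "loop_at (top_of_set S) x0 p" for p
    unfolding wn_def using winding_lf_int[of "insert l A" p l, folded S_def] that[unfolded loopS] by auto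
  define \<Psi> where "\<Psi> g = q g \<otimes>\<^bsub>Q\<^esub> \<mu> [^]\<^bsub>Q\<^esub> (- N g)" for g
  have \<Psi>: "\<Psi> \<in> hom ?F Q"
  proof (rule homI)
    fix g assume "g \<in> carrier ?F"
    then obtain p where p: "g = ?cl p" "loop_at (top_of_set S) x0 p" by (auto simp: carrier_fundamental_group)
    have qg: "q g' \<in> carrier Q" if "g' \<in> carrier ?F" for g' using q that by (auto simp: hom_def)
    show "\<Psi> g \<in> carrier Q" using qg[OF \<open>g \<in> carrier ?F\<close>] \<mu> by (simp add: \<Psi>_def)
    fix g' assume "g' \<in> carrier ?F"
    then obtain p' where p': "g' = ?cl p'" "loop_at (top_of_set S) x0 p'" by (auto simp: carrier_fundamental_group)
    obtain k k' where k: "wn p = of_int k" "wn p' = of_int k'" using wn_int p p' by blast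
    have gg: "g \<otimes>\<^bsub>?F\<^esub> g' = ?cl (p +++ p')"
      using p p' by (simp add: mult_fundamental_group join_loops_eq_joinpaths)
    have "wn (p +++ p') = of_int (k + k')"
      using p(2)[unfolded loopS] p'(2)[unfolded loopS] k winding_lf_join[of "insert l A" p p' l, folded S_def wn_def]
      by simp
    then have "N (g \<otimes>\<^bsub>?F\<^esub> g') = k + k'"
      using N[of "p +++ p'"] loop_at_join[OF p(2) p'(2)] by (simp add: gg join_loops_eq_joinpaths)
    then have NN: "- N (g \<otimes>\<^bsub>?F\<^esub> g') = - N g + - N g'" using N p p' k by simp
    have "q (g \<otimes>\<^bsub>?F\<^esub> g') = q g \<otimes>\<^bsub>Q\<^esub> q g'"
      using q \<open>g \<in> carrier ?F\<close> \<open>g' \<in> carrier ?F\<close> by (simp add: hom_def)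
    then show "\<Psi> (g \<otimes>\<^bsub>?F\<^esub> g') = \<Psi> g \<otimes>\<^bsub>Q\<^esub> \<Psi> g'"
      unfolding \<Psi>_def NN Q.int_pow_mult[OF \<mu>]
      using qg[OF \<open>g \<in> carrier ?F\<close>] qg[OF \<open>g' \<in> carrier ?F\<close>] \<mu>
      by (simp add: Q.m_ac)
  qed
  interpret \<Psi>h: group_hom ?F Q \<Psi> by (intro group_hom.intro group_hom_axioms.intro F.is_group Q.is_group \<Psi>)
  from path_functor_extension[OF pcS x0(1) Q.is_group \<Psi>]
  obtain \<phi>' w where \<phi>': "path_functor Q S \<phi>'"
    and \<phi>'\<Psi>': "\<forall>p. loop_at (top_of_set S) x0 p \<longrightarrow> \<phi>' p = \<Psi> (?cl p)"
    and w': "\<forall>y\<in>S. path_in S (w y) \<and> pathstart (w y) = x0 \<and> pathfinish (w y) = y"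
    and \<phi>'L: "\<forall>p. \<phi>' p = \<Psi> (?cl (w (pathstart p) +++ (p +++ reversepath (w (pathfinish p)))))"
    by (elim exE conjE)
  have \<phi>'\<Psi>: "\<phi>' p = \<Psi> (?cl p)" if "loop_at (top_of_set S) x0 p" for p using \<phi>'\<Psi>' that by blast
  note w = bspec[OF w']
  interpret \<phi>': path_functor Q S \<phi>' by (rule \<phi>')
  have local: "\<exists>\<rho>>0. ball c \<rho> \<subseteq> S' \<and>
      (\<forall>p. path_in (ball c \<rho> \<inter> S) p \<longrightarrow> pathfinish p = pathstart p \<longrightarrow> \<phi>' p = \<one>\<^bsub>Q\<^esub>)" if c: "c \<in> S'" for c
  proof -
    obtain \<rho> where \<rho>: "\<rho> > 0" "ball c \<rho> \<subseteq> S'" and \<rho>\<mu>: "\<forall>p k. path_in (ball c \<rho> \<inter> S) p \<longrightarrow> pathfinish p = pathstart p \<longrightarrow>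
       winding_number (lf l \<circ> p) 0 = of_int k \<longrightarrow> \<phi> p = \<mu> [^]\<^bsub>Q\<^esub> k"
      using \<mu>_local c by blast
    have "\<phi>' p = \<one>\<^bsub>Q\<^esub>" if p: "path_in (ball c \<rho> \<inter> S) p" "pathfinish p = pathstart p" for p
    proof -
      have pS: "path_in S p" using p(1) by (rule path_in_mono) simp
      define a where "a = w (pathstart p)"
      have a: "path_in S a" "pathstart a = x0" "pathfinish a = pathstart p"
        using w[OF path_in_ends(1)[OF pS]] by (auto simp: a_def)
      have pr: "path_in S (p +++ reversepath a)"
        using pS a p(2) by (intro path_in_join) (auto simp: path_in_reverse)
      define L where "L = a +++ (p +++ reversepath a)"
      have L: "loop_at (top_of_set S) x0 L"
        unfolding loopS L_def using pr a by (auto intro!: path_in_join)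
      obtain k where k: "winding_number (lf l \<circ> p) 0 = of_int k"
        using winding_lf_int[of "insert l A" p l] pS p(2) by (auto simp: S_def)
      have "wn L = of_int k"
        unfolding wn_def L_def
        using winding_lf_join[of "insert l A" a "p +++ reversepath a" l]
          winding_lf_join[of "insert l A" p "reversepath a" l] winding_lf_reverse[of "insert l A" a l]
          a p(2) pS pr k by (simp add: S_def path_in_reverse)
      then have NL: "N (?cl L) = k" by (rule N[OF L])
      have "q (?cl L) = \<phi> L" using \<phi>q[OF L] by simp
      also have "\<dots> = \<phi> a \<otimes>\<^bsub>Q\<^esub> (\<phi> p \<otimes>\<^bsub>Q\<^esub> inv\<^bsub>Q\<^esub> (\<phi> a))"
        unfolding L_def using a pS p(2) pr by (simp add: \<phi>.join path_in_reverse \<phi>.reverse)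
      also have "\<dots> = \<phi> p"
        using \<phi>.closed[OF a(1)] \<phi>.closed[OF pS] Q.m_lcomm[of "\<phi> a" "\<phi> p" "inv\<^bsub>Q\<^esub> \<phi> a"] by simp
      also have "\<dots> = \<mu> [^]\<^bsub>Q\<^esub> k" using \<rho>\<mu> p k by blast
      finally have "q (?cl L) = \<mu> [^]\<^bsub>Q\<^esub> k" .
      then have "\<Psi> (?cl L) = \<one>\<^bsub>Q\<^esub>" using \<mu> by (simp add: \<Psi>_def NL Q.int_pow_neg)
      then show ?thesis using \<phi>'L p(2) by (simp add: L_def a_def)
    qed
    then show ?thesis using \<rho> by blast
  qed
  have id: "continuous_map (top_of_set S) (top_of_set S') id" by (auto simp: S_eq)
  define \<iota> where "\<iota> = fundamental_group_map (top_of_set S') x0 id"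
  have \<iota>_hom: "\<iota> \<in> hom ?F ?F'" using hom_fundamental_group_map[OF id, of x0] by (simp add: \<iota>_def)
  interpret \<iota>: group_hom ?F ?F' \<iota> by (intro group_hom.intro group_hom_axioms.intro F.is_group F'.is_group \<iota>_hom)
  have \<iota>_cl: "\<iota> (?cl p) = ?cl' p" if "loop_at (top_of_set S) x0 p" for p
    using fundamental_group_map_loop_class[OF id that] by (simp add: \<iota>_def)
  have surj: "\<iota> ` carrier ?F = carrier ?F'"
  proof
    show "\<iota> ` carrier ?F \<subseteq> carrier ?F'" using \<iota>.hom_closed by blast
    show "carrier ?F' \<subseteq> \<iota> ` carrier ?F"
    proof
      fix y assume "y \<in> carrier ?F'"
      then obtain r where r: "y = ?cl' r" "loop_at (top_of_set S') x0 r" by (auto simp: carrier_fundamental_group)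
      then have r': "path_in S' r" "pathstart r = x0" "pathfinish r = x0" by (auto simp: loop_at_path_in)
      obtain r1 where r1: "path_in {x\<in>S'. lf l x \<noteq> 0} r1" "homotopic_paths S' r r1"
        using push_off_hyperplane[OF l oS(2) r'(1)] r' x0(1) by (auto simp: S_eq)
      have "loop_at (top_of_set S) x0 r1"
        using r1 r' homotopic_paths_imp_pathstart[OF r1(2)] homotopic_paths_imp_pathfinish[OF r1(2)]
        unfolding loopS unfolding S_eq by simp
      moreover have "?cl' r = ?cl' r1"
        by (rule loop_class_eqI) (use r1 r' in \<open>simp add: homotopic_loops_at_top_of_set\<close>)
      ultimately show "y \<in> \<iota> ` carrier ?F" using r(1) \<iota>_cl[of r1] by (auto simp: carrier_fundamental_group)
    qed
  qed
  have p: "loop_at (top_of_set S) x0 p" using insert.prems by (simp add: S_def)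
  have pF: "?cl p \<in> carrier ?F" using p by (auto simp: carrier_fundamental_group)
  have "loop_at (top_of_set S') x0 p" using p by (auto simp: loop_at_path_in S_eq path_in_def)
  then have "?cl' p \<in> derived ?F' (carrier ?F')"
    unfolding S'_def using insert.IH[of p] A0 x0 insert.prems by (simp add: S'_def)
  also have "derived ?F' (carrier ?F') = \<iota> ` D"
    unfolding D_def surj[symmetric] by (rule \<iota>.derived_img) simp
  finally obtain d where d: "d \<in> D" "\<iota> d = ?cl' p" by auto
  have dF: "d \<in> carrier ?F" using d(1) D.subset by blast
  define x where "x = ?cl p \<otimes>\<^bsub>?F\<^esub> inv\<^bsub>?F\<^esub> d"
  have xF: "x \<in> carrier ?F" using pF dF by (simp add: x_def)
  have "\<iota> x = \<one>\<^bsub>?F'\<^esub>" using pF dF d(2) \<iota>_cl[OF p] \<iota>.hom_closed[OF dF] by (simp add: x_def)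
  moreover obtain c where c: "x = ?cl c" "loop_at (top_of_set S) x0 c" using xF by (auto simp: carrier_fundamental_group)
  ultimately have "?cl' c = ?cl' (\<lambda>_. x0)" using \<iota>_cl[OF c(2)] by (simp add: one_fundamental_group)
  moreover have cS': "loop_at (top_of_set S') x0 c" using c(2) by (auto simp: loop_at_path_in S_eq path_in_def)
  ultimately have "homotopic_loops_at (top_of_set S') x0 c (\<lambda>_. x0)"
    using loop_class_eq_iff[OF cS' loop_at_const] x0 by simp
  then have null: "homotopic_paths S' c (linepath x0 x0)" by (simp add: homotopic_loops_at_top_of_set linepath_refl)
  have "\<phi>' c = \<one>\<^bsub>Q\<^esub>"
  proof (rule \<phi>'.null_homotopic_killed[OF oS(2) _ _ _ local _ _ _ null])
    show "S \<subseteq> S'" by (auto simp: S_eq)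
    show "\<exists>y\<in>S. dist z y < r" if z: "z \<in> S'" "r > 0" for z r
    proof -
      obtain r0 where r0: "r0 > 0" "ball z r0 \<subseteq> S'" using oS(2) z open_contains_ball by blast
      obtain y where "dist z y < min r r0" "lf l y \<noteq> 0" using lf_nonzero_dense[OF l, of "min r r0" z] r0 z by auto
      then show ?thesis using r0 by (auto simp: S_eq subset_iff)
    qed
    show "path_connected (ball z r \<inter> S)" for z r
      unfolding S_def using insert.hyps by (intro path_connected_open_convex_minus_hyperplanes) auto
  qed (use c(2) in \<open>auto simp: loopS\<close>)
  then have "\<Psi> x = \<one>\<^bsub>Q\<^esub>" using \<phi>'\<Psi>[OF c(2)] c(1) by simp
  moreover have "\<Psi> d = \<one>\<^bsub>Q\<^esub>"
  proof -
    have "\<Psi> ` D = derived Q (\<Psi> ` carrier ?F)" unfolding D_def by (rule \<Psi>h.derived_img[symmetric]) simp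
    also have "\<dots> = {\<one>\<^bsub>Q\<^esub>}" by (rule Q.derived_eq_singleton) (use \<Psi>h.hom_closed in blast)
    finally show ?thesis using d(1) by blast
  qed
  moreover have "?cl p = x \<otimes>\<^bsub>?F\<^esub> d" using pF dF by (simp add: x_def F.m_assoc)
  ultimately have "\<Psi> (?cl p) = \<one>\<^bsub>Q\<^esub>" using xF dF by simp
  moreover have "N (?cl p) = 0" 
    by (rule N[OF p]) (simp only: wn_def insert.prems(4)[OF insertI1] of_int_0)
  ultimately have "q (?cl p) = \<one>\<^bsub>Q\<^esub>"
    using q pF by (simp add: \<Psi>_def hom_def Pi_iff)
  then have "D #>\<^bsub>?F\<^esub> ?cl p = D" by (simp add: q_def Q_def FactGroup_def)
  then have "?cl p \<in> D" using F.coset_join1[OF _ pF] D.subgroup_axioms F.rcos_self[OF pF D.subgroup_axioms] by simp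
  then show ?case by (simp add: D_def S_def)
qed

section \<open>Complex reflection groups\<close>

lemma group_GL: "group (GL :: (complex^'n^'n) monoid)"
proof (rule groupI)
  fix x :: "complex^'n^'n"
  assume "x \<in> carrier GL"
  then obtain y where "x ** y = mat 1" "y ** x = mat 1" by (auto simp: GL_def invertible_def)
  then show "\<exists>y\<in>carrier GL. y \<otimes>\<^bsub>GL\<^esub> x = \<one>\<^bsub>GL\<^esub>"
    by (intro bexI[of _ y]) (auto simp: GL_def invertible_def)
qed (auto simp: GL_def invertible_mult matrix_mul_assoc, auto simp: invertible_def intro: exI[of _ "mat 1"])

lemma inv_GL:
  assumes "A \<in> carrier (GL :: (complex^'n^'n) monoid)"
  shows "inv\<^bsub>GL\<^esub> A ** A = mat 1" "A ** inv\<^bsub>GL\<^esub> A = mat 1"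
proof -
  interpret group GL by (rule group_GL)
  show "inv\<^bsub>GL\<^esub> A ** A = mat 1" "A ** inv\<^bsub>GL\<^esub> A = mat 1"
    using l_inv[OF assms] r_inv[OF assms] by (simp_all add: GL_def)
qed

lemma reflection_inverse:
  assumes r: "is_reflection r" and s: "s ** r = mat 1" "r ** s = mat 1"
  shows "is_reflection s"
proof -
  obtain H where H: "hyperplane H" "fixes_pointwise r H" using r unfolding is_reflection_def by blast
  have "s *v x = x" if "x \<in> H" for x
  proof -
    have "s *v x = s *v (r *v x)" using H(2) that by (simp add: fixes_pointwise_def)
    then show ?thesis by (simp add: matrix_vector_mul_assoc s)
  qed
  moreover have "s \<noteq> mat 1" using s r by (auto simp: is_reflection_def)
  ultimately show ?thesis using s H(1) by (auto simp: is_reflection_def fixes_pointwise_def invertible_def)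
qed

lemma complex_reflection_group_locale:
  assumes W: "complex_reflection_group W"
  shows "reflection_group W"
proof
  have sub: "subgroup W GL" and gen: "W = generate GL {r \<in> W. is_reflection r}"
    using W by (auto simp: complex_reflection_group_def)
  show "finite W" using W by (simp add: complex_reflection_group_def)
  show one: "mat 1 \<in> W" using subgroup.one_closed[OF sub] by (simp add: GL_def)
  show mult: "A ** B \<in> W" if "A \<in> W" "B \<in> W" for A B
    using subgroup.m_closed[OF sub that] by (simp add: GL_def)
  have car: "W \<subseteq> carrier GL" using subgroup.subset[OF sub] .
  show inv: "\<exists>B\<in>W. B ** A = mat 1 \<and> A ** B = mat 1" if "A \<in> W" for A
    using inv_GL[of A] subgroup.m_inv_closed[OF sub that] car that by blast
  fix Q w assume w: "w \<in> W" and Q1: "Q (mat 1)"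
    and Qs: "\<And>r w. r \<in> W \<Longrightarrow> is_reflection r \<Longrightarrow> w \<in> W \<Longrightarrow> Q w \<Longrightarrow> Q (r ** w)"
  have "\<forall>u\<in>W. Q u \<longrightarrow> Q (g ** u)" if "g \<in> generate GL {r \<in> W. is_reflection r}" for g
    using that
  proof (induction rule: generate.induct)
    case one
    show ?case by (simp add: GL_def)
  next
    case (incl h)
    then show ?case using Qs by blast
  next
    case (inv h)
    have "h \<in> carrier GL" using inv car by blast
    then have "is_reflection (inv\<^bsub>GL\<^esub> h)" using reflection_inverse[of h "inv\<^bsub>GL\<^esub> h"] inv_GL inv by blast
    moreover have "inv\<^bsub>GL\<^esub> h \<in> W" using subgroup.m_inv_closed[OF sub] inv by blast
    ultimately show ?case using Qs by blast
  next
    case (eng h1 h2)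
    show ?case
    proof (intro ballI impI)
      fix u assume u: "u \<in> W" "Q u"
      have "h2 \<in> W" using eng.hyps gen by simp
      then have "h2 ** u \<in> W" "Q (h2 ** u)" using u mult eng.IH by auto
      then have "Q (h1 ** (h2 ** u))" using eng.IH by blast
      then show "Q (h1 \<otimes>\<^bsub>GL\<^esub> h2 ** u)" by (simp add: GL_def matrix_mul_assoc)
    qed
  qed
  then have "Q (w ** mat 1)" using w gen one Q1 by blast
  then show "Q w" by simp
qed

context reflection_group
begin

text \<open>
  A reflecting hyperplane is the full fixed space of any of its reflections, so there are only
  finitely many.
\<close>

lemma reflecting_hyperplane_form:
  assumes "H \<in> reflecting_hyperplanes W"
  obtains l r where "l \<noteq> 0" "H = {x. lf l x = 0}" "r \<in> W" "r \<noteq> mat 1" "H = {x. r *v x = x}"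
proof -
  obtain r where r: "r \<in> W" "is_reflection r" "fixes_pointwise r H" "hyperplane H"
    using assms by (auto simp: reflecting_hyperplanes_def)
  obtain l a where l: "l \<noteq> 0" "H = {x. lf l x = 0}" "\<forall>x. r *v x = x + lf l x *s a"
    using reflection_form[OF r(2,4,3)] by (elim exE conjE)
  have r1: "r \<noteq> mat 1" using r(2) by (simp add: is_reflection_def)
  have "a \<noteq> 0"
  proof
    assume "a = 0"
    then have "r *v x = mat 1 *v x" for x using l(3) by simp
    then show False using r1 by (metis matrix_eq)
  qed
  then have "H = {x. r *v x = x}" unfolding l(2) using l(3) by simp
  then show ?thesis using that l(1,2) r(1) r1 by blast
qed

lemma finite_reflecting_hyperplanes: "finite (reflecting_hyperplanes W)"
proof (rule finite_subset)
  show "reflecting_hyperplanes W \<subseteq> (\<lambda>r. {x. r *v x = x}) ` W"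
    using reflecting_hyperplane_form by blast
qed (simp add: finite_W)

lemma arrangement_exists:
  "\<exists>A. finite A \<and> 0 \<notin> A \<and> hyperplane_complement W = arr_complement A \<and>
     (\<forall>H\<in>reflecting_hyperplanes W. \<exists>l\<in>A. H = {x. lf l x = 0})"
proof -
  have "\<forall>H\<in>reflecting_hyperplanes W. \<exists>l. l \<noteq> 0 \<and> H = {x. lf l x = 0}"
    using reflecting_hyperplane_form by blast
  from bchoice[OF this] obtain f where f: "\<forall>H\<in>reflecting_hyperplanes W. f H \<noteq> 0 \<and> H = {x. lf (f H) x = 0}"
    by (elim exE)
  have ker: "H = {x. lf (f H) x = 0}" if "H \<in> reflecting_hyperplanes W" for H
    using bspec[OF f that] by (rule conjunct2)
  have mem: "x \<in> H \<longleftrightarrow> lf (f H) x = 0" if "H \<in> reflecting_hyperplanes W" for H x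
    by (subst ker[OF that]) simp
  have "hyperplane_complement W = arr_complement (f ` reflecting_hyperplanes W)"
    unfolding hyperplane_complement_def arr_complement_def by (auto simp: mem)
  moreover have "\<forall>H\<in>reflecting_hyperplanes W. \<exists>l\<in>f ` reflecting_hyperplanes W. H = {x. lf l x = 0}"
    using ker by blast
  moreover have "0 \<notin> f ` reflecting_hyperplanes W"
  proof
    assume "0 \<in> f ` reflecting_hyperplanes W"
    then obtain H where "H \<in> reflecting_hyperplanes W" "f H = 0" by (metis imageE)
    then show False using bspec[OF f, of H] by simp
  qed
  ultimately show ?thesis using finite_reflecting_hyperplanes
    by (intro exI[of _ "f ` reflecting_hyperplanes W"] conjI finite_imageI)
qed

text \<open>
  One inclusion is the theorem of Steinberg; the other holds because a reflection fixes every
  point of its hyperplane.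
\<close>

lemma hyperplane_complement_eq_free_points: "hyperplane_complement W = free_points"
proof
  show "hyperplane_complement W \<subseteq> free_points"
    using steinberg by (auto simp: free_points_def)
  show "free_points \<subseteq> hyperplane_complement W"
  proof
    fix x assume x: "x \<in> free_points"
    have "x \<notin> H" if "H \<in> reflecting_hyperplanes W" for H
    proof (rule reflecting_hyperplane_form[OF that])
      fix r assume "r \<in> W" "r \<noteq> mat 1" "H = {x. r *v x = x}"
      then show "x \<notin> H" using x by (simp add: free_points_def)
    qed
    then show "x \<in> hyperplane_complement W" by (auto simp: hyperplane_complement_def)
  qed
qed

lemma free_points_act:
  assumes w: "w \<in> W" and x: "x \<in> free_points" shows "w *v x \<in> free_points"
  unfolding free_points_def
proof (intro CollectI ballI impI notI)
  fix u assume u: "u \<in> W" "u \<noteq> mat 1" "u *v (w *v x) = w *v x"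
  have "u ** w = w"
    by (rule free_points_cancel[OF x mult_W[OF u(1) w] w])
      (use u(3) in \<open>simp add: matrix_vector_mul_assoc\<close>)
  then show False using left_unit_W[OF w] u(2) by blast
qed

section \<open>The covering of the orbit space\<close>

lemma orbit_of_act: "w \<in> W \<Longrightarrow> orbit_of W (w *v x) = orbit_of W x"
proof -
  assume w: "w \<in> W"
  have "(\<lambda>u. u *v (w *v x)) ` W = (\<lambda>u. u *v x) ` ((\<lambda>u. u ** w) ` W)"
    by (auto simp: image_image matrix_vector_mul_assoc)
  then show ?thesis using bij_betw_mult_right[OF w] by (simp add: orbit_of_def bij_betw_def)
qed

lemma mem_orbit_self: "x \<in> orbit_of W x"
  unfolding orbit_of_def using one_W by (intro image_eqI[of _ _ "mat 1"]) auto

lemma finite_orbit: "finite (orbit_of W x)"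
  using finite_W by (simp add: orbit_of_def)

lemma orbit_eqD: "orbit_of W x = orbit_of W y \<Longrightarrow> \<exists>w\<in>W. x = w *v y"
  using mem_orbit_self[of x] by (auto simp: orbit_of_def)

text \<open>
  An orbit is encoded by its distance function, which becomes bounded after subtracting the norm.
  The supremum norm then is the Hausdorff distance between orbits, so this embeds the orbit space
  into a Banach space, where the theorems on lifting paths and homotopies through coverings apply.
\<close>

definition orbit_code :: "(complex^'n) set \<Rightarrow> (complex^'n) \<Rightarrow>\<^sub>C real" where
  "orbit_code S = Bcontfun (\<lambda>y. infdist y S - norm y)"

lemma orbit_code_apply:
  assumes "finite S" "S \<noteq> {}"
  shows "apply_bcontfun (orbit_code S) y = infdist y S - norm y"
proof -
  obtain a where a: "a \<in> S" using assms by blast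
  obtain R where R: "\<And>s. s \<in> S \<Longrightarrow> norm s \<le> R" using finite_imp_bounded[OF assms(1)] bounded_iff by metis
  have "(\<lambda>y. infdist y S - norm y) \<in> bcontfun"
  proof (rule bcontfun_normI)
    show "continuous_on UNIV (\<lambda>y. infdist y S - norm y)" by (intro continuous_intros)
    fix y
    obtain s where s: "s \<in> S" "infdist y S = dist y s"
      using infdist_attains_inf[OF finite_imp_closed[OF assms(1)] assms(2)] by blast
    have "\<bar>dist y s - norm y\<bar> \<le> norm s"
      using norm_triangle_ineq4[of y s] norm_triangle_ineq2[of y s] by (simp add: dist_norm abs_le_iff)
    then show "norm (infdist y S - norm y) \<le> R" using R[OF s(1)] s(2) by simp
  qed
  then show ?thesis by (simp add: orbit_code_def Bcontfun_inverse)
qed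

definition orbit_map :: "complex^'n \<Rightarrow> (complex^'n) \<Rightarrow>\<^sub>C real" where
  "orbit_map z = orbit_code (orbit_of W z)"

lemma orbit_map_apply: "apply_bcontfun (orbit_map z) y = infdist y (orbit_of W z) - norm y"
  unfolding orbit_map_def by (rule orbit_code_apply[OF finite_orbit]) (use mem_orbit_self in blast)

lemma orbit_map_act: "w \<in> W \<Longrightarrow> orbit_map (w *v z) = orbit_map z"
  by (simp add: orbit_map_def orbit_of_act)

lemma infdist_orbit_attained: "\<exists>w\<in>W. infdist y (orbit_of W z) = dist y (w *v z)"
proof -
  have "orbit_of W z \<noteq> {}" using mem_orbit_self by blast
  then obtain s where "s \<in> orbit_of W z" "infdist y (orbit_of W z) = dist y s"
    using infdist_attains_inf[OF finite_imp_closed[OF finite_orbit]] by blast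
  then show ?thesis by (auto simp: orbit_of_def)
qed

text \<open>The supremum is at least the value at \<open>z\<close>, where the first distance function vanishes.\<close>

lemma orbit_map_dist: "\<exists>w\<in>W. dist z (w *v z') \<le> dist (orbit_map z) (orbit_map z')"
proof -
  obtain w where w: "w \<in> W" "infdist z (orbit_of W z') = dist z (w *v z')"
    using infdist_orbit_attained by blast
  have "dist (apply_bcontfun (orbit_map z) z) (apply_bcontfun (orbit_map z') z) \<le> dist (orbit_map z) (orbit_map z')"
    by (rule dist_bounded)
  then show ?thesis using w mem_orbit_self[of z] by (auto simp: orbit_map_apply dist_real_def intro!: bexI[of _ w])
qed

lemma orbit_map_eqD: "orbit_map z = orbit_map z' \<Longrightarrow> \<exists>w\<in>W. z = w *v z'"
  using orbit_map_dist[of z z'] by auto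

lemma continuous_orbit_map: "continuous_on UNIV orbit_map"
  unfolding continuous_on_iff
proof (intro ballI allI impI)
  fix z :: "complex^'n" and \<epsilon> :: real assume \<epsilon>: "\<epsilon> > 0"
  have "\<forall>\<^sub>F z' in nhds z. dist (w *v z) (w *v z') < \<epsilon> / 2" for w :: "complex^'n^'n"
  proof -
    have "continuous_on UNIV (\<lambda>x. w *v x)" by (intro continuous_intros)
    then have "isCont (\<lambda>x. w *v x) z" by (simp add: continuous_on_eq_continuous_at)
    then have "((\<lambda>x. w *v x) \<longlongrightarrow> w *v z) (nhds z)" by (simp add: isCont_def tendsto_at_iff_tendsto_nhds)
    then show ?thesis using \<epsilon> by (auto dest!: tendstoD[where e = "\<epsilon> / 2"] simp: dist_commute)
  qed
  then have "\<forall>\<^sub>F z' in nhds z. \<forall>w\<in>W. dist (w *v z) (w *v z') < \<epsilon> / 2"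
    using finite_W by (simp add: eventually_ball_finite)
  then obtain \<delta> where \<delta>: "\<delta> > 0" "\<And>z' w. dist z' z < \<delta> \<Longrightarrow> w \<in> W \<Longrightarrow> dist (w *v z) (w *v z') < \<epsilon> / 2"
    unfolding eventually_nhds_metric by blast
  have "dist (orbit_map z') (orbit_map z) < \<epsilon>" if z': "dist z' z < \<delta>" for z'
  proof -
    have "dist (orbit_map z') (orbit_map z) \<le> \<epsilon> / 2"
    proof (rule dist_bound)
      fix y
      obtain w where w: "w \<in> W" "infdist y (orbit_of W z) = dist y (w *v z)"
        using infdist_orbit_attained by blast
      obtain w' where w': "w' \<in> W" "infdist y (orbit_of W z') = dist y (w' *v z')"
        using infdist_orbit_attained by blast
      have "infdist y (orbit_of W z') \<le> dist y (w *v z')" "infdist y (orbit_of W z) \<le> dist y (w' *v z)"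
        using w(1) w'(1) by (auto intro!: infdist_le simp: orbit_of_def)
      moreover have "dist y (w *v z') \<le> dist y (w *v z) + dist (w *v z) (w *v z')" by (rule dist_triangle)
      moreover have "dist y (w' *v z) \<le> dist y (w' *v z') + dist (w' *v z') (w' *v z)" by (rule dist_triangle)
      moreover have "dist (w *v z) (w *v z') < \<epsilon> / 2" "dist (w' *v z') (w' *v z) < \<epsilon> / 2"
        using \<delta>(2)[OF z' w(1)] \<delta>(2)[OF z' w'(1)] by (simp_all add: dist_commute)
      ultimately have "\<bar>infdist y (orbit_of W z') - infdist y (orbit_of W z)\<bar> \<le> \<epsilon> / 2"
        using w(2) w'(2) by linarith
      then show "dist (apply_bcontfun (orbit_map z') y) (apply_bcontfun (orbit_map z) y) \<le> \<epsilon> / 2"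
        by (simp add: orbit_map_apply dist_real_def)
    qed
    then show ?thesis using \<epsilon> by simp
  qed
  then show "\<exists>d>0. \<forall>x'\<in>UNIV. dist x' z < d \<longrightarrow> dist (orbit_map x') (orbit_map z) < \<epsilon>" using \<delta>(1) by blast
qed

lemma open_free_points: "open free_points"
proof -
  obtain A where "finite A" "hyperplane_complement W = arr_complement A" using arrangement_exists by blast
  then show ?thesis using open_arr_complement hyperplane_complement_eq_free_points by metis
qed

lemma orbit_map_open:
  assumes U: "open U" "U \<subseteq> free_points"
  shows "openin (top_of_set (orbit_map ` free_points)) (orbit_map ` U)"
  unfolding openin_euclidean_subtopology_iff
proof (intro conjI ballI)
  show "orbit_map ` U \<subseteq> orbit_map ` free_points" using U by blast
  fix q assume "q \<in> orbit_map ` U"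
  then obtain z where z: "z \<in> U" "q = orbit_map z" by blast
  obtain \<epsilon> where \<epsilon>: "\<epsilon> > 0" "ball z \<epsilon> \<subseteq> U" using U(1) z open_contains_ball by blast
  have "q' \<in> orbit_map ` U" if q': "q' \<in> orbit_map ` free_points" "dist q' q < \<epsilon>" for q'
  proof -
    obtain z' where z': "q' = orbit_map z'" using q' by blast
    obtain w where w: "w \<in> W" "dist z (w *v z') \<le> dist (orbit_map z) (orbit_map z')" using orbit_map_dist by blast
    then have "w *v z' \<in> U" using \<epsilon>(2) q'(2) z z' by (auto simp: dist_commute)
    then show ?thesis using orbit_map_act[OF w(1), of z'] z' by (metis image_eqI)
  qed
  then show "\<exists>e>0. \<forall>x'\<in>orbit_map ` free_points. dist x' q < e \<longrightarrow> x' \<in> orbit_map ` U" using \<epsilon>(1) by blast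
qed

text \<open>Each of the finitely many nontrivial elements moves a small neighbourhood of \<open>z\<close> off itself.\<close>

lemma displacement: assumes z: "z \<in> free_points"
  obtains B where "open B" "z \<in> B" "B \<subseteq> free_points" "\<And>w x. w \<in> W \<Longrightarrow> x \<in> B \<Longrightarrow> w *v x \<in> B \<Longrightarrow> w = mat 1"
proof -
  have "\<forall>w\<in>W. \<exists>U. open U \<and> z \<in> U \<and> (w \<noteq> mat 1 \<longrightarrow> (\<forall>x\<in>U. w *v x \<notin> U))"
  proof
    fix w assume w: "w \<in> W"
    show "\<exists>U. open U \<and> z \<in> U \<and> (w \<noteq> mat 1 \<longrightarrow> (\<forall>x\<in>U. w *v x \<notin> U))"
    proof (cases "w = mat 1")
      case False
      then have "w *v z \<noteq> z" using z w by (auto simp: free_points_def)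
      then obtain U V where UV: "open U" "open V" "w *v z \<in> U" "z \<in> V" "U \<inter> V = {}"
        using separation_t2 by metis
      have "continuous_on UNIV (\<lambda>x. w *v x)" by (intro continuous_intros)
      then have "open ((\<lambda>x. w *v x) -` U)" using UV(1) open_vimage by blast
      then show ?thesis using UV by (intro exI[of _ "V \<inter> (\<lambda>x. w *v x) -` U"]) auto
    qed (auto intro: exI[of _ UNIV])
  qed
  from bchoice[OF this] obtain U where U: "\<forall>w\<in>W. open (U w) \<and> z \<in> U w \<and> (w \<noteq> mat 1 \<longrightarrow> (\<forall>x\<in>U w. w *v x \<notin> U w))"
    by (elim exE)
  show ?thesis
  proof (rule that[of "free_points \<inter> (\<Inter>w\<in>W. U w)"])
    show "open (free_points \<inter> (\<Inter>w\<in>W. U w))" using U finite_W open_free_points by auto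
  qed (use U z in auto)
qed

text \<open>The sheets over the image of a neighbourhood \<open>B\<close> as in \<open>displacement\<close> are the translates of \<open>B\<close>.\<close>

lemma covering_orbit_map: "covering_space free_points orbit_map (orbit_map ` free_points)"
  unfolding covering_space_def
proof (intro conjI ballI refl)
  show contX: "continuous_on free_points orbit_map" using continuous_orbit_map continuous_on_subset by blast
  fix q assume "q \<in> orbit_map ` free_points"
  then obtain z where z: "z \<in> free_points" "q = orbit_map z" by blast
  obtain B where B: "open B" "z \<in> B" "B \<subseteq> free_points"
    and disp: "\<And>w x. w \<in> W \<Longrightarrow> x \<in> B \<Longrightarrow> w *v x \<in> B \<Longrightarrow> w = mat 1"
    by (rule displacement[OF z(1)]) blast
  define T where "T = orbit_map ` B"
  define wB where "wB w = (\<lambda>x. w *v x) ` B" for w :: "complex^'n^'n"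
  have open_wB: "open (wB w)" if w: "w \<in> W" for w
  proof -
    obtain v where v: "v \<in> W" "v ** w = mat 1" "w ** v = mat 1" using inv_W w by blast
    have "wB w = (\<lambda>x. v *v x) -` B"
    proof
      show "wB w \<subseteq> (\<lambda>x. v *v x) -` B" by (auto simp: wB_def matrix_vector_mul_assoc v)
      show "(\<lambda>x. v *v x) -` B \<subseteq> wB w"
      proof
        fix x assume "x \<in> (\<lambda>x. v *v x) -` B"
        then have "v *v x \<in> B" "w *v (v *v x) = x" by (simp_all add: matrix_vector_mul_assoc v)
        then show "x \<in> wB w" unfolding wB_def by (metis image_eqI)
      qed
    qed
    moreover have "continuous_on UNIV (\<lambda>x. v *v x)" by (intro continuous_intros)
    ultimately show ?thesis using B(1) open_vimage by metis
  qed
  have wB_free: "wB w \<subseteq> free_points" if "w \<in> W" for w using free_points_act[OF that] B(3) by (auto simp: wB_def)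
  have im: "orbit_map ` wB w = T" if "w \<in> W" for w
    using orbit_map_act[OF that] by (auto simp: wB_def T_def image_image)
  have oT: "openin (top_of_set (orbit_map ` free_points)) T" unfolding T_def by (rule orbit_map_open[OF B(1,3)])
  have cancel: "w = u" if wu: "w \<in> W" "u \<in> W" "x \<in> B" "y \<in> B" "w *v x = u *v y" for w u x y
    using transporter[OF wu(1,2,5)] disp wu(3,4) by blast
  have "\<exists>h. homeomorphism (wB w) T orbit_map h" if w: "w \<in> W" for w
  proof -
    have inj: "inj_on orbit_map (wB w)"
    proof (rule inj_onI)
      fix x y assume xy: "x \<in> wB w" "y \<in> wB w" "orbit_map x = orbit_map y"
      obtain u where u: "u \<in> W" "x = u *v y" using orbit_map_eqD[OF xy(3)] by blast
      obtain a b where ab: "a \<in> B" "b \<in> B" "x = w *v a" "y = w *v b" using xy by (auto simp: wB_def)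
      have "w = u ** w" by (rule cancel[OF w mult_W[OF u(1) w] ab(1,2)]) (use u ab in \<open>simp add: matrix_vector_mul_assoc\<close>)
      then show "x = y" using u(2) ab(4) by (simp add: matrix_vector_mul_assoc)
    qed
    have oo: "openin (top_of_set T) (orbit_map ` U)" if U: "openin (top_of_set (wB w)) U" for U
    proof -
      have "open U" "U \<subseteq> wB w" using U open_wB[OF w] openin_open_eq by blast+
      then have "openin (top_of_set (orbit_map ` free_points)) (orbit_map ` U)"
        using wB_free[OF w] by (intro orbit_map_open) auto
      moreover have "orbit_map ` U \<subseteq> T" using im[OF w] \<open>U \<subseteq> wB w\<close> by blast
      moreover have "T \<subseteq> orbit_map ` free_points" using B(3) by (auto simp: T_def)
      ultimately show ?thesis using openin_subset_trans by blast
    qed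
    show ?thesis
      using homeomorphism_injective_open_map[OF continuous_on_subset[OF contX wB_free[OF w]] im[OF w] inj oo] by blast
  qed
  moreover have "\<Union> (wB ` W) = free_points \<inter> orbit_map -` T"
  proof
    show "\<Union> (wB ` W) \<subseteq> free_points \<inter> orbit_map -` T" using wB_free im by blast
    show "free_points \<inter> orbit_map -` T \<subseteq> \<Union> (wB ` W)"
    proof
      fix y assume "y \<in> free_points \<inter> orbit_map -` T"
      then obtain b where b: "b \<in> B" "orbit_map y = orbit_map b" by (auto simp: T_def)
      then obtain w where "w \<in> W" "y = w *v b" using orbit_map_eqD by blast
      then show "y \<in> \<Union> (wB ` W)" using b(1) by (auto simp: wB_def)
    qed
  qed
  moreover have "pairwise disjnt (wB ` W)"
  proof (rule pairwiseI)
    fix S S' assume S: "S \<in> wB ` W" "S' \<in> wB ` W" "S \<noteq> S'"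
    then obtain w u where wu: "w \<in> W" "u \<in> W" "S = wB w" "S' = wB u" by blast
    show "disjnt S S'"
    proof (rule ccontr)
      assume "\<not> disjnt S S'"
      then obtain p where "p \<in> wB w" "p \<in> wB u" using wu by (auto simp: disjnt_def)
      then obtain x y where "x \<in> B" "y \<in> B" "w *v x = u *v y" unfolding wB_def by (elim imageE) metis
      then show False using cancel[OF wu(1,2)] wu(3,4) S(3) by blast
    qed
  qed
  moreover have "\<forall>u\<in>wB ` W. openin (top_of_set free_points) u"
    using open_wB wB_free open_free_points by (simp add: openin_open_eq)
  moreover have "q \<in> T" using z B by (simp add: T_def)
  ultimately show "\<exists>T. q \<in> T \<and> openin (top_of_set (orbit_map ` free_points)) T \<and>
      (\<exists>v. \<Union>v = free_points \<inter> orbit_map -` T \<and> (\<forall>u\<in>v. openin (top_of_set free_points) u) \<and>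
        pairwise disjnt v \<and> (\<forall>u\<in>v. Ex (homeomorphism u T orbit_map)))"
    using oT by (intro exI[of _ T] conjI exI[of _ "wB ` W"]) auto
qed

end

section \<open>Braids as paths upstairs\<close>

locale braid_setup = reflection_group W for W :: "(complex^'n^'n) set" +
  fixes x0 :: "complex^'n"
  assumes x0: "x0 \<in> hyperplane_complement W"
begin

abbreviation "X \<equiv> hyperplane_complement W"
abbreviation "B \<equiv> braid_group W x0"
abbreviation "P \<equiv> pure_braid_group W x0"

lemma X_free: "X = free_points" by (rule hyperplane_complement_eq_free_points)

lemma X_act: "w \<in> W \<Longrightarrow> x \<in> X \<Longrightarrow> w *v x \<in> X"
  using free_points_act by (simp add: X_free)

lemma topspace_orbit_space: "topspace (orbit_space W) = orbit_of W ` X"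
  by (simp add: orbit_space_def topspace_quotient_topology)

lemma continuous_orbit_of: "continuous_map (top_of_set X) (orbit_space W) (orbit_of W)"
  unfolding orbit_space_def by (rule quotient_imp_continuous_map[OF quotient_map_quotient_topology])

lemma continuous_orbit_code:
  "continuous_map (orbit_space W) (top_of_set (orbit_map ` X)) orbit_code"
  unfolding orbit_space_def
proof (rule continuous_compose_quotient_map[OF quotient_map_quotient_topology])
  have "orbit_code \<circ> orbit_of W = orbit_map" by (auto simp: orbit_map_def)
  moreover have "continuous_on X orbit_map" using continuous_orbit_map continuous_on_subset by blast
  ultimately show "continuous_map (top_of_set X) (top_of_set (orbit_map ` X)) (orbit_code \<circ> orbit_of W)"
    by auto
qed

lemma group_B: "group B"
  unfolding braid_group_def by (rule group_fundamental_group) (use x0 in \<open>simp add: topspace_orbit_space\<close>)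

lemma group_P: "group P"
  unfolding pure_braid_group_def by (rule group_fundamental_group) (use x0 in simp)

text \<open>
  A braid over \<open>w\<close> is handled through its lift to the complement, a path from the base point to
  its translate by \<open>w\<close>. Composition of braids becomes concatenation with a translate
  (\<open>braid_of_mult\<close>).
\<close>

definition lifted_braids :: "complex^'n^'n \<Rightarrow> (real \<Rightarrow> complex^'n) set" where
  "lifted_braids w = {g. path_in X g \<and> pathstart g = x0 \<and> pathfinish g = w *v x0}"

definition braid_of :: "(real \<Rightarrow> complex^'n) \<Rightarrow> (real \<Rightarrow> (complex^'n) set) set" where
  "braid_of g = loop_class (orbit_space W) (orbit_of W x0) (orbit_of W \<circ> g)"

lemma lifted_braid_loop:
  assumes w: "w \<in> W" and g: "g \<in> lifted_braids w"
  shows "loop_at (orbit_space W) (orbit_of W x0) (orbit_of W \<circ> g)"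
proof -
  have "pathin (top_of_set X) g" using g
    by (auto simp: lifted_braids_def path_in_def pathin_def path_def path_image_def)
  then have "pathin (orbit_space W) (orbit_of W \<circ> g)"
    unfolding pathin_def using continuous_orbit_of continuous_map_compose by blast
  then show ?thesis using g orbit_of_act[OF w]
    by (simp add: loop_at_def lifted_braids_def pathstart_def pathfinish_def)
qed

lemma braid_of_carrier: "w \<in> W \<Longrightarrow> g \<in> lifted_braids w \<Longrightarrow> braid_of g \<in> carrier B"
  using lifted_braid_loop by (auto simp: braid_group_def carrier_fundamental_group braid_of_def)

text \<open>The loop is lifted through the embedding of the orbit space by \<open>orbit_code\<close>.\<close>

lemma lift_braid:
  assumes p: "loop_at (orbit_space W) (orbit_of W x0) p"
  shows "\<exists>w\<in>W. \<exists>g\<in>lifted_braids w. \<forall>t\<in>{0..1}. orbit_of W (g t) = p t"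
proof -
  have pp: "pathin (orbit_space W) p" "p 0 = orbit_of W x0" "p 1 = orbit_of W x0" using p by (auto simp: loop_at_def)
  have "pathin (top_of_set (orbit_map ` X)) (orbit_code \<circ> p)"
    using pp(1) continuous_orbit_code continuous_map_compose unfolding pathin_def by blast
  then have c: "path (orbit_code \<circ> p)" "path_image (orbit_code \<circ> p) \<subseteq> orbit_map ` free_points"
    by (auto simp: pathin_def path_def path_image_def X_free Pi_iff)
  have s: "pathstart (orbit_code \<circ> p) = orbit_map x0" using pp by (simp add: pathstart_def orbit_map_def)
  have x0f: "x0 \<in> free_points" using x0 by (simp add: X_free)
  obtain g where g: "path g" "path_image g \<subseteq> free_points" "pathstart g = x0"
    "\<And>t. t \<in> {0..1} \<Longrightarrow> orbit_map (g t) = (orbit_code \<circ> p) t"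
    using covering_space_lift_path_strong[OF covering_orbit_map x0f c s] by blast
  have gp: "orbit_of W (g t) = p t" if t: "t \<in> {0..1}" for t
  proof -
    have "p t \<in> topspace (orbit_space W)" using pp(1) t unfolding pathin_def continuous_map_def by auto
    then obtain z where z: "p t = orbit_of W z" using topspace_orbit_space by auto
    then have "orbit_map (g t) = orbit_map z" using g(4)[OF t] by (simp add: orbit_map_def)
    then obtain w where "w \<in> W" "g t = w *v z" using orbit_map_eqD by blast
    then show ?thesis using z orbit_of_act by simp
  qed
  have "orbit_of W (g 1) = orbit_of W x0" using gp[of 1] pp by simp
  then obtain w where w: "w \<in> W" "g 1 = w *v x0" using orbit_eqD by blast
  then have "g \<in> lifted_braids w" using g by (auto simp: lifted_braids_def path_in_def X_free pathfinish_def)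
  then show ?thesis using w(1) gp by blast
qed

lemma braid_of_surj:
  assumes "b \<in> carrier B" shows "\<exists>w\<in>W. \<exists>g\<in>lifted_braids w. b = braid_of g"
proof -
  obtain p where p: "b = loop_class (orbit_space W) (orbit_of W x0) p" "loop_at (orbit_space W) (orbit_of W x0) p"
    using assms by (auto simp: braid_group_def carrier_fundamental_group)
  obtain w g where wg: "w \<in> W" "g \<in> lifted_braids w" "\<forall>t\<in>{0..1}. orbit_of W (g t) = p t"
    using lift_braid[OF p(2)] by blast
  have "homotopic_loops_at (orbit_space W) (orbit_of W x0) p (orbit_of W \<circ> g)"
    by (rule homotopic_loops_at_eq[OF homotopic_loops_at_refl[THEN iffD2, OF p(2)]]) (use wg in auto)
  from loop_class_eqI[OF this] show ?thesis using wg p(1) by (auto simp: braid_of_def)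
qed

lemma homotopic_lifts:
  assumes "w \<in> W" "g \<in> lifted_braids w" "w' \<in> W" "g' \<in> lifted_braids w'"
    and h: "homotopic_loops_at (orbit_space W) (orbit_of W x0) (orbit_of W \<circ> g) (orbit_of W \<circ> g')"
  shows "homotopic_paths X g g'"
proof -
  have e: "orbit_code \<circ> (orbit_of W \<circ> f) = orbit_map \<circ> f" for f :: "real \<Rightarrow> complex^'n"
    by (auto simp: orbit_map_def)
  have "homotopic_loops_at (top_of_set (orbit_map ` X)) (orbit_code (orbit_of W x0)) (orbit_map \<circ> g) (orbit_map \<circ> g')"
    using homotopic_loops_at_compose[OF h continuous_orbit_code] by (simp only: e)
  then have hp: "homotopic_paths (orbit_map ` free_points) (orbit_map \<circ> g) (orbit_map \<circ> g')"
    by (simp add: homotopic_loops_at_top_of_set X_free)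
  have g: "path g" "path_image g \<subseteq> free_points" "path g'" "path_image g' \<subseteq> free_points" "pathstart g = pathstart g'"
    using assms by (auto simp: lifted_braids_def path_in_def X_free)
  show ?thesis unfolding X_free
    by (rule covering_space_lift_homotopic_paths[OF covering_orbit_map _ _ _ _ hp])
      (use g homotopic_paths_imp_path[OF hp] homotopic_paths_imp_subset[OF hp] in auto)
qed

lemma braid_of_eqD:
  assumes g: "w \<in> W" "g \<in> lifted_braids w" "w' \<in> W" "g' \<in> lifted_braids w'" and e: "braid_of g = braid_of g'"
  shows "w = w'" "homotopic_paths X g g'"
proof -
  have "homotopic_loops_at (orbit_space W) (orbit_of W x0) (orbit_of W \<circ> g) (orbit_of W \<circ> g')"
    using e loop_class_eq_iff[OF lifted_braid_loop[OF g(1,2)] lifted_braid_loop[OF g(3,4)]]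
    by (simp add: braid_of_def)
  then show hp: "homotopic_paths X g g'" by (rule homotopic_lifts[OF g])
  have "w *v x0 = w' *v x0" using homotopic_paths_imp_pathfinish[OF hp] g by (simp add: lifted_braids_def)
  then show "w = w'" using free_points_cancel[of x0 w w'] x0 g by (simp add: X_free)
qed

lemma path_in_act: "w \<in> W \<Longrightarrow> path_in X g \<Longrightarrow> path_in X ((\<lambda>x. w *v x) \<circ> g)"
  by (rule path_in_compose) (auto intro!: continuous_intros X_act)

lemma lifted_braids_mult:
  assumes "w \<in> W" "g \<in> lifted_braids w" "w' \<in> W" "g' \<in> lifted_braids w'"
  shows "g +++ ((\<lambda>x. w *v x) \<circ> g') \<in> lifted_braids (w ** w')"
proof -
  have g: "path_in X g" "pathstart g = x0" "pathfinish g = w *v x0"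
    and g': "path_in X g'" "pathstart g' = x0" "pathfinish g' = w' *v x0"
    using assms by (auto simp: lifted_braids_def)
  have "path_in X (g +++ ((\<lambda>x. w *v x) \<circ> g'))"
    by (rule path_in_join[OF g(1) path_in_act[OF assms(1) g'(1)]]) (simp add: g g' pathstart_compose)
  then show ?thesis
    unfolding lifted_braids_def by (simp add: g g' pathfinish_compose matrix_vector_mul_assoc)
qed

lemma braid_of_mult:
  assumes "w \<in> W" "g \<in> lifted_braids w" "w' \<in> W" "g' \<in> lifted_braids w'"
  shows "braid_of g \<otimes>\<^bsub>B\<^esub> braid_of g' = braid_of (g +++ ((\<lambda>x. w *v x) \<circ> g'))"
proof -
  have "orbit_of W \<circ> (g +++ ((\<lambda>x. w *v x) \<circ> g')) = join_loops (orbit_of W \<circ> g) (orbit_of W \<circ> g')"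
    by (rule ext) (simp add: orbit_of_act[OF assms(1)] join_loops_def joinpaths_def)
  then show ?thesis
    unfolding braid_of_def braid_group_def
    by (simp only: mult_fundamental_group[OF lifted_braid_loop[OF assms(1,2)] lifted_braid_loop[OF assms(3,4)]])
qed

lemma braid_to_group_braid_of:
  assumes w: "w \<in> W" "g \<in> lifted_braids w"
  shows "braid_to_group W x0 (braid_of g) = w"
  unfolding braid_to_group_def
proof (rule the_equality)
  have lift: "pathin (top_of_set X) f \<and> f 0 = x0 \<and> f 1 = u *v x0 \<longleftrightarrow> f \<in> lifted_braids u" for f u
    by (auto simp: lifted_braids_def path_in_def pathin_def path_def path_image_def pathstart_def pathfinish_def)
  show "w \<in> W \<and> (\<exists>f. pathin (top_of_set X) f \<and> f 0 = x0 \<and> f 1 = w *v x0 \<and> orbit_of W \<circ> f \<in> braid_of g)"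
    using w lift[of g w] mem_loop_class_self[OF lifted_braid_loop[OF w]] by (auto simp: braid_of_def)
  fix u assume "u \<in> W \<and> (\<exists>f. pathin (top_of_set X) f \<and> f 0 = x0 \<and> f 1 = u *v x0 \<and> orbit_of W \<circ> f \<in> braid_of g)"
  then obtain f where f: "u \<in> W" "f \<in> lifted_braids u" "orbit_of W \<circ> f \<in> braid_of g" using lift by blast
  then have "homotopic_loops_at (orbit_space W) (orbit_of W x0) (orbit_of W \<circ> g) (orbit_of W \<circ> f)"
    by (simp add: braid_of_def mem_loop_class)
  from loop_class_eqI[OF this] have "braid_of g = braid_of f" by (simp add: braid_of_def)
  then show "u = w" using braid_of_eqD(1)[OF w f(1,2)] by simp
qed

lemma braid_to_group_hom: "braid_to_group W x0 \<in> hom B GL"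
proof (rule homI)
  fix b assume "b \<in> carrier B"
  then obtain w g where g: "w \<in> W" "g \<in> lifted_braids w" "b = braid_of g" using braid_of_surj by blast
  show "braid_to_group W x0 b \<in> carrier GL"
    using inv_W[OF g(1)] by (auto simp: g(3) braid_to_group_braid_of[OF g(1,2)] GL_def invertible_def)
  fix b' assume "b' \<in> carrier B"
  then obtain w' g' where g': "w' \<in> W" "g' \<in> lifted_braids w'" "b' = braid_of g'" using braid_of_surj by blast
  show "braid_to_group W x0 (b \<otimes>\<^bsub>B\<^esub> b') = braid_to_group W x0 b \<otimes>\<^bsub>GL\<^esub> braid_to_group W x0 b'"
    using braid_to_group_braid_of[OF mult_W[OF g(1) g'(1)] lifted_braids_mult[OF g(1,2) g'(1,2)]]
    by (simp add: g(3) g'(3) braid_to_group_braid_of[OF g(1,2)] braid_to_group_braid_of[OF g'(1,2)]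
        braid_of_mult[OF g(1,2) g'(1,2)] GL_def)
qed

lemma loops_are_lifted_braids: "loop_at (top_of_set X) x0 p \<longleftrightarrow> p \<in> lifted_braids (mat 1)"
  by (simp add: loop_at_path_in lifted_braids_def)

lemma pure_to_braid_class:
  assumes "p \<in> lifted_braids (mat 1)"
  shows "pure_to_braid W x0 (loop_class (top_of_set X) x0 p) = braid_of p"
  using fundamental_group_map_loop_class[OF continuous_orbit_of] assms
  by (simp add: pure_to_braid_def loops_are_lifted_braids braid_of_def)

lemma carrier_P: "carrier P = loop_class (top_of_set X) x0 ` lifted_braids (mat 1)"
  by (auto simp: pure_braid_group_def carrier_fundamental_group loops_are_lifted_braids)

lemma pure_to_braid_hom: "pure_to_braid W x0 \<in> hom P B"
  unfolding pure_to_braid_def pure_braid_group_def braid_group_def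
  by (rule hom_fundamental_group_map[OF continuous_orbit_of])

lemma pure_to_braid_inj: "inj_on (pure_to_braid W x0) (carrier P)"
proof (rule inj_onI)
  fix a b assume ab: "a \<in> carrier P" "b \<in> carrier P" "pure_to_braid W x0 a = pure_to_braid W x0 b"
  obtain p q where p: "p \<in> lifted_braids (mat 1)" "a = loop_class (top_of_set X) x0 p"
    and q: "q \<in> lifted_braids (mat 1)" "b = loop_class (top_of_set X) x0 q"
    using ab by (auto simp: carrier_P)
  have "homotopic_paths X p q"
    using braid_of_eqD(2)[OF one_W p(1) one_W q(1)] ab(3) p q by (simp add: pure_to_braid_class)
  then have "homotopic_loops_at (top_of_set X) x0 p q"
    using p by (simp add: homotopic_loops_at_top_of_set lifted_braids_def)
  then show "a = b" unfolding p(2) q(2) by (rule loop_class_eqI)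
qed

lemma pure_image_eq_kernel: "pure_to_braid W x0 ` carrier P = kernel B GL (braid_to_group W x0)"
proof
  show "pure_to_braid W x0 ` carrier P \<subseteq> kernel B GL (braid_to_group W x0)"
    using braid_of_carrier[OF one_W] braid_to_group_braid_of[OF one_W]
    by (auto simp: carrier_P kernel_def pure_to_braid_class GL_def)
  show "kernel B GL (braid_to_group W x0) \<subseteq> pure_to_braid W x0 ` carrier P"
  proof
    fix b assume b: "b \<in> kernel B GL (braid_to_group W x0)"
    then have "b \<in> carrier B" by (simp add: kernel_def)
    then obtain w g where g: "w \<in> W" "g \<in> lifted_braids w" "b = braid_of g" using braid_of_surj by blast
    have "w = mat 1" using b braid_to_group_braid_of[OF g(1,2)] g(3) by (simp add: kernel_def GL_def)
    then have g1: "g \<in> lifted_braids (mat 1)" using g(2) by simp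
    show "b \<in> pure_to_braid W x0 ` carrier P"
      unfolding carrier_P image_image g(3)
      by (rule image_eqI[OF _ g1]) (simp add: pure_to_braid_class[OF g1])
  qed
qed

text \<open>
  The pure braid group is the kernel of the map to \<open>W\<close>, and the commutator subgroup of a normal
  subgroup is normal.
\<close>

lemma pure_commutators_normal: "pure_commutators W x0 \<lhd> B"
proof -
  interpret B: group B by (rule group_B)
  interpret P: group P by (rule group_P)
  interpret \<rho>: group_hom B GL "braid_to_group W x0"
    by (intro group_hom.intro group_hom_axioms.intro group_B group_GL braid_to_group_hom)
  interpret \<iota>: group_hom P B "pure_to_braid W x0"
    by (intro group_hom.intro group_hom_axioms.intro group_B group_P pure_to_braid_hom)
  have "pure_commutators W x0 = derived B (pure_to_braid W x0 ` carrier P)"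
    unfolding pure_commutators_def Let_def by (rule \<iota>.derived_img[symmetric]) simp
  then show ?thesis
    using B.derived_is_normal[OF \<rho>.normal_kernel] by (simp add: pure_image_eq_kernel)
qed

lemma pure_commutators_kernel:
  assumes "a \<in> pure_commutators W x0" shows "braid_to_group W x0 a = mat 1" "a \<in> carrier B"
proof -
  interpret P: group P by (rule group_P)
  have "a \<in> pure_to_braid W x0 ` carrier P"
    using assms P.derived_in_carrier[of "carrier P"] unfolding pure_commutators_def Let_def by blast
  then have "a \<in> kernel B GL (braid_to_group W x0)" by (simp add: pure_image_eq_kernel)
  then show "braid_to_group W x0 a = mat 1" "a \<in> carrier B" by (simp_all add: kernel_def GL_def)
qed

end

section \<open>Torsion in the quotient of the braid group\<close>

primrec matrix_power :: "complex^'n^'n \<Rightarrow> nat \<Rightarrow> complex^'n^'n" where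
  "matrix_power w 0 = mat 1"
| "matrix_power w (Suc n) = matrix_power w n ** w"

lemma matrix_power_eigen:
  fixes w :: "complex^'n^'n"
  assumes "w *v x = z *s x" shows "matrix_power w n *v x = z ^ n *s x"
proof (induction n)
  case (Suc n)
  have "matrix_power w (Suc n) *v x = matrix_power w n *v (z *s x)"
    by (simp add: matrix_vector_mul_assoc[symmetric] assms)
  also have "\<dots> = z *s (z ^ n *s x)" by (simp add: vector_scalar_commute Suc.IH)
  finally show ?case by (simp add: vector_smult_assoc mult.commute)
qed simp

lemma matrix_power_add: "matrix_power w (m + n) = matrix_power w m ** matrix_power w n"
  by (induction n) (simp_all add: matrix_mul_assoc)

lemma matrix_power_mult: "matrix_power w (m * n) = matrix_power (matrix_power w m) n"
proof (induction n)
  case (Suc n)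
  have "m * Suc n = m * n + m" by simp
  then show ?case by (simp only: matrix_power_add Suc.IH matrix_power.simps)
qed simp

lemma matrix_power_one: "matrix_power (mat 1) n = mat 1"
  by (induction n) simp_all

lemma matrix_power_periodic:
  assumes "matrix_power w d = mat 1" shows "matrix_power w (d * k) = mat 1"
  by (simp add: matrix_power_mult assms matrix_power_one)

text \<open>As \<open>w\<close> has finite order, inverses are powers with nonnegative exponent.\<close>

lemma generate_matrix_powers:
  fixes w :: "complex^'n^'n"
  assumes d: "matrix_power w d = mat 1" "d > 0" and u: "u \<in> generate GL {w}"
  shows "\<exists>j. u = matrix_power w j"
  using u
proof (induction rule: generate.induct)
  case one
  show ?case by (rule exI[of _ 0]) (simp add: GL_def)
next
  case (incl h)
  then show ?case by (intro exI[of _ 1]) simp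
next
  case (inv h)
  then have h: "h = w" by simp
  obtain e where e: "d = Suc e" using d(2) by (cases d) auto
  have l: "matrix_power w e ** w = mat 1" using d(1) e by simp
  then have r: "w ** matrix_power w e = mat 1" by (simp add: matrix_left_right_inverse)
  interpret group "GL :: (complex^'n^'n) monoid" by (rule group_GL)
  have "inv\<^bsub>GL\<^esub> w = matrix_power w e"
    by (rule inv_equality) (use l r in \<open>auto simp: GL_def invertible_def\<close>)
  then show ?case using h by blast
next
  case (eng h1 h2)
  then obtain i j where "h1 = matrix_power w i" "h2 = matrix_power w j" by blast
  then show ?case by (intro exI[of _ "i + j"]) (simp add: matrix_power_add GL_def)
qed

lemma lf_image_kernel:
  assumes l: "l \<noteq> 0" and img: "(*v) u ` {x. lf l x = 0} = {x. lf l x = 0}"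
  shows "\<exists>\<zeta>. \<forall>x. lf l (u *v x) = \<zeta> * lf l x"
proof -
  obtain e where e: "lf l e = 1" using lf_nonzero_dual[OF l] by blast
  have "lf l (u *v x) = lf l (u *v e) * lf l x" for x
  proof -
    have "x - lf l x *s e \<in> {x. lf l x = 0}" by (simp add: lf_diff lf_scale e)
    then have "u *v (x - lf l x *s e) \<in> {x. lf l x = 0}" using img by blast
    then show ?thesis
      by (simp add: matrix_vector_mult_diff_distrib vector_scalar_commute lf_diff lf_scale)
  qed
  then show ?thesis by blast
qed

text \<open>
  Logarithms of the two paths differ by a continuous function with values in the discrete set of
  logarithms of \<open>\<zeta>\<close>, which is constant.
\<close>

lemma winding_number_scale_path:
  assumes p: "path p" "0 \<notin> path_image p" and \<zeta>: "\<zeta> \<noteq> 0"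
  shows "winding_number (\<lambda>t. \<zeta> * p t) 0 = winding_number p 0"
proof -
  define h where "h = (\<lambda>t. \<zeta> * p t)"
  have h: "path h" "0 \<notin> path_image h"
    using p \<zeta> by (auto simp: h_def path_def path_image_def intro!: continuous_intros)
  obtain q where q: "path q" "pathfinish q - pathstart q = 2 * of_real pi * \<i> * winding_number p 0"
    "\<And>t. t \<in> {0..1} \<Longrightarrow> p t = 0 + exp (q t)" using winding_number_as_continuous_log[OF p] by blast
  obtain r where r: "path r" "pathfinish r - pathstart r = 2 * of_real pi * \<i> * winding_number h 0"
    "\<And>t. t \<in> {0..1} \<Longrightarrow> h t = 0 + exp (r t)" using winding_number_as_continuous_log[OF h] by blast
  have ex: "exp (r t - q t) = \<zeta>" if "t \<in> {0..1}" for t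
    using q(3)[OF that] r(3)[OF that] by (auto simp: h_def exp_diff divide_eq_eq)
  have "(\<lambda>t. r t - q t) constant_on {0..1}"
  proof (rule continuous_discrete_range_constant)
    show "continuous_on {0..1} (\<lambda>t. r t - q t)"
      using q(1) r(1) unfolding path_def by (intro continuous_intros)
    fix t :: real assume t: "t \<in> {0..1}"
    have "2 * pi \<le> norm ((r s - q s) - (r t - q t))"
      if s: "s \<in> {0..1}" "r s - q s \<noteq> r t - q t" for s
    proof -
      obtain n :: int where n: "r s - q s = (r t - q t) + (of_int (2 * n) * pi) * \<i>"
        using ex[OF t] ex[OF s(1)] exp_eq[of "r s - q s" "r t - q t"] by auto
      then have "n \<noteq> 0" using s(2) by auto
      have "norm ((r s - q s) - (r t - q t)) = 2 * \<bar>of_int n\<bar> * pi"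
        using n by (simp add: norm_mult)
      moreover have "\<bar>of_int n\<bar> \<ge> (1::real)" using \<open>n \<noteq> 0\<close> by linarith
      ultimately show ?thesis by simp
    qed
    then show "\<exists>e>0. \<forall>y. y \<in> {0..1} \<and> r y - q y \<noteq> r t - q t \<longrightarrow> e \<le> norm (r y - q y - (r t - q t))"
      using pi_gt_zero by (intro exI[of _ "2 * pi"]) auto
  qed simp
  then have "r 1 - q 1 = r 0 - q 0" unfolding constant_on_def by force
  then have "pathfinish r - pathstart r = pathfinish q - pathstart q"
    by (simp add: pathfinish_def pathstart_def algebra_simps)
  then show ?thesis using q(2) r(2) by (simp add: h_def)
qed

context braid_setup
begin

text \<open>
  The \<open>n\<close>-th piece of the lifted power is translated by \<open>w^n\<close>, so that it starts where the
  previous one ends.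
\<close>

primrec lift_power :: "complex^'n^'n \<Rightarrow> (real \<Rightarrow> complex^'n) \<Rightarrow> nat \<Rightarrow> real \<Rightarrow> complex^'n" where
  "lift_power w g 0 = linepath x0 x0"
| "lift_power w g (Suc n) = lift_power w g n +++ ((\<lambda>x. matrix_power w n *v x) \<circ> g)"

lemma matrix_power_W: "w \<in> W \<Longrightarrow> matrix_power w n \<in> W"
  by (induction n) (auto intro: one_W mult_W)

lemma lift_power:
  assumes w: "w \<in> W" and g: "g \<in> lifted_braids w"
  shows "lift_power w g n \<in> lifted_braids (matrix_power w n) \<and>
    braid_of (lift_power w g n) = braid_of g [^]\<^bsub>B\<^esub> n"
proof (induction n)
  case 0
  interpret group B by (rule group_B)
  have "linepath x0 x0 \<in> lifted_braids (mat 1)" using x0 by (simp add: lifted_braids_def path_in_const)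
  moreover have "braid_of (linepath x0 x0) = \<one>\<^bsub>B\<^esub>"
    by (simp add: braid_of_def braid_group_def one_fundamental_group linepath_refl o_def)
  ultimately show ?case unfolding lift_power.simps matrix_power.simps nat_pow_0 by blast
next
  case (Suc n)
  interpret group B by (rule group_B)
  note IH = Suc.IH[THEN conjunct1]
  have "lift_power w g (Suc n) \<in> lifted_braids (matrix_power w (Suc n))"
    using lifted_braids_mult[OF matrix_power_W[OF w] IH w g] by simp
  moreover have "braid_of (lift_power w g (Suc n)) = braid_of (lift_power w g n) \<otimes>\<^bsub>B\<^esub> braid_of g"
    unfolding lift_power.simps by (rule braid_of_mult[OF matrix_power_W[OF w] IH w g, symmetric])
  ultimately show ?case using Suc.IH by simp
qed

text \<open>
  Every piece contributes the same winding number, because \<open>l\<close> changes only by the scalar \<open>\<zeta>\<close>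
  under \<open>w\<close>.
\<close>

lemma winding_lift_power:
  assumes A: "X = arr_complement A" "l \<in> A" and w: "w \<in> W" and g: "g \<in> lifted_braids w"
    and \<zeta>: "\<And>x. lf l (w *v x) = \<zeta> * lf l x"
  shows "winding_number (lf l \<circ> lift_power w g n) 0 = of_nat n * winding_number (lf l \<circ> g) 0"
proof (induction n)
  case 0
  have "lf l \<circ> linepath x0 x0 = linepath (lf l x0) (lf l x0)" by (auto simp: linepath_refl)
  moreover have "lf l x0 \<noteq> 0" using x0 A by (auto simp: arr_complement_def)
  ultimately show ?case
    unfolding lift_power.simps by (simp only: winding_number_trivial of_nat_0 mult_zero_left not_False_eq_True)
next
  case (Suc n)
  have gX: "path_in (arr_complement A) g" using g A by (simp add: lifted_braids_def)
  have lp: "path (lf l \<circ> g)" "0 \<notin> path_image (lf l \<circ> g)" using lf_path_image_compose[OF gX A(2)] by auto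
  have pw: "lf l (matrix_power w n *v x) = \<zeta> ^ n * lf l x" for x
  proof (induction n arbitrary: x)
    case (Suc n)
    then show ?case by (simp add: matrix_vector_mul_assoc[symmetric] \<zeta>)
  qed simp
  have "lf l (w *v x0) \<noteq> 0" using X_act[OF w x0] A by (auto simp: arr_complement_def)
  then have z0: "\<zeta> \<noteq> 0" using \<zeta>[of x0] by auto
  let ?h = "(\<lambda>x. matrix_power w n *v x) \<circ> g"
  have "lf l \<circ> ?h = (\<lambda>t. \<zeta> ^ n * (lf l \<circ> g) t)" by (auto simp: pw)
  then have wh: "winding_number (lf l \<circ> ?h) 0 = winding_number (lf l \<circ> g) 0"
    using winding_number_scale_path[OF lp, of "\<zeta> ^ n"] z0 by simp
  have ln: "lift_power w g n \<in> lifted_braids (matrix_power w n)" using lift_power[OF w g] by blast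
  have "winding_number (lf l \<circ> (lift_power w g n +++ ?h)) 0 =
      winding_number (lf l \<circ> lift_power w g n) 0 + winding_number (lf l \<circ> ?h) 0"
  proof (rule winding_lf_join[OF _ _ _ A(2)])
    show "path_in (arr_complement A) (lift_power w g n)" using ln A by (simp add: lifted_braids_def)
    show "path_in (arr_complement A) ?h" using path_in_act[OF matrix_power_W[OF w], of g] gX A by simp
    show "pathfinish (lift_power w g n) = pathstart ?h"
      using ln g by (simp add: lifted_braids_def pathstart_compose)
  qed
  then show ?case by (simp only: lift_power.simps Suc.IH wh of_nat_Suc distrib_right mult_1_left add.commute)
qed

text \<open>
  The winding number is a homomorphism from \<open>P\<close> to the commutative group of complex numbers, so it
  kills commutators.
\<close>

lemma pure_commutators_winding:
  assumes A: "X = arr_complement A" "l \<in> A"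
    and p: "p \<in> lifted_braids (mat 1)" "braid_of p \<in> pure_commutators W x0"
  shows "winding_number (lf l \<circ> p) 0 = 0"
proof -
  interpret P: group P by (rule group_P)
  let ?cl = "loop_class (top_of_set X) x0"
  have P_def: "P = fundamental_group (top_of_set X) x0" by (simp add: pure_braid_group_def)
  define N where "N a = winding_number (lf l \<circ> (SOME p. p \<in> a)) 0" for a
  have N: "N (?cl q) = winding_number (lf l \<circ> q) 0" if q: "q \<in> lifted_braids (mat 1)" for q
  proof -
    have "q \<in> ?cl q" using q by (simp add: mem_loop_class_self loops_are_lifted_braids)
    define s where "s = (SOME p. p \<in> ?cl q)"
    have "s \<in> ?cl q" unfolding s_def by (rule someI[of "\<lambda>p. p \<in> ?cl q"]) fact
    then have "homotopic_paths X q s" by (simp add: mem_loop_class homotopic_loops_at_top_of_set)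
    then show ?thesis unfolding N_def s_def[symmetric] using winding_lf_homotopic[of A q s l] A by simp
  qed
  define Z :: "complex monoid" where "Z = \<lparr>carrier = UNIV, mult = (+), one = 0\<rparr>"
  interpret Z: comm_group Z
    by (rule comm_groupI) (auto simp: Z_def intro: exI[of _ "- x" for x])
  have "N \<in> hom P Z"
  proof (rule homI)
    fix a b assume "a \<in> carrier P" "b \<in> carrier P"
    then obtain q r where q: "q \<in> lifted_braids (mat 1)" "a = ?cl q" and r: "r \<in> lifted_braids (mat 1)" "b = ?cl r"
      by (auto simp: carrier_P)
    have qr: "q +++ r \<in> lifted_braids (mat 1)"
      using q r by (auto simp: lifted_braids_def intro!: path_in_join)
    have "a \<otimes>\<^bsub>P\<^esub> b = ?cl (q +++ r)"
      using q r mult_fundamental_group[of "top_of_set X" x0 q r]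
      by (simp add: P_def loops_are_lifted_braids join_loops_eq_joinpaths)
    moreover have "winding_number (lf l \<circ> (q +++ r)) 0 = winding_number (lf l \<circ> q) 0 + winding_number (lf l \<circ> r) 0"
      by (rule winding_lf_join[OF _ _ _ A(2)]) (use q r A in \<open>auto simp: lifted_braids_def\<close>)
    ultimately show "N (a \<otimes>\<^bsub>P\<^esub> b) = N a \<otimes>\<^bsub>Z\<^esub> N b"
      using N[OF qr] N[OF q(1)] N[OF r(1)] by (simp add: q(2) r(2) Z_def)
  qed (simp add: Z_def)
  then interpret N: group_hom P Z N by (intro group_hom.intro group_hom_axioms.intro P.is_group Z.is_group)
  obtain a where a: "a \<in> derived P (carrier P)" "braid_of p = pure_to_braid W x0 a"
    using p(2) unfolding pure_commutators_def Let_def by blast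
  have aP: "a \<in> carrier P" using a(1) P.derived_in_carrier[of "carrier P"] by blast
  have pP: "?cl p \<in> carrier P" using p(1) by (auto simp: carrier_P)
  have "pure_to_braid W x0 (?cl p) = pure_to_braid W x0 a" using a(2) pure_to_braid_class[OF p(1)] by simp
  then have "?cl p = a" using inj_onD[OF pure_to_braid_inj _ pP aP] by blast
  then have "?cl p \<in> derived P (carrier P)" using a(1) by simp
  moreover have "N ` derived P (carrier P) = {\<one>\<^bsub>Z\<^esub>}"
  proof -
    have "N ` derived P (carrier P) = derived Z (N ` carrier P)" by (rule N.derived_img[symmetric]) simp
    also have "\<dots> = {\<one>\<^bsub>Z\<^esub>}" by (rule Z.derived_eq_singleton) (use N.hom_closed in blast)
    finally show ?thesis .
  qed
  ultimately have "N (?cl p) = \<one>\<^bsub>Z\<^esub>" by blast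
  then show ?thesis using N[OF p(1)] by (simp add: Z_def)
qed

lemma winding_pure_commutators:
  assumes A: "X = arr_complement A" "finite A" "0 \<notin> A"
    and p: "p \<in> lifted_braids (mat 1)" "\<And>l. l \<in> A \<Longrightarrow> winding_number (lf l \<circ> p) 0 = 0"
  shows "braid_of p \<in> pure_commutators W x0"
proof -
  have "loop_class (top_of_set X) x0 p \<in> derived P (carrier P)"
    unfolding pure_braid_group_def A(1)
    by (rule zero_winding_imp_derived[OF A(2,3)]) (use x0 p A(1) in \<open>auto simp: loops_are_lifted_braids[unfolded A(1)]\<close>)
  then show ?thesis
    unfolding pure_commutators_def Let_def using pure_to_braid_class[OF p(1)] by (metis image_eqI)
qed

lemma coset_image_braid_to_group:
  assumes b: "b \<in> carrier B"
  shows "braid_to_group W x0 ` (pure_commutators W x0 #>\<^bsub>B\<^esub> b) = {braid_to_group W x0 b}"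
proof -
  interpret \<rho>: group_hom B GL "braid_to_group W x0"
    by (intro group_hom.intro group_hom_axioms.intro group_B group_GL braid_to_group_hom)
  interpret D: normal "pure_commutators W x0" B by (rule pure_commutators_normal)
  have "braid_to_group W x0 (a \<otimes>\<^bsub>B\<^esub> b) = braid_to_group W x0 b" if "a \<in> pure_commutators W x0" for a
    using pure_commutators_kernel[OF that] b by (simp add: GL_def)
  moreover have "pure_commutators W x0 \<noteq> {}" using D.one_closed by blast
  ultimately show ?thesis by (auto simp: r_coset_def image_UN)
qed

text \<open>
  The order \<open>d'\<close> of the eigenvalue is found to be \<open>d\<close> from the absence of torsion in \<open>P/(P,P)\<close>.
  For freeness, a power \<open>u\<close> of \<open>w\<close> that stabilises the kernel of \<open>l\<close> is compared with the
  corresponding power of the braid, whose \<open>d\<close>-th power does not wind around that kernel.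
\<close>

theorem torsion_imp_freely_regular:
  assumes c: "c \<in> carrier (braid_quotient W x0)" "group.ord (braid_quotient W x0) c = d"
    and reg: "regular_element W (braid_quotient_to_group W x0 c)" and d0: "d > 0"
  shows "freely_regular_number W d"
proof -
  let ?D = "pure_commutators W x0"
  interpret B: group B by (rule group_B)
  interpret D: normal ?D B by (rule pure_commutators_normal)
  have Q: "braid_quotient W x0 = B Mod ?D" by (simp add: braid_quotient_def)
  interpret Q: group "B Mod ?D" by (rule D.factorgroup_is_group)
  obtain b where b: "b \<in> carrier B" "c = ?D #>\<^bsub>B\<^esub> b" using c(1) by (auto simp: Q FactGroup_def RCOSETS_def)
  obtain w g where g: "w \<in> W" "g \<in> lifted_braids w" "b = braid_of g" using braid_of_surj[OF b(1)] by blast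
  have w: "braid_quotient_to_group W x0 c = w"
    by (simp add: braid_quotient_to_group_def b(2) coset_image_braid_to_group[OF b(1)])
      (simp add: g braid_to_group_braid_of)
  obtain d' x z where x: "x \<in> X" "x \<noteq> 0" "w *v x = z *s x" and z: "has_mult_order z d'"
    using reg w by (auto simp: regular_element_def regular_with_order_def)
  interpret co: group_hom B "B Mod ?D" "\<lambda>a. ?D #>\<^bsub>B\<^esub> a"
    by (intro group_hom.intro group_hom_axioms.intro group_B Q.is_group D.r_coset_hom_Mod)
  have mem_D: "a \<in> ?D" if "a \<in> carrier B" "?D #>\<^bsub>B\<^esub> a = ?D" for a
    using B.coset_join1[OF that(2,1) D.subgroup_axioms] .
  have pow: "b [^]\<^bsub>B\<^esub> n \<in> ?D \<longleftrightarrow> d dvd n" for n :: nat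
  proof -
    have "c [^]\<^bsub>B Mod ?D\<^esub> n = ?D #>\<^bsub>B\<^esub> (b [^]\<^bsub>B\<^esub> n)" using co.hom_nat_pow[OF b(1)] b(2) by simp
    moreover have "c [^]\<^bsub>B Mod ?D\<^esub> n = \<one>\<^bsub>B Mod ?D\<^esub> \<longleftrightarrow> d dvd n"
      using Q.pow_eq_id[of c n] c by (simp add: Q)
    moreover have "\<one>\<^bsub>B Mod ?D\<^esub> = ?D" by (simp add: FactGroup_def)
    moreover have "?D #>\<^bsub>B\<^esub> a = ?D \<longleftrightarrow> a \<in> ?D" if "a \<in> carrier B" for a
      using mem_D[OF that] D.rcos_const[OF B.is_group] by blast
    ultimately show ?thesis using b(1) by simp
  qed
  obtain A where A: "finite A" "0 \<notin> A" "X = arr_complement A"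
    "\<forall>H\<in>reflecting_hyperplanes W. \<exists>l\<in>A. H = {x. lf l x = 0}" using arrangement_exists by blast
  have z': "z ^ d' = 1" "d' > 0" using z by (auto simp: has_mult_order_def)
  have z_dvd: "d' dvd n" if "z ^ n = 1" for n
  proof -
    have "z ^ n = z ^ (n mod d')"
      using z'(1) by (metis (no_types) div_mult_mod_eq mult.commute mult_1 power_add power_mult power_one)
    then have "z ^ (n mod d') = 1" using that by simp
    then have "n mod d' = 0" using z z'(2) by (metis has_mult_order_def bot_nat_0.not_eq_extremum mod_less_divisor)
    then show ?thesis by presburger
  qed
  have fix_one: "matrix_power w n = mat 1 \<longleftrightarrow> z ^ n = 1" for n
  proof
    assume "matrix_power w n = mat 1"
    then have "z ^ n *s x = x" using matrix_power_eigen[OF x(3), of n] by simp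
    then have "(z ^ n - 1) *s x = 0" unfolding vec.scale_left_diff_distrib by simp
    then have "z ^ n - 1 = 0" using x(2) vec.scale_eq_0_iff by blast
    then show "z ^ n = 1" by simp
  next
    assume "z ^ n = 1"
    then have "matrix_power w n *v x = x" using matrix_power_eigen[OF x(3), of n] by simp
    then show "matrix_power w n = mat 1" by (rule steinberg[OF x(1) matrix_power_W[OF g(1)]])
  qed
  have lift: "lift_power w g n \<in> lifted_braids (matrix_power w n)" "braid_of (lift_power w g n) = b [^]\<^bsub>B\<^esub> n" for n
    using lift_power[OF g(1,2)] g(3) by auto
  have "b [^]\<^bsub>B\<^esub> d \<in> ?D" using pow by simp
  then have wd: "matrix_power w d = mat 1"
    using pure_commutators_kernel(1)[of "b [^]\<^bsub>B\<^esub> d"] braid_to_group_braid_of[OF matrix_power_W[OF g(1)] lift(1)[of d]] lift(2)[of d]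
    by simp
  then have "d' dvd d" using fix_one z_dvd by blast
  then obtain k where k: "d = d' * k" by (elim dvdE)
  have k0: "k > 0" using k d0 by simp
  \<comment> \<open>the winding numbers of the \<open>k\<close>-th power of \<open>p\<close> are \<open>k\<close> times those of \<open>p\<close>, and they vanish\<close>
  define p where "p = lift_power w g d'"
  have p: "p \<in> lifted_braids (mat 1)" "braid_of p = b [^]\<^bsub>B\<^esub> d'"
    using lift[of d'] fix_one[of d'] z'(1) by (auto simp: p_def)
  have "braid_of (lift_power (mat 1) p k) = b [^]\<^bsub>B\<^esub> d"
    using lift_power[OF one_W p(1), of k] p(2) b(1) by (simp add: k B.nat_pow_pow)
  moreover have pk: "lift_power (mat 1) p k \<in> lifted_braids (mat 1)"
    using lift_power[OF one_W p(1), of k] by (simp add: matrix_power_one)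
  ultimately have "winding_number (lf l \<circ> lift_power (mat 1) p k) 0 = 0" if "l \<in> A" for l
    using pure_commutators_winding[OF A(3) that pk] \<open>b [^]\<^bsub>B\<^esub> d \<in> ?D\<close> by simp
  then have "winding_number (lf l \<circ> p) 0 = 0" if "l \<in> A" for l
    using winding_lift_power[OF A(3) that one_W p(1), of 1 k] k0 that by simp
  then have "braid_of p \<in> ?D" by (rule winding_pure_commutators[OF A(3,1,2) p(1)])
  then have "d dvd d'" using pow p(2) by simp
  then have dd: "d' = d" using \<open>d' dvd d\<close> by (simp add: dvd_antisym)
  have reg_w: "regular_with_order W d w"
    unfolding regular_with_order_def using g(1) x z dd by blast
  have "u = mat 1" if u: "u \<in> generate GL {w}" and H: "H \<in> reflecting_hyperplanes W" "(*v) u ` H = H" for u H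
  proof -
    obtain j where j: "u = matrix_power w j" using generate_matrix_powers[OF wd d0 u] by blast
    obtain l where l: "l \<in> A" "H = {x. lf l x = 0}" using A(4) H(1) by blast
    have uW: "u \<in> W" using matrix_power_W[OF g(1)] j by simp
    have l0: "l \<noteq> 0" using l(1) A(2) by blast
    obtain \<zeta> where \<zeta>: "\<And>x. lf l (u *v x) = \<zeta> * lf l x"
      using lf_image_kernel[OF l0] H(2) l(2) by blast
    define \<gamma> where "\<gamma> = lift_power w g j"
    have \<gamma>: "\<gamma> \<in> lifted_braids u" "braid_of \<gamma> = b [^]\<^bsub>B\<^esub> j" using lift[of j] by (auto simp: \<gamma>_def j)
    have "matrix_power u d = mat 1"
      using matrix_power_periodic[OF wd, of j] by (simp add: j matrix_power_mult[symmetric] mult.commute)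
    then have gd: "lift_power u \<gamma> d \<in> lifted_braids (mat 1)" "braid_of (lift_power u \<gamma> d) = b [^]\<^bsub>B\<^esub> (j * d)"
      using lift_power[OF uW \<gamma>(1), of d] \<gamma>(2) b(1) by (auto simp: B.nat_pow_pow)
    then have "braid_of (lift_power u \<gamma> d) \<in> ?D" using pow by simp
    then have "winding_number (lf l \<circ> lift_power u \<gamma> d) 0 = 0"
      by (rule pure_commutators_winding[OF A(3) l(1) gd(1)])
    then have w0: "winding_number (lf l \<circ> \<gamma>) 0 = 0"
      using winding_lift_power[OF A(3) l(1) uW \<gamma>(1) \<zeta>, of d] d0 by simp
    have "path_in (arr_complement A) \<gamma>" using \<gamma>(1) A(3) by (simp add: lifted_braids_def)
    from lf_path_image_compose[OF this l(1)]
    have "pathfinish (lf l \<circ> \<gamma>) = pathstart (lf l \<circ> \<gamma>)"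
      using winding_number_exp_2pi[of "lf l \<circ> \<gamma>" 0] w0 by simp
    then have "\<zeta> * lf l x0 = lf l x0"
      using \<gamma>(1) \<zeta> by (simp add: lifted_braids_def pathfinish_compose pathstart_compose)
    moreover have "lf l x0 \<noteq> 0" using x0 A(3) l(1) by (auto simp: arr_complement_def)
    ultimately have "\<zeta> = 1" by simp
    then have "lf l (u *v x) = lf l x" using \<zeta> by simp
    moreover have "u *v x = z ^ j *s x" using matrix_power_eigen[OF x(3)] by (simp add: j)
    moreover have "lf l x \<noteq> 0" using x(1) A(3) l(1) by (auto simp: arr_complement_def)
    ultimately have "z ^ j = 1" by (simp add: lf_scale)
    then show "u = mat 1" using fix_one j by simp
  qed
  then show ?thesis
    using reg_w unfolding freely_regular_number_def acts_freely_on_def by blast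
qed

end

theorem proposition3p2:
  fixes W :: "(complex^'n^'n) set" and x0 :: "complex^'n" and d :: nat
  assumes "complex_reflection_group W"
    and "x0 \<in> hyperplane_complement W"
    and "regular_number W d"
    and "\<exists>c \<in> carrier (braid_quotient W x0).
           group.ord (braid_quotient W x0) c = d \<and>
           regular_element W (braid_quotient_to_group W x0 c)"
  shows "freely_regular_number W d"
proof -
  interpret braid_setup W x0
    using complex_reflection_group_locale[OF assms(1)] assms(2)
    by (intro braid_setup.intro braid_setup_axioms.intro)
  have "d > 0" using assms(3)
    by (auto simp: regular_number_def regular_with_order_def has_mult_order_def)
  then show ?thesis using assms(4) torsion_imp_freely_regular by blast
qed

end
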